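(* Let $c_1\ge c_2>0$ and let $\{Y_v\}_{v\in\mathbb N^2}$ be independent exponential random variables with $Y_{(i,j)}\sim \mathrm{Exp}(c_1)$ if $i<j$, $Y_{(i,j)}\sim\mathrm{Exp}(c_1\wedge c_2)$ if $i=j$, and $Y_{(i,j)}\sim\mathrm{Exp}(c_2)$ if $i>j$. For $(m,n)\in\mathbb N^2$ let $$G(m,n)=\max_{\pi\in\Pi(m,n)}\sum_{v\in\pi}Y_v,$$ where $\Pi(m,n)$ is the set of nearest-neighbour paths $(1,1)=v_1,v_2,\dots,v_{m+n-1}=(m,n)$ with $v_{i+1}-v_i\in\{(1,0),(0,1)\}$. Put $c=c_1/c_2\ge 1$ and $b=2c-1-2\sqrt{c(c-1)}$. Then for every $(x,y)\in(0,\infty)^2$ the almost sure limit $\Phi(x,y)=\lim_{n\to\infty}n^{-1}G(\lfloor nx\rfloor,\lfloor ny\rfloor)$ exists and equals $$\Phi(x,y)=\begin{cases} c_1^{-1}(\sqrt x+\sqrt y)^2, & 0<x\le b^2y,\\[3pt] x\,\dfrac{4c-(1+b)^2}{c_1(1-b^2)}+y\,\dfrac{(1+b)^2-4cb^2}{c_1(1-b^2)}, & b^2y<x<y,\\[3pt] c_2^{-1}(\sqrt x+\sqrt y)^2, & y\le x<\infty.\end{cases}$$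
   Context: $\mathrm{Exp}(r)$ denotes the exponential distribution with density $re^{-rx}$ on $(0,\infty)$ (mean $1/r$). $\mathbb N=\{1,2,3,\dots\}$. *)

theory Defs
  imports "HOL-Probability.Probability"
begin

definition Nsq :: "(nat \<times> nat) set" where
  "Nsq = {(i, j). 1 \<le> i \<and> 1 \<le> j}"

definition lpp_rate :: "real \<Rightarrow> real \<Rightarrow> nat \<times> nat \<Rightarrow> real" where
  "lpp_rate c1 c2 v = (case v of (i, j) \<Rightarrow>
     if i < j then c1 else if i = j then min c1 c2 else c2)"

definition up_right_paths :: "nat \<Rightarrow> nat \<Rightarrow> (nat \<times> nat) list set" where
  "up_right_paths m n = {p. length p = m + n - 1 \<and> p \<noteq> [] \<and>
      hd p = (1, 1) \<and> last p = (m, n) \<and>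
      (\<forall>k. Suc k < length p \<longrightarrow>
          (p ! Suc k = (fst (p ! k) + 1, snd (p ! k)) \<or>
           p ! Suc k = (fst (p ! k), snd (p ! k) + 1)))}"

definition lpp_G :: "(nat \<times> nat \<Rightarrow> 'a \<Rightarrow> real) \<Rightarrow> nat \<Rightarrow> nat \<Rightarrow> 'a \<Rightarrow> real" where
  "lpp_G Y m n \<omega> = Max ((\<lambda>p. \<Sum>v\<leftarrow>p. Y v \<omega>) ` up_right_paths m n)"

definition lpp_Phi :: "real \<Rightarrow> real \<Rightarrow> real \<Rightarrow> real \<Rightarrow> real" where
  "lpp_Phi c1 c2 x y =
    (let c = c1 / c2; b = 2 * c - 1 - 2 * sqrt (c * (c - 1)) in
     if x \<le> b^2 * y then (sqrt x + sqrt y)^2 / c1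
     else if x < y then
       x * (4 * c - (1 + b)^2) / (c1 * (1 - b^2))
       + y * ((1 + b)^2 - 4 * c * b^2) / (c1 * (1 - b^2))
     else (sqrt x + sqrt y)^2 / c2)"

end

theory Submission
  imports Defs
begin

text \<open>The rescaled weights \<open>X v = rate v * Y v\<close> are i.i.d. \<open>Exp(1)\<close>. For them, consider the
  stationary last-passage times with boundary weights \<open>Exp(1 - r)\<close> on the horizontal and
  \<open>Exp(r)\<close> on the vertical axis. By the Burke property the increments along every column are
  i.i.d., so the stationary time to \<open>(m, n)\<close> is a sum of two i.i.d. sums and concentrates around
  \<open>m / (1 - r) + n / r\<close> exponentially well. It dominates the last-passage time, which gives the upper
  bound for every \<open>r\<close>. At the characteristic \<open>r = sqrt y / (sqrt x + sqrt y)\<close> a stationary geodesic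
  cannot leave the axes far from the origin, as these upper bounds with nearby parameters show, so the
  last-passage time is also at least \<open>N ((sqrt x + sqrt y)\<^sup>2 - \<epsilon>)\<close>.

  In the two-phase environment a path to a point above the diagonal leaves the diagonal for the last
  time at some \<open>(k + 1, k + 1)\<close>; inserting the linear upper bounds for the two pieces, with
  \<open>1 / (1 - r) + 1 / r \<ge> 4 c1 / c2\<close>, gives a bound that does not increase with \<open>k\<close>. The matching lower
  bound follows the diagonal through boxes placed strictly below it and then crosses one box of the
  homogeneous environment.\<close>


subsection \<open>Last-passage times\<close>

text \<open>Burke's theorem asks that the two boundary rates add up to the bulk rate,
  \<open>(1 - r) + r = 1\<close>. So the stationary models form a one-parameter family, and
  \<open>(sqrt x + sqrt y)^2\<close> is the minimum of \<open>x / (1 - r) + y / r\<close> over it.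

  All upper deviation bounds are exponential in \<open>N\<close> with one constant for all endpoints
  with coordinates at most \<open>D * N\<close>. Union bounds over the order \<open>N\<close> many
  exit points, or points where a path leaves the diagonal, therefore stay summable, and
  Borel-Cantelli gives the limit along the whole sequence.

  The constant \<open>b\<close> marks where the diagonal starts to pay. A step \<open>(1, 1)\<close>
  along it is worth \<open>4 / c2\<close>, whereas the shape \<open>(sqrt x + sqrt y)^2 / c1\<close>
  has derivative \<open>(1 / (1 - r) + 1 / r) / c1\<close> in direction \<open>(1, 1)\<close>, with
  \<open>r\<close> characteristic for \<open>(x, y)\<close>. The two agree for
  \<open>r = 1 / (1 + b)\<close>, that is, in the direction \<open>x = b^2 * y\<close>. Between this
  direction and the diagonal the best path follows the diagonal and then leaves it in the critical
  direction, which makes the limit linear there.\<close>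

fun last_passage :: "(nat \<times> nat \<Rightarrow> real) \<Rightarrow> nat \<Rightarrow> nat \<Rightarrow> real" where
  "last_passage w 0 j = 0"
| "last_passage w (Suc i) 0 = 0"
| "last_passage w (Suc i) (Suc j) =
     w (Suc i, Suc j) + max (last_passage w i (Suc j)) (last_passage w (Suc i) j)"

text \<open>The value type stays open because the shift acts both on weight configurations and on
  families of random variables.\<close>

definition shifted :: "nat \<Rightarrow> nat \<Rightarrow> (nat \<times> nat \<Rightarrow> 'b) \<Rightarrow> nat \<times> nat \<Rightarrow> 'b" where
  "shifted k l w = (\<lambda>(i, j). w (i + k, j + l))"

definition nonneg_on :: "(nat \<times> nat) set \<Rightarrow> (nat \<times> nat \<Rightarrow> real) \<Rightarrow> bool" where
  "nonneg_on A w \<longleftrightarrow> (\<forall>v\<in>A. 0 \<le> w v)"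

lemma mem_Nsq [simp]: "(i, j) \<in> Nsq \<longleftrightarrow> 1 \<le> i \<and> 1 \<le> j"
  by (simp add: Nsq_def)

lemma shifted_apply [simp]: "shifted k l w (i, j) = w (i + k, j + l)"
  by (simp add: shifted_def)

lemma last_passage_0 [simp]: "last_passage w i 0 = 0"
  by (cases i) auto

lemma last_passage_nonneg: "nonneg_on Nsq w \<Longrightarrow> 0 \<le> last_passage w i j"
  by (induction w i j rule: last_passage.induct) (auto simp: nonneg_on_def le_max_iff_disj intro!: add_nonneg_nonneg)

lemma last_passage_Suc1: "nonneg_on Nsq w \<Longrightarrow> last_passage w i j \<le> last_passage w (Suc i) j"
proof (cases j)
  case (Suc j')
  assume "nonneg_on Nsq w"
  then have "0 \<le> w (Suc i, Suc j')" by (auto simp: nonneg_on_def)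
  then show ?thesis using Suc by simp
qed simp

lemma last_passage_Suc2: "nonneg_on Nsq w \<Longrightarrow> last_passage w i j \<le> last_passage w i (Suc j)"
proof (cases i)
  case (Suc i')
  assume "nonneg_on Nsq w"
  then have "0 \<le> w (Suc i', Suc j)" by (auto simp: nonneg_on_def)
  then show ?thesis using Suc by simp
qed simp

lemma last_passage_mono:
  assumes "nonneg_on Nsq w" "i \<le> i'" "j \<le> j'"
  shows "last_passage w i j \<le> last_passage w i' j'"
proof -
  have "last_passage w i j \<le> last_passage w i' j"
    using lift_Suc_mono_le[of "\<lambda>i. last_passage w i j", OF last_passage_Suc1] assms by blast
  also have "\<dots> \<le> last_passage w i' j'"
    using lift_Suc_mono_le[of "\<lambda>j. last_passage w i' j", OF last_passage_Suc2] assms by blast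
  finally show ?thesis .
qed

lemma last_passage_weight_mono:
  assumes "\<And>a b. 1 \<le> a \<Longrightarrow> a \<le> i \<Longrightarrow> 1 \<le> b \<Longrightarrow> b \<le> j \<Longrightarrow> w (a, b) \<le> w' (a, b)"
  shows "last_passage w i j \<le> last_passage w' i j"
  using assms
proof (induction w i j rule: last_passage.induct)
  case (3 w i j)
  have "last_passage w i (Suc j) \<le> last_passage w' i (Suc j)" using 3 by simp
  moreover have "last_passage w (Suc i) j \<le> last_passage w' (Suc i) j" using 3 by simp
  moreover have "w (Suc i, Suc j) \<le> w' (Suc i, Suc j)" using 3 by simp
  ultimately show ?case by simp
qed auto

lemma last_passage_divide:
  assumes "c > 0"
  shows "last_passage (\<lambda>v. w v / c) i j = last_passage w i j / c"
  by (induction w i j rule: last_passage.induct)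
     (use assms in \<open>auto simp: add_divide_distrib max_divide_distrib_right max_def divide_right_mono divide_le_cancel\<close>)

text \<open>A path to \<open>(a, b)\<close> and a path from \<open>(a + 1, b + 1)\<close> can be
  joined through a cell of nonnegative weight. The shifted recursion copies the original one, so
  only its base cases need an argument, namely monotonicity.\<close>

lemma last_passage_superadditive:
  assumes w: "nonneg_on Nsq w"
  shows "last_passage w a b + last_passage (shifted a b w) m n \<le> last_passage w (a + m) (b + n)"
proof (induction "shifted a b w" m n rule: last_passage.induct)
  case (3 i j)
  then show ?case by (simp add: add.commute)
qed (use last_passage_mono[OF w, of a a b] last_passage_mono[OF w, of a _ b b] in auto)

lemma last_passage_shift_le:
  assumes w: "nonneg_on Nsq w"
  shows "last_passage (shifted a b w) m n \<le> last_passage w (a + m) (b + n)"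
  using last_passage_superadditive[OF w, of a b m n] last_passage_nonneg[OF w, of a b] by simp

lemma last_passage_chain:
  assumes w: "nonneg_on Nsq w"
  shows "(\<Sum>k<K. last_passage (shifted (p + k * m) (q + k * n) w) m n) \<le> last_passage w (p + K * m) (q + K * n)"
proof (induction K)
  case 0
  then show ?case using last_passage_nonneg[OF w] by simp
next
  case (Suc K)
  show ?case
    using Suc last_passage_superadditive[OF w, of "p + K * m" "q + K * n" m n]
    by (simp add: add_ac)
qed

subsection \<open>Stationary last-passage times\<close>

text \<open>Paths start at the origin and may run along an axis, collecting its weights, before they
  enter the quadrant. The function is deterministic; stationarity is a property of the law
  \<open>stat_space\<close> of \<open>w\<close>.\<close>

fun stat_passage :: "(nat \<times> nat \<Rightarrow> real) \<Rightarrow> nat \<Rightarrow> nat \<Rightarrow> real" where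
  "stat_passage w 0 0 = 0"
| "stat_passage w 0 (Suc j) = stat_passage w 0 j + w (0, Suc j)"
| "stat_passage w (Suc i) 0 = stat_passage w i 0 + w (Suc i, 0)"
| "stat_passage w (Suc i) (Suc j) =
     w (Suc i, Suc j) + max (stat_passage w i (Suc j)) (stat_passage w (Suc i) j)"

lemma stat_passage_row: "stat_passage w i 0 = (\<Sum>a=1..i. w (a, 0))"
  by (induction i) auto

lemma stat_passage_col: "stat_passage w 0 j = (\<Sum>b=1..j. w (0, b))"
  by (induction j) auto

lemma last_passage_le_stat_passage:
  assumes "nonneg_on UNIV w"
  shows "last_passage w i j \<le> stat_passage w i j"
  using assms
proof (induction w i j rule: last_passage.induct)
  case (1 w j)
  then show ?case by (auto simp: stat_passage_col nonneg_on_def intro!: sum_nonneg)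
next
  case (2 w i)
  then show ?case unfolding stat_passage_row
    by (auto simp: nonneg_on_def simp del: sum.cl_ivl_Suc intro!: sum_nonneg)
qed auto

lemma last_passage_shift_step:
  assumes "k \<le> i" "l \<le> j"
  shows "w (Suc i, Suc j) + last_passage (shifted k l w) (i - k) (Suc j - l)
           \<le> last_passage (shifted k l w) (Suc i - k) (Suc j - l)" (is ?A)
    and "w (Suc i, Suc j) + last_passage (shifted k l w) (Suc i - k) (j - l)
           \<le> last_passage (shifted k l w) (Suc i - k) (Suc j - l)" (is ?B)
proof -
  have "Suc i - k = Suc (i - k)" "Suc j - l = Suc (j - l)"
    using assms by auto
  moreover have "shifted k l w (Suc (i - k), Suc (j - l)) = w (Suc i, Suc j)"
    using assms by simp
  ultimately show ?A ?B by auto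
qed

text \<open>The maximising branch of the recursion is traced back to an axis. If
  \<open>(k + 1, 0)\<close> is the last vertex on the axis, the path enters the quadrant at
  \<open>(k + 1, 1)\<close>, which is the cell \<open>(1, 1)\<close> after a shift by
  \<open>k\<close>; hence \<open>Suc k\<close> boundary weights go with a shift by
  \<open>k\<close>.\<close>

lemma stat_passage_exit:
  assumes w: "nonneg_on Nsq w"
  shows "(\<exists>k\<le>i. stat_passage w (Suc i) (Suc j)
                \<le> (\<Sum>a=1..Suc k. w (a, 0)) + last_passage (shifted k 0 w) (Suc i - k) (Suc j))
       \<or> (\<exists>l\<le>j. stat_passage w (Suc i) (Suc j)
                \<le> (\<Sum>b=1..Suc l. w (0, b)) + last_passage (shifted 0 l w) (Suc i) (Suc j - l))"
    (is "?H i j \<or> ?V i j")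
proof (induction "i + j" arbitrary: i j rule: less_induct)
  case less
  consider (left) "stat_passage w (Suc i) (Suc j) = w (Suc i, Suc j) + stat_passage w i (Suc j)"
    | (down) "stat_passage w (Suc i) (Suc j) = w (Suc i, Suc j) + stat_passage w (Suc i) j"
    by (cases "stat_passage w i (Suc j) \<le> stat_passage w (Suc i) j") auto
  then show ?case
  proof cases
    case left
    show ?thesis
    proof (cases i)
      case 0
      \<comment> \<open>The predecessor \<open>(0, j + 1)\<close> lies on the vertical axis; exiting
        there, with \<open>l = j\<close>, leaves a box of a single cell.\<close>
      have "?V i j"
        using 0 left by (intro exI[of _ j]) (auto simp: stat_passage_col)
      then show ?thesis ..
    next
      case (Suc i')
      with less[of i' j] consider "?H i' j" | "?V i' j" by auto
      then show ?thesis
      proof cases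
        case 1
        then obtain k where k: "k \<le> i'" "stat_passage w i (Suc j)
            \<le> (\<Sum>a=1..Suc k. w (a, 0)) + last_passage (shifted k 0 w) (i - k) (Suc j)"
          using Suc by auto
        with last_passage_shift_step(1)[of k i 0 j w] Suc left show ?thesis
          by (intro disjI1 exI[of _ k]) auto
      next
        case 2
        then obtain l where l: "l \<le> j" "stat_passage w i (Suc j)
            \<le> (\<Sum>b=1..Suc l. w (0, b)) + last_passage (shifted 0 l w) i (Suc j - l)"
          using Suc by auto
        with last_passage_shift_step(1)[of 0 i l j w] left show ?thesis
          by (intro disjI2 exI[of _ l]) auto
      qed
    qed
  next
    case down
    show ?thesis
    proof (cases j)
      case 0
      have "?H i j"
        using 0 down by (intro exI[of _ i]) (auto simp del: sum.cl_ivl_Suc simp: stat_passage_row)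
      then show ?thesis ..
    next
      case (Suc j')
      with less[of i j'] consider "?H i j'" | "?V i j'" by auto
      then show ?thesis
      proof cases
        case 1
        then obtain k where k: "k \<le> i" "stat_passage w (Suc i) j
            \<le> (\<Sum>a=1..Suc k. w (a, 0)) + last_passage (shifted k 0 w) (Suc i - k) j"
          using Suc by auto
        with last_passage_shift_step(2)[of k i 0 j w] down show ?thesis
          by (intro disjI1 exI[of _ k]) auto
      next
        case 2
        then obtain l where l: "l \<le> j'" "stat_passage w (Suc i) j
            \<le> (\<Sum>b=1..Suc l. w (0, b)) + last_passage (shifted 0 l w) (Suc i) (j - l)"
          using Suc by auto
        with last_passage_shift_step(2)[of 0 i l j w] Suc down show ?thesis
          by (intro disjI2 exI[of _ l]) auto
      qed
    qed
  qed
qed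

text \<open>A path into the region above the diagonal leaves the diagonal for the last time at some
  \<open>(k + 1, k + 1)\<close>; before that its weights are at most those with rate \<open>c2\<close>, afterwards
  all rates are \<open>c1\<close>.\<close>

lemma two_phase_upper:
  assumes X: "nonneg_on Nsq X" and c: "c1 \<ge> c2" "c2 > 0"
    and Y: "\<And>v. v \<in> Nsq \<Longrightarrow> Y v = X v / lpp_rate c1 c2 v"
    and mn: "1 \<le> m" "m \<le> n"
  shows "\<exists>k<m. last_passage Y m n \<le> last_passage X (Suc k) (Suc k) / c2
            + last_passage (shifted k (Suc k) X) (m - k) (n - Suc k) / c1"
  using mn
proof (induction "m + n" arbitrary: m n rule: less_induct)
  case less
  have X0: "0 \<le> X (a, b)" if "1 \<le> a" "1 \<le> b" for a b
    using X that by (auto simp: nonneg_on_def)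
  show ?case
  proof (cases "m = n")
    case True
    have "last_passage Y m n \<le> last_passage (\<lambda>v. X v / c2) m n"
      using X0 c by (intro last_passage_weight_mono) (auto simp: Y lpp_rate_def intro!: divide_left_mono)
    also have "\<dots> = last_passage X m n / c2"
      using c by (simp add: last_passage_divide)
    \<comment> \<open>On the diagonal the witness is \<open>k = m - 1\<close>; the second box then
      has height \<open>n - m = 0\<close> and contributes nothing.\<close>
    finally show ?thesis
      using True less.prems by (intro exI[of _ "m - 1"]) auto
  next
    case False
    with less.prems have "m < n" by simp
    obtain m' n' where m': "m = Suc m'" and n': "n = Suc n'"
      using less.prems by (metis Suc_le_D One_nat_def le_trans)
    have Ymn: "Y (m, n) = X (m, n) / c1"
      using \<open>m < n\<close> less.prems by (simp add: Y lpp_rate_def)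
    have c1: "c1 > 0" using c by simp
    consider (left) "last_passage Y m n = X (m, n) / c1 + last_passage Y m' n"
      | (down) "last_passage Y m n = X (m, n) / c1 + last_passage Y m n'"
      using Ymn m' n' by (cases "last_passage Y m' n \<le> last_passage Y m n'") auto
    then show ?thesis
    proof cases
      case left
      show ?thesis
      proof (cases "m' = 0")
        case True
        \<comment> \<open>Here \<open>m = 1\<close> and the branch points at the value 0 on the
          axis, so there is no shorter path to extend; with \<open>k = 0\<close> the single cell
          already gives the bound.\<close>
        obtain n'' where n'': "n' = Suc n''" using \<open>m < n\<close> m' n' by (cases n') auto
        have "last_passage Y m n = X (m, n) / c1" using left True by simp
        also have "\<dots> \<le> last_passage (shifted 0 1 X) 1 n' / c1"
          using last_passage_shift_step(1)[of 0 0 1 n' X] True m' n' n'' c1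
          by (simp add: divide_right_mono)
        also have "\<dots> \<le> last_passage X 1 1 / c2 + \<dots>"
          using last_passage_nonneg[OF X, of 1 1] c by simp
        finally show ?thesis using True m' n' by (intro exI[of _ 0]) auto
      next
        case False
        then obtain k where k: "k < m'" "last_passage Y m' n \<le> last_passage X (Suc k) (Suc k) / c2
            + last_passage (shifted k (Suc k) X) (m' - k) (n - Suc k) / c1"
          using less.hyps[of m' n] \<open>m < n\<close> m' by auto
        have "X (m, n) / c1 + last_passage (shifted k (Suc k) X) (m' - k) (n - Suc k) / c1
            \<le> last_passage (shifted k (Suc k) X) (m - k) (n - Suc k) / c1"
          unfolding add_divide_distrib[symmetric] using \<open>m < n\<close> k m' n' c1
          by (intro divide_right_mono) (use last_passage_shift_step(1)[of k m' "Suc k" n' X] in auto)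
        with k left m' show ?thesis by (intro exI[of _ k]) auto
      qed
    next
      case down
      then obtain k where k: "k < m" "last_passage Y m n' \<le> last_passage X (Suc k) (Suc k) / c2
          + last_passage (shifted k (Suc k) X) (m - k) (n' - Suc k) / c1"
        using less.hyps[of m n'] \<open>m < n\<close> less.prems n' by auto
      have "X (m, n) / c1 + last_passage (shifted k (Suc k) X) (m - k) (n' - Suc k) / c1
          \<le> last_passage (shifted k (Suc k) X) (m - k) (n - Suc k) / c1"
        unfolding add_divide_distrib[symmetric] using \<open>m < n\<close> k m' n' c1
        by (intro divide_right_mono) (use last_passage_shift_step(2)[of k m' "Suc k" n' X] in auto)
      with k down show ?thesis by (intro exI[of _ k]) auto
    qed
  qed
qed

subsection \<open>Up-right paths and the recursion\<close>

lemma up_right_paths_bounds: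
  assumes "p \<in> up_right_paths m n" "k < length p"
  shows "1 \<le> fst (p ! k) \<and> 1 \<le> snd (p ! k)"
  using assms(2)
proof (induction k)
  case 0
  then show ?case using assms by (auto simp: up_right_paths_def hd_conv_nth)
next
  case (Suc k)
  then have "p ! Suc k = (fst (p ! k) + 1, snd (p ! k)) \<or> p ! Suc k = (fst (p ! k), snd (p ! k) + 1)"
    using assms by (auto simp: up_right_paths_def)
  then show ?case using Suc by auto
qed

lemma up_right_paths_empty: "m = 0 \<or> n = 0 \<Longrightarrow> up_right_paths m n = {}"
proof (rule ccontr)
  assume mn: "m = 0 \<or> n = 0" and "up_right_paths m n \<noteq> {}"
  then obtain p where p: "p \<in> up_right_paths m n" by auto
  then have "last p = (m, n)" "p \<noteq> []" by (auto simp: up_right_paths_def)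
  then have "p ! (length p - 1) = (m, n)" "length p - 1 < length p" by (auto simp: last_conv_nth)
  with up_right_paths_bounds[OF p, of "length p - 1"] mn show False by auto
qed

lemma up_right_paths_1: "up_right_paths 1 1 = {[(1, 1)]}"
proof -
  have "p = [(1, 1)]" if "length p = Suc 0" "hd p = (Suc 0, Suc 0)" for p :: "(nat \<times> nat) list"
    using that by (cases p) auto
  then show ?thesis by (auto simp: up_right_paths_def)
qed

lemma up_right_paths_Suc:
  assumes "(m, n) \<noteq> (0, 0)"
  shows "up_right_paths (Suc m) (Suc n) =
           (\<lambda>p. p @ [(Suc m, Suc n)]) ` (up_right_paths m (Suc n) \<union> up_right_paths (Suc m) n)"
    (is "?L = ?R")
proof (intro subset_antisym subsetI)
  fix p assume p: "p \<in> ?L"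
  define q where "q = butlast p"
  have len: "length p = m + n + 1" and last: "last p = (Suc m, Suc n)" and "p \<noteq> []"
    using p by (auto simp: up_right_paths_def)
  then have pq: "p = q @ [(Suc m, Suc n)]" unfolding q_def by (metis append_butlast_last_id)
  have lenq: "length q = m + n" using len pq by simp
  have "q \<noteq> []" using lenq assms by auto
  have step: "p ! Suc k = (fst (p ! k) + 1, snd (p ! k)) \<or> p ! Suc k = (fst (p ! k), snd (p ! k) + 1)"
    if "Suc k < length p" for k
    using p that by (auto simp: up_right_paths_def)
  have stepq: "q ! Suc k = (fst (q ! k) + 1, snd (q ! k)) \<or> q ! Suc k = (fst (q ! k), snd (q ! k) + 1)"
    if "Suc k < length q" for k
    using step[of k] that by (simp add: pq nth_append)
  have hd: "hd q = (1, 1)" using p \<open>q \<noteq> []\<close> by (auto simp: up_right_paths_def pq)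
  have *: "(Suc m, Suc n) = (fst (last q) + 1, snd (last q)) \<or> (Suc m, Suc n) = (fst (last q), snd (last q) + 1)"
    using step[of "length q - 1"] \<open>q \<noteq> []\<close> by (auto simp: pq nth_append last_conv_nth)
  then have "last q = (m, Suc n) \<or> last q = (Suc m, n)"
    by (cases "last q") auto
  then have "q \<in> up_right_paths m (Suc n) \<union> up_right_paths (Suc m) n"
    unfolding up_right_paths_def using stepq hd lenq \<open>q \<noteq> []\<close> by auto
  then show "p \<in> ?R" using pq by blast
next
  fix p assume "p \<in> ?R"
  then obtain q where pq: "p = q @ [(Suc m, Suc n)]"
    and q: "q \<in> up_right_paths m (Suc n) \<union> up_right_paths (Suc m) n" by auto
  then have len: "length q = m + n" "q \<noteq> []" "hd q = (1, 1)" and "last q = (m, Suc n) \<or> last q = (Suc m, n)"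
    and step: "\<And>k. Suc k < length q \<Longrightarrow>
      q ! Suc k = (fst (q ! k) + 1, snd (q ! k)) \<or> q ! Suc k = (fst (q ! k), snd (q ! k) + 1)"
    by (auto simp: up_right_paths_def)
  then have l: "(Suc m, Suc n) = (fst (last q) + 1, snd (last q)) \<or> (Suc m, Suc n) = (fst (last q), snd (last q) + 1)"
    by auto
  have "p ! Suc k = (fst (p ! k) + 1, snd (p ! k)) \<or> p ! Suc k = (fst (p ! k), snd (p ! k) + 1)"
    if "Suc k < length p" for k
  proof (cases "Suc k < length q")
    case True
    then show ?thesis using step[of k] by (simp add: pq nth_append)
  next
    case False
    then have "k = length q - 1" "Suc k = length q" using that pq len by auto
    then show ?thesis using l len by (auto simp: pq nth_append last_conv_nth)
  qed
  then show "p \<in> ?L" using len by (auto simp: up_right_paths_def pq)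
qed

text \<open>Identifies the recursion with a maximum over paths. The delicate point is a neighbour on
  an axis: it has no paths but value 0 in the recursion, and nonnegativity ensures that this 0 does
  not beat the other neighbour.\<close>

lemma last_passage_path_sums:
  assumes w: "nonneg_on Nsq w" and "1 \<le> m" "1 \<le> n"
  shows "finite (up_right_paths m n) \<and> up_right_paths m n \<noteq> {} \<and>
         (\<forall>p\<in>up_right_paths m n. (\<Sum>v\<leftarrow>p. w v) \<le> last_passage w m n) \<and>
         (\<exists>p\<in>up_right_paths m n. (\<Sum>v\<leftarrow>p. w v) = last_passage w m n)"
  using assms(2,3)
proof (induction "m + n" arbitrary: m n rule: less_induct)
  case less
  obtain i j where ij: "m = Suc i" "n = Suc j"
    using less.prems by (metis Suc_le_D One_nat_def)
  show ?case
  proof (cases "i = 0 \<and> j = 0")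
    case True
    then show ?thesis using ij up_right_paths_1 by simp
  next
    case False
    let ?A = "up_right_paths i n" and ?B = "up_right_paths m j"
    have eq: "up_right_paths m n = (\<lambda>p. p @ [(m, n)]) ` (?A \<union> ?B)"
      using up_right_paths_Suc[of i j] False ij by auto
    have A: "finite ?A \<and> (\<forall>p\<in>?A. (\<Sum>v\<leftarrow>p. w v) \<le> last_passage w i n) \<and>
        (if i = 0 then ?A = {} else (\<exists>p\<in>?A. (\<Sum>v\<leftarrow>p. w v) = last_passage w i n))"
      using less.hyps[of i n] up_right_paths_empty[of i n] ij by (cases "i = 0") auto
    have B: "finite ?B \<and> (\<forall>p\<in>?B. (\<Sum>v\<leftarrow>p. w v) \<le> last_passage w m j) \<and>
        (if j = 0 then ?B = {} else (\<exists>p\<in>?B. (\<Sum>v\<leftarrow>p. w v) = last_passage w m j))"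
      using less.hyps[of m j] up_right_paths_empty[of m j] ij by (cases "j = 0") auto
    have rec: "last_passage w m n = w (m, n) + max (last_passage w i n) (last_passage w m j)"
      using ij by simp
    have "\<exists>p\<in>?A \<union> ?B. (\<Sum>v\<leftarrow>p. w v) = max (last_passage w i n) (last_passage w m j)"
    \<comment> \<open>The split selects a neighbour that attains the maximum and has paths; one on
      an axis is never selected.\<close>
    proof (cases "i = 0 \<or> (j \<noteq> 0 \<and> last_passage w i n \<le> last_passage w m j)")
      case True
      then have "j \<noteq> 0" using False by auto
      have "last_passage w i n \<le> last_passage w m j"
        using True last_passage_nonneg[OF w, of m j] by auto
      then show ?thesis using B \<open>j \<noteq> 0\<close> by (auto simp: max_def)
    next
      case F: False
      have "last_passage w m j \<le> last_passage w i n"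
        using F last_passage_nonneg[OF w, of i n] by auto
      then show ?thesis using A F by (auto simp: max_def)
    qed
    then obtain p where p: "p \<in> ?A \<union> ?B" "(\<Sum>v\<leftarrow>p. w v) = max (last_passage w i n) (last_passage w m j)"
      by blast
    have "(\<Sum>v\<leftarrow>p. w v) \<le> max (last_passage w i n) (last_passage w m j)" if "p \<in> ?A \<union> ?B" for p
      using that A B by (fastforce simp: le_max_iff_disj)
    then have "\<forall>p\<in>up_right_paths m n. (\<Sum>v\<leftarrow>p. w v) \<le> last_passage w m n"
      unfolding eq rec by auto
    moreover have "\<exists>p\<in>up_right_paths m n. (\<Sum>v\<leftarrow>p. w v) = last_passage w m n"
      unfolding eq rec using p by (intro bexI[of _ "p @ [(m, n)]"]) auto
    moreover have "finite (up_right_paths m n)" unfolding eq using A B by simp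
    ultimately show ?thesis by blast
  qed
qed

lemma lpp_G_eq_last_passage:
  assumes w: "nonneg_on Nsq (\<lambda>v. Y v \<omega>)" and "1 \<le> m" "1 \<le> n"
  shows "lpp_G Y m n \<omega> = last_passage (\<lambda>v. Y v \<omega>) m n"
  unfolding lpp_G_def using last_passage_path_sums[OF w assms(2,3)]
  by (intro Max_eqI) (auto intro: rev_image_eqI)


subsection \<open>Burke's theorem for a single cell\<close>

abbreviation expo :: "real \<Rightarrow> real measure" where
  "expo a \<equiv> density lborel (\<lambda>x. ennreal (exponential_density a x))"

lemma nn_integral_expo:
  assumes [measurable]: "f \<in> borel_measurable borel"
  shows "(\<integral>\<^sup>+x. f x \<partial>expo a) = (\<integral>\<^sup>+x. ennreal (exponential_density a x) * f x \<partial>lborel)"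
  by (simp add: nn_integral_density)

lemma sigma_finite_expo: "0 < a \<Longrightarrow> sigma_finite_measure (expo a)"
  using prob_space_exponential_density[of a] prob_space_imp_sigma_finite by blast

text \<open>The substitution \<open>I = J + d\<close> makes the joint density factor: the minimum
  has law \<open>Exp(a + b)\<close> and is independent of the difference, whose two-sided
  exponential density is \<open>h\<close>. This is the memoryless property in integral form.\<close>

lemma nn_integral_min_diff:
  assumes ab: "0 < a" "0 < b" and [measurable]: "f \<in> borel_measurable (borel \<Otimes>\<^sub>M borel)"
  defines "h \<equiv> \<lambda>d. a * b / (a + b) * (if 0 \<le> d then exp (- (a * d)) else exp (b * d))"
  shows "(\<integral>\<^sup>+J. (\<integral>\<^sup>+I. f (min I J, I - J) \<partial>expo a) \<partial>expo b)
       = (\<integral>\<^sup>+d. ennreal (h d) * (\<integral>\<^sup>+w. f (w, d) \<partial>expo (a + b)) \<partial>lborel)"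
proof -
  have [measurable]: "h \<in> borel_measurable borel" unfolding h_def by measurable
  have h0: "0 \<le> h d" for d using ab by (auto simp: h_def)
  let ?e = "exponential_density :: real \<Rightarrow> real \<Rightarrow> real"
  have e0: "0 \<le> ?e a x" "0 \<le> ?e b x" "0 \<le> ?e (a + b) x" for x
    using ab by (auto intro: exponential_density_nonneg)
  have "(\<integral>\<^sup>+J. (\<integral>\<^sup>+I. f (min I J, I - J) \<partial>expo a) \<partial>expo b)
      = (\<integral>\<^sup>+J. ennreal (?e b J) * (\<integral>\<^sup>+I. ennreal (?e a I) * f (min I J, I - J) \<partial>lborel) \<partial>lborel)"
    by (simp add: nn_integral_expo)
  also have "\<dots> = (\<integral>\<^sup>+J. ennreal (?e b J) * (\<integral>\<^sup>+d. ennreal (?e a (J + d)) * f (min (J + d) J, d) \<partial>lborel) \<partial>lborel)"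
  proof (intro nn_integral_cong)
    fix J :: real
    show "ennreal (?e b J) * (\<integral>\<^sup>+I. ennreal (?e a I) * f (min I J, I - J) \<partial>lborel)
        = ennreal (?e b J) * (\<integral>\<^sup>+d. ennreal (?e a (J + d)) * f (min (J + d) J, d) \<partial>lborel)"
      by (subst nn_integral_real_affine[where c = 1 and t = J]) auto
  qed
  also have "\<dots> = (\<integral>\<^sup>+J. (\<integral>\<^sup>+d. ennreal (?e b J * ?e a (J + d)) * f (min (J + d) J, d) \<partial>lborel) \<partial>lborel)"
    using e0 by (simp add: nn_integral_cmult[symmetric] ennreal_mult mult.assoc)
  also have "\<dots> = (\<integral>\<^sup>+d. (\<integral>\<^sup>+J. ennreal (?e b J * ?e a (J + d)) * f (min (J + d) J, d) \<partial>lborel) \<partial>lborel)"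
    by (rule lborel_pair.Fubini') measurable
  also have "\<dots> = (\<integral>\<^sup>+d. (\<integral>\<^sup>+w. ennreal (h d) * (ennreal (?e (a + b) w) * f (w, d)) \<partial>lborel) \<partial>lborel)"
  proof (rule nn_integral_cong)
    fix d :: real
    show "(\<integral>\<^sup>+J. ennreal (?e b J * ?e a (J + d)) * f (min (J + d) J, d) \<partial>lborel)
        = (\<integral>\<^sup>+w. ennreal (h d) * (ennreal (?e (a + b) w) * f (w, d)) \<partial>lborel)"
    proof (cases "0 \<le> d")
      case True
      have "?e b J * ?e a (J + d) = h d * ?e (a + b) J" for J
        using True ab by (auto simp: h_def exponential_density_def exp_add[symmetric] field_simps)
      then show ?thesis using True h0 e0
        by (intro nn_integral_cong) (auto simp: ennreal_mult mult.assoc)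
    next
      case False
      \<comment> \<open>For \<open>d < 0\<close> the minimum is \<open>J + d\<close>, so
        \<open>J = w - d\<close> is substituted in order to integrate over the minimum
        \<open>w\<close>.\<close>
      have *: "?e b (- d + w) * ?e a w = h d * ?e (a + b) w" for w
        using False ab by (auto simp: h_def exponential_density_def exp_add[symmetric] field_simps)
      show ?thesis
      proof (subst nn_integral_real_affine[where c = 1 and t = "- d"])
        show "ennreal \<bar>1\<bar> * (\<integral>\<^sup>+w. ennreal (?e b (- d + 1 * w) * ?e a (- d + 1 * w + d)) * f (min (- d + 1 * w + d) (- d + 1 * w), d) \<partial>lborel)
          = (\<integral>\<^sup>+w. ennreal (h d) * (ennreal (?e (a + b) w) * f (w, d)) \<partial>lborel)"
          using False h0 e0 * by (auto intro!: nn_integral_cong simp: ennreal_mult mult.assoc min_def)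
      qed auto
    qed
  qed
  also have "\<dots> = (\<integral>\<^sup>+d. ennreal (h d) * (\<integral>\<^sup>+w. f (w, d) \<partial>expo (a + b)) \<partial>lborel)"
    by (simp add: nn_integral_expo nn_integral_cmult)
  finally show ?thesis .
qed

text \<open>The outputs have minimum \<open>w\<close> and difference \<open>I - J\<close>. The minimum of the inputs is again
  independent of their difference and has the law of \<open>w\<close>, so inputs and outputs agree in law.\<close>

lemma burke_nn_integral:
  assumes ab: "0 < a" "0 < b" and g[measurable]: "g \<in> borel_measurable (borel \<Otimes>\<^sub>M borel)"
  shows "(\<integral>\<^sup>+w. (\<integral>\<^sup>+J. (\<integral>\<^sup>+I. g (w + max 0 (I - J), w + max 0 (J - I)) \<partial>expo a) \<partial>expo b) \<partial>expo (a + b))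
       = (\<integral>\<^sup>+J. (\<integral>\<^sup>+I. g (I, J) \<partial>expo a) \<partial>expo b)"
proof -
  \<comment> \<open>\<open>f\<close> expresses the outputs through the cell weight \<open>w\<close>
    and the difference \<open>d = I - J\<close>; at \<open>w = min I J\<close> it returns the value
    of \<open>g\<close> at the inputs.\<close>
  define f where "f = (\<lambda>(w, d). g (w + max 0 d, w + max 0 (- d)))"
  have [measurable]: "f \<in> borel_measurable (borel \<Otimes>\<^sub>M borel)"
    unfolding f_def by measurable
  define h where "h = (\<lambda>d. a * b / (a + b) * (if 0 \<le> d then exp (- (a * d)) else exp (b * d)))"
  have [measurable]: "h \<in> borel_measurable borel" unfolding h_def by measurable
  interpret E: prob_space "expo (a + b)"
    using ab by (intro prob_space_exponential_density) auto
  have E1: "emeasure (expo (a + b)) UNIV = 1"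
    using E.emeasure_space_1 by simp
  interpret P: pair_sigma_finite "expo (a + b)" lborel
    by (intro pair_sigma_finite.intro E.sigma_finite_measure_axioms sigma_finite_lborel)
  have "(\<integral>\<^sup>+w. (\<integral>\<^sup>+J. (\<integral>\<^sup>+I. g (w + max 0 (I - J), w + max 0 (J - I)) \<partial>expo a) \<partial>expo b) \<partial>expo (a + b))
      = (\<integral>\<^sup>+w. (\<integral>\<^sup>+J. (\<integral>\<^sup>+I. (\<lambda>(_, d). f (w, d)) (min I J, I - J) \<partial>expo a) \<partial>expo b) \<partial>expo (a + b))"
    by (simp add: f_def)
  \<comment> \<open>The integrand does not involve \<open>min I J\<close>, whose law integrates to
    1; only the density \<open>h\<close> of the difference remains.\<close>
  also have "\<dots> = (\<integral>\<^sup>+w. (\<integral>\<^sup>+d. ennreal (h d) * f (w, d) \<partial>lborel) \<partial>expo (a + b))"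
    by (intro nn_integral_cong, subst nn_integral_min_diff[OF ab])
       (simp_all add: h_def E1)
  also have "\<dots> = (\<integral>\<^sup>+d. (\<integral>\<^sup>+w. ennreal (h d) * f (w, d) \<partial>expo (a + b)) \<partial>lborel)"
    by (rule P.Fubini'[symmetric]) measurable
  also have "\<dots> = (\<integral>\<^sup>+d. ennreal (h d) * (\<integral>\<^sup>+w. f (w, d) \<partial>expo (a + b)) \<partial>lborel)"
    by (simp add: nn_integral_cmult)
  also have "\<dots> = (\<integral>\<^sup>+J. (\<integral>\<^sup>+I. f (min I J, I - J) \<partial>expo a) \<partial>expo b)"
    by (simp add: nn_integral_min_diff[OF ab] h_def)
  also have "\<dots> = (\<integral>\<^sup>+J. (\<integral>\<^sup>+I. g (I, J) \<partial>expo a) \<partial>expo b)"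
    by (intro nn_integral_cong arg_cong[where f = g]) (auto simp: f_def min_def max_def)
  finally show ?thesis .
qed

text \<open>Lifts the identity for one cell to a finite product: coordinates outside
  \<open>{a, b, w}\<close> are spectators and factor out. The weight is consumed, so
  \<open>w\<close> leaves the index set, while \<open>a\<close> and \<open>b\<close> are reused for
  the outputs. \<open>rw\<close> is Burke's condition on the rates.\<close>

lemma burke_step:
  fixes S :: "'i set" and r :: "'i \<Rightarrow> real"
  assumes fin: "finite S" and S: "a \<in> S" "b \<in> S" "w \<in> S" "a \<noteq> b" "a \<noteq> w" "b \<noteq> w"
    and pos: "\<And>s. 0 < r s" and rw: "r w = r a + r b"
  shows "distr (PiM S (\<lambda>s. expo (r s))) (PiM (S - {w}) (\<lambda>s. expo (r s)))
           (\<lambda>x. restrict (x(a := x w + max 0 (x a - x b), b := x w + max 0 (x b - x a))) (S - {w}))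
       = PiM (S - {w}) (\<lambda>s. expo (r s))" (is "distr ?P ?Q ?T = ?Q")
proof -
  let ?\<mu> = "\<lambda>s. expo (r s)"
  interpret product_sigma_finite ?\<mu>
    using pos by (intro product_sigma_finite.intro sigma_finite_expo)
  define R where "R = S - {a, b, w}"
  have SR: "S = insert a (insert b (insert w R))" "S - {w} = insert a (insert b R)"
    and R: "finite R" "a \<notin> R" "b \<notin> R" "w \<notin> R"
    using S fin by (auto simp: R_def)
  have comp[measurable]: "(\<lambda>x. x s) \<in> borel_measurable ?P" if "s \<in> S" for s
    using measurable_component_singleton[OF that, of ?\<mu>] by simp
  have T[measurable]: "?T \<in> measurable ?P ?Q"
  proof (rule measurable_restrict)
    fix s assume "s \<in> S - {w}"
    then have "(\<lambda>x. (x(a := x w + max 0 (x a - x b), b := x w + max 0 (x b - x a))) s) \<in> borel_measurable ?P"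
      using S by (cases "s = a"; cases "s = b") (auto simp: S)
    then show "(\<lambda>x. (x(a := x w + max 0 (x a - x b), b := x w + max 0 (x b - x a))) s) \<in> measurable ?P (expo (r s))"
      by simp
  qed
  show ?thesis
  proof (rule PiM_eqI)
    fix A assume A: "\<And>s. s \<in> S - {w} \<Longrightarrow> A s \<in> sets (expo (r s))"
    then have Am[measurable]: "A s \<in> sets borel" if "s \<in> S - {w}" for s
      using that by simp
    have [measurable]: "A a \<in> sets borel" "A b \<in> sets borel"
      using S by (auto intro!: Am)
    define G where "G x = (\<Prod>s\<in>R. indicator (A s) (x s) :: ennreal)" for x :: "'i \<Rightarrow> real"
    define g where "g p = (indicator (A a) (fst p) * indicator (A b) (snd p) :: ennreal)" for p :: "real \<times> real"
    have g[measurable]: "g \<in> borel_measurable (borel \<Otimes>\<^sub>M borel)"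
      unfolding g_def by measurable
    have GP: "G \<in> borel_measurable (PiM K ?\<mu>)" if "R \<subseteq> K" for K
      unfolding G_def using R SR that
      by (intro borel_measurable_prod_ennreal measurable_compose[OF measurable_component_singleton[of _ K]]) (auto intro!: Am)
    note [measurable] = GP[OF order_refl] GP[of S]
    let ?H = "\<lambda>x. G x * g (x w + max 0 (x a - x b), x w + max 0 (x b - x a))"
    have abw: "(\<lambda>x. x a) \<in> borel_measurable ?P" "(\<lambda>x. x b) \<in> borel_measurable ?P" "(\<lambda>x. x w) \<in> borel_measurable ?P"
      using S by (auto intro: comp)
    have "(\<lambda>x. (x w + max 0 (x a - x b), x w + max 0 (x b - x a))) \<in> measurable ?P (borel \<Otimes>\<^sub>M borel)"
      by (intro measurable_Pair borel_measurable_add borel_measurable_max borel_measurable_diff abw borel_measurable_const)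
    from measurable_compose[OF this g]
    have H[measurable]: "?H \<in> borel_measurable ?P"
      by (intro borel_measurable_times_ennreal GP) (auto simp: R_def)
    have "emeasure (distr ?P ?Q ?T) (Pi\<^sub>E (S - {w}) A) = (\<integral>\<^sup>+x. indicator (Pi\<^sub>E (S - {w}) A) (?T x) \<partial>?P)"
      using A fin by (subst nn_integral_distr[symmetric, OF T]) (auto intro!: sets_PiM_I_finite)
    also have "\<dots> = (\<integral>\<^sup>+x. ?H x \<partial>?P)"
    proof (intro nn_integral_cong)
      fix x
      have eq: "?T x \<in> Pi\<^sub>E (S - {w}) A \<longleftrightarrow> x w + max 0 (x a - x b) \<in> A a \<and> x w + max 0 (x b - x a) \<in> A b \<and> (\<forall>s\<in>R. x s \<in> A s)"
        unfolding SR using S R by (auto simp: PiE_iff)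
      have "G x = (if \<forall>s\<in>R. x s \<in> A s then 1 else 0)"
        using R by (auto simp: G_def indicator_def)
      then show "indicator (Pi\<^sub>E (S - {w}) A) (?T x) = ?H x"
        using eq by (auto simp: indicator_def g_def)
    qed
    \<comment> \<open>Splitting off \<open>a\<close>, then \<open>b\<close>, then \<open>w\<close>
      nests the integrals as in \<open>burke_nn_integral\<close>.\<close>
    also have "\<dots> = (\<integral>\<^sup>+x. (\<integral>\<^sup>+W. (\<integral>\<^sup>+J. (\<integral>\<^sup>+I. ?H (x(w := W, b := J, a := I)) \<partial>?\<mu> a) \<partial>?\<mu> b) \<partial>?\<mu> w) \<partial>PiM R ?\<mu>)"
    proof -
      have 1: "(\<integral>\<^sup>+x. ?H x \<partial>?P) = (\<integral>\<^sup>+x. (\<integral>\<^sup>+I. ?H (x(a := I)) \<partial>?\<mu> a) \<partial>PiM (insert b (insert w R)) ?\<mu>)"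
        unfolding SR using R S H by (intro product_nn_integral_insert) (auto simp: SR)
      have m1: "(\<lambda>x. (\<integral>\<^sup>+I. ?H (x(a := I)) \<partial>?\<mu> a)) \<in> borel_measurable (PiM (insert b (insert w R)) ?\<mu>)"
      proof (rule sigma_finite_measure.borel_measurable_nn_integral[OF sigma_finite_expo[OF pos]])
        show "(\<lambda>(x, I). ?H (x(a := I))) \<in> borel_measurable (PiM (insert b (insert w R)) ?\<mu> \<Otimes>\<^sub>M ?\<mu> a)"
          using measurable_compose[OF measurable_add_dim H[unfolded SR]] by (simp add: split_beta')
      qed
      have 2: "(\<integral>\<^sup>+x. (\<integral>\<^sup>+I. ?H (x(a := I)) \<partial>?\<mu> a) \<partial>PiM (insert b (insert w R)) ?\<mu>) = (\<integral>\<^sup>+x. (\<integral>\<^sup>+J. (\<integral>\<^sup>+I. ?H (x(b := J, a := I)) \<partial>?\<mu> a) \<partial>?\<mu> b) \<partial>PiM (insert w R) ?\<mu>)"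
        using R S m1 by (subst product_nn_integral_insert) auto
      have m2: "(\<lambda>x. (\<integral>\<^sup>+J. (\<integral>\<^sup>+I. ?H (x(b := J, a := I)) \<partial>?\<mu> a) \<partial>?\<mu> b)) \<in> borel_measurable (PiM (insert w R) ?\<mu>)"
      proof (rule sigma_finite_measure.borel_measurable_nn_integral[OF sigma_finite_expo[OF pos]])
        show "(\<lambda>(x, J). \<integral>\<^sup>+I. ?H (x(b := J, a := I)) \<partial>?\<mu> a) \<in> borel_measurable (PiM (insert w R) ?\<mu> \<Otimes>\<^sub>M ?\<mu> b)"
          using measurable_compose[OF measurable_add_dim m1] by (simp add: split_beta')
      qed
      have 3: "(\<integral>\<^sup>+x. (\<integral>\<^sup>+J. (\<integral>\<^sup>+I. ?H (x(b := J, a := I)) \<partial>?\<mu> a) \<partial>?\<mu> b) \<partial>PiM (insert w R) ?\<mu>)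
          = (\<integral>\<^sup>+x. (\<integral>\<^sup>+W. (\<integral>\<^sup>+J. (\<integral>\<^sup>+I. ?H (x(w := W, b := J, a := I)) \<partial>?\<mu> a) \<partial>?\<mu> b) \<partial>?\<mu> w) \<partial>PiM R ?\<mu>)"
        using R S m2 by (subst product_nn_integral_insert) auto
      show ?thesis unfolding 1 2 3 ..
    qed
    also have "\<dots> = (\<integral>\<^sup>+x. (\<integral>\<^sup>+W. (\<integral>\<^sup>+J. (\<integral>\<^sup>+I. G x * g (W + max 0 (I - J), W + max 0 (J - I)) \<partial>?\<mu> a) \<partial>?\<mu> b) \<partial>?\<mu> w) \<partial>PiM R ?\<mu>)"
    proof -
      have "G (x(w := W, b := J, a := I)) = G x" for x W J I
        using R unfolding G_def by (intro prod.cong) auto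
      then show ?thesis using S by simp
    qed
    also have "\<dots> = (\<integral>\<^sup>+x. G x * (\<integral>\<^sup>+W. (\<integral>\<^sup>+J. (\<integral>\<^sup>+I. g (W + max 0 (I - J), W + max 0 (J - I)) \<partial>?\<mu> a) \<partial>?\<mu> b) \<partial>?\<mu> w) \<partial>PiM R ?\<mu>)"
    proof -
      interpret Ea: sigma_finite_measure "?\<mu> a" by (rule sigma_finite_expo[OF pos])
      interpret Eb: sigma_finite_measure "?\<mu> b" by (rule sigma_finite_expo[OF pos])
      show ?thesis by (simp add: nn_integral_cmult)
    qed
    also have "\<dots> = (\<integral>\<^sup>+x. G x * (\<integral>\<^sup>+J. (\<integral>\<^sup>+I. g (I, J) \<partial>?\<mu> a) \<partial>?\<mu> b) \<partial>PiM R ?\<mu>)"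
      unfolding rw by (simp add: burke_nn_integral[OF pos pos g])
    also have "(\<integral>\<^sup>+J. (\<integral>\<^sup>+I. g (I, J) \<partial>?\<mu> a) \<partial>?\<mu> b) = emeasure (?\<mu> a) (A a) * emeasure (?\<mu> b) (A b)"
      by (simp add: g_def nn_integral_multc nn_integral_cmult)
    also have "(\<integral>\<^sup>+x. G x * (emeasure (?\<mu> a) (A a) * emeasure (?\<mu> b) (A b)) \<partial>PiM R ?\<mu>)
        = (\<integral>\<^sup>+x. G x \<partial>PiM R ?\<mu>) * (emeasure (?\<mu> a) (A a) * emeasure (?\<mu> b) (A b))"
      by (simp add: nn_integral_multc)
    also have "(\<integral>\<^sup>+x. G x \<partial>PiM R ?\<mu>) = (\<Prod>s\<in>R. emeasure (?\<mu> s) (A s))"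
      unfolding G_def using R SR A by (subst product_nn_integral_prod) (auto intro!: prod.cong nn_integral_indicator)
    also have "(\<Prod>s\<in>R. emeasure (?\<mu> s) (A s)) * (emeasure (?\<mu> a) (A a) * emeasure (?\<mu> b) (A b))
        = (\<Prod>s\<in>S - {w}. emeasure (?\<mu> s) (A s))"
      unfolding SR(2) using R S by (simp add: mult_ac)
    finally show "emeasure (distr ?P ?Q ?T) (Pi\<^sub>E (S - {w}) A) = (\<Prod>s\<in>S - {w}. emeasure (?\<mu> s) (A s))" .
  qed (use fin in auto)
qed


subsection \<open>The stationary model\<close>

definition stat_rate :: "real \<Rightarrow> nat \<times> nat \<Rightarrow> real" where
  "stat_rate r v = (if snd v = 0 then 1 - r else if fst v = 0 then r else 1)"

definition stat_space :: "real \<Rightarrow> (nat \<times> nat \<Rightarrow> real) measure" where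
  "stat_space r = PiM UNIV (\<lambda>v. expo (stat_rate r v))"

lemma stat_rate_pos: "0 < r \<Longrightarrow> r < 1 \<Longrightarrow> 0 < stat_rate r v"
  by (auto simp: stat_rate_def)

lemma measurable_stat_coord [measurable]: "(\<lambda>x. x v) \<in> borel_measurable (stat_space r)"
  using measurable_component_singleton[of v UNIV "\<lambda>v. expo (stat_rate r v)"]
  by (simp add: stat_space_def)

lemma measurable_stat_passage [measurable]:
  "(\<lambda>x. stat_passage x i j) \<in> borel_measurable (stat_space r)"
proof (induction i arbitrary: j)
  case 0
  show ?case by (induction j) auto
next
  case (Suc i)
  show ?case by (induction j) (auto intro!: borel_measurable_add borel_measurable_max Suc)
qed

context
  fixes r :: real
  assumes r: "0 < r" "r < 1"
begin

lemma product_prob_space_stat: "product_prob_space (\<lambda>v. expo (stat_rate r v))"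
  using prob_space_exponential_density[OF stat_rate_pos[OF r]]
  by (intro product_prob_space.intro product_prob_space_axioms.intro product_sigma_finite.intro)
     (auto intro: prob_space_imp_sigma_finite)

lemma prob_space_stat_space: "prob_space (stat_space r)"
  unfolding stat_space_def using prob_space_exponential_density[OF stat_rate_pos[OF r]]
  by (intro prob_space_PiM) auto

section \<open>The Burke property, propagated cell by cell and column by column\<close>

abbreviation stat_prod :: "(nat \<times> nat) set \<Rightarrow> (nat \<times> nat \<Rightarrow> real) measure" where
  "stat_prod S \<equiv> PiM S (\<lambda>v. expo (stat_rate r v))"

lemma measurable_into_stat_prod:
  assumes "\<And>v. v \<in> S \<Longrightarrow> (\<lambda>x. f x v) \<in> borel_measurable N"
  shows "(\<lambda>x. restrict (f x) S) \<in> measurable N (stat_prod S)"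
  by (intro measurable_restrict) (use assms in simp)

lemma distr_stat_prod_restrict:
  assumes "finite J" "J \<subseteq> I"
  shows "distr (stat_prod I) (stat_prod J) (\<lambda>x. restrict x J) = stat_prod J"
proof -
  interpret product_prob_space "\<lambda>v. expo (stat_rate r v)" by (rule product_prob_space_stat)
  show ?thesis by (rule distr_PiM_restrict_finite[OF assms])
qed

text \<open>The sweep replaces, cell by cell, the two incoming increments and the weight of a cell by the
  two outgoing increments. While column \<open>i + 1\<close> is processed up to height \<open>j\<close>,
  \<open>(0, b)\<close> indexes the current vertical increment at height \<open>b\<close> and \<open>(i + 1, 0)\<close>
  the current horizontal increment.\<close>

definition sweep :: "nat \<Rightarrow> nat \<Rightarrow> (nat \<times> nat \<Rightarrow> real) \<Rightarrow> nat \<times> nat \<Rightarrow> real" where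
  "sweep i j x s =
     (let c = (if snd s \<le> j then Suc i else i)
      in if fst s = 0 then stat_passage x c (snd s) - stat_passage x c (snd s - 1)
         else if s = (Suc i, 0) then stat_passage x (Suc i) j - stat_passage x i j
         else x s)"

text \<open>The coordinates alive when the sweep has reached height \<open>j\<close> in column
  \<open>i + 1\<close>: the increments along the current frontier and the weights beyond it. Weights
  of processed cells have been absorbed into increments; the bounds \<open>m\<close>,
  \<open>n\<close> keep the product finite.\<close>

definition unswept :: "nat \<Rightarrow> nat \<Rightarrow> nat \<Rightarrow> nat \<Rightarrow> (nat \<times> nat) set" where
  "unswept m n i j = {(a, b). a \<le> m \<and> b \<le> n \<and>
      (a = 0 \<and> 1 \<le> b \<or> Suc i < a \<or> a = Suc i \<and> (b = 0 \<or> j < b))}"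

lemma finite_unswept: "finite (unswept m n i j)"
  by (rule finite_subset[of _ "{0..m} \<times> {0..n}"]) (auto simp: unswept_def)

lemma measurable_sweep: "(\<lambda>x. sweep i j x s) \<in> borel_measurable (stat_space r)"
  unfolding sweep_def Let_def by (cases "fst s = 0"; cases "s = (Suc i, 0)") auto

lemma measurable_sweep_restrict:
  "(\<lambda>x. restrict (sweep i j x) S) \<in> measurable (stat_space r) (stat_prod S)"
  by (intro measurable_into_stat_prod measurable_sweep)

text \<open>Processing the cell \<open>(i + 1, j + 1)\<close> is the map of
  \<open>burke_step\<close>: for incoming increments \<open>I\<close>, \<open>J\<close> and cell
  weight \<open>w\<close>, the recursion of \<open>stat_passage\<close> yields the outgoing
  increments \<open>w + max 0 (I - J)\<close> and \<open>w + max 0 (J - I)\<close>.\<close>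

lemma sweep_step:
  assumes "i < m" "j < n"
    and IH: "distr (stat_space r) (stat_prod (unswept m n i j)) (\<lambda>x. restrict (sweep i j x) (unswept m n i j))
        = stat_prod (unswept m n i j)"
  shows "distr (stat_space r) (stat_prod (unswept m n i (Suc j))) (\<lambda>x. restrict (sweep i (Suc j) x) (unswept m n i (Suc j)))
        = stat_prod (unswept m n i (Suc j))"
proof -
  let ?S = "unswept m n i j" and ?S' = "unswept m n i (Suc j)"
  let ?a = "(Suc i, 0::nat)" and ?b = "(0::nat, Suc j)" and ?w = "(Suc i, Suc j)"
  let ?T = "\<lambda>x. restrict (x(?a := x ?w + max 0 (x ?a - x ?b), ?b := x ?w + max 0 (x ?b - x ?a))) ?S'"
  have S': "?S - {?w} = ?S'"
    using assms(1,2) by (auto simp: unswept_def)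
  have mem: "?a \<in> ?S" "?b \<in> ?S" "?w \<in> ?S" using assms(1,2) by (auto simp: unswept_def)
  have step: "distr (stat_prod ?S) (stat_prod ?S') ?T = stat_prod ?S'"
    using burke_step[where S = ?S and a = ?a and b = ?b and w = ?w and r = "stat_rate r"]
      finite_unswept mem stat_rate_pos[OF r] unfolding S'
    by (auto simp: stat_rate_def)
  have comp[measurable]: "(\<lambda>x. x s) \<in> borel_measurable (stat_prod ?S)" if "s \<in> ?S" for s
    using measurable_component_singleton[OF that, of "\<lambda>v. expo (stat_rate r v)"] by simp
  have T: "?T \<in> measurable (stat_prod ?S) (stat_prod ?S')"
  proof (rule measurable_into_stat_prod)
    fix s assume "s \<in> ?S'"
    then have "s \<in> ?S" using S' by auto
    then show "(\<lambda>x. (x(?a := x ?w + max 0 (x ?a - x ?b), ?b := x ?w + max 0 (x ?b - x ?a))) s) \<in> borel_measurable (stat_prod ?S)"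
      using mem by (cases "s = ?a"; cases "s = ?b") (auto simp: mem)
  qed
  have ab: "?a \<noteq> ?b" by simp
  have eq: "?T (restrict (sweep i j x) ?S) = restrict (sweep i (Suc j) x) ?S'" for x
  proof
    fix s
    let ?u = "restrict (sweep i j x) ?S"
    have u: "?u ?w = x ?w" "?u ?a = stat_passage x (Suc i) j - stat_passage x i j"
      "?u ?b = stat_passage x i (Suc j) - stat_passage x i j"
      using mem by (simp_all add: sweep_def)
    show "?T ?u s = restrict (sweep i (Suc j) x) ?S' s"
    proof (cases "s \<in> ?S'")
      case True
      then have s: "s \<in> ?S" using S' by auto
      consider "s = ?a" | "s = ?b" | "s \<noteq> ?a" "s \<noteq> ?b" by blast
      then show ?thesis
      proof cases
        case 1
        have "?T ?u s = ?u ?w + max 0 (?u ?a - ?u ?b)"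
          unfolding 1 by (simp only: restrict_apply'[OF True[unfolded 1]] fun_upd_other[OF ab] fun_upd_same)
        also have "\<dots> = sweep i (Suc j) x s" unfolding u 1 by (simp add: sweep_def max_def)
        finally show ?thesis by (simp only: restrict_apply'[OF True])
      next
        case 2
        have "?T ?u s = ?u ?w + max 0 (?u ?b - ?u ?a)"
          unfolding 2 by (simp only: restrict_apply'[OF True[unfolded 2]] fun_upd_same)
        also have "\<dots> = sweep i (Suc j) x s" unfolding u 2 by (simp add: sweep_def max_def)
        finally show ?thesis by (simp only: restrict_apply'[OF True])
      next
        case 3
        have "?T ?u s = sweep i j x s"
          by (simp only: restrict_apply'[OF True] restrict_apply'[OF s] fun_upd_apply 3 if_False)
        \<comment> \<open>Raising \<open>j\<close> affects only the vertical increment at height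
          \<open>j + 1\<close> and the running horizontal increment, and both are excluded
          here.\<close>
        also have "\<dots> = sweep i (Suc j) x s"
        proof (cases "fst s = 0")
          case True
          then have "snd s \<noteq> Suc j" using 3(2) by (auto simp: prod_eq_iff)
          then have "(snd s \<le> Suc j) = (snd s \<le> j)" by auto
          then show ?thesis unfolding sweep_def by (simp only: True simp_thms if_True Let_def)
        next
          case False
          then show ?thesis unfolding sweep_def using 3(1) by (simp only: Let_def simp_thms if_False)
        qed
        finally show ?thesis by (simp only: restrict_apply'[OF True])
      qed
    next
      case False
      then show ?thesis by (simp only: restrict_apply if_False)
    qed
  qed
  have "distr (stat_space r) (stat_prod ?S') (\<lambda>x. restrict (sweep i (Suc j) x) ?S')
      = distr (distr (stat_space r) (stat_prod ?S) (\<lambda>x. restrict (sweep i j x) ?S)) (stat_prod ?S') ?T"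
    unfolding distr_distr[OF T measurable_sweep_restrict] comp_def eq ..
  also have "\<dots> = stat_prod ?S'" by (simp only: IH step)
  finally show ?thesis .
qed

lemma sweep_column:
  assumes "i < m" "j \<le> n"
    and "distr (stat_space r) (stat_prod (unswept m n i 0)) (\<lambda>x. restrict (sweep i 0 x) (unswept m n i 0))
        = stat_prod (unswept m n i 0)"
  shows "distr (stat_space r) (stat_prod (unswept m n i j)) (\<lambda>x. restrict (sweep i j x) (unswept m n i j))
        = stat_prod (unswept m n i j)"
  using assms(2)
proof (induction j)
  case 0
  show ?case by (rule assms(3))
next
  case (Suc j)
  then show ?case by (intro sweep_step[OF assms(1)] Suc.IH) simp_all
qed

text \<open>Marginals of a product measure are product measures. This serves to drop finished
  coordinates and to re-express the remaining ones by any \<open>f\<close> that agrees with the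
  sweep on them.\<close>

lemma sweep_restrict:
  assumes "finite S" "S' \<subseteq> S"
    and "distr (stat_space r) (stat_prod S) (\<lambda>x. restrict (sweep i j x) S) = stat_prod S"
    and eq: "\<And>x s. s \<in> S' \<Longrightarrow> sweep i j x s = f x s"
  shows "distr (stat_space r) (stat_prod S') (\<lambda>x. restrict (f x) S') = stat_prod S'"
proof -
  have fin: "finite S'" using assms(1,2) finite_subset by blast
  have "(\<lambda>x. restrict (f x) S') = (\<lambda>x. restrict x S') \<circ> (\<lambda>x. restrict (sweep i j x) S)"
    using assms(2) eq by (auto simp: fun_eq_iff restrict_def)
  then have "distr (stat_space r) (stat_prod S') (\<lambda>x. restrict (f x) S')
      = distr (distr (stat_space r) (stat_prod S) (\<lambda>x. restrict (sweep i j x) S)) (stat_prod S') (\<lambda>x. restrict x S')"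
    using distr_distr[OF measurable_restrict_subset[OF assms(2)] measurable_sweep_restrict] by simp
  also have "\<dots> = stat_prod S'"
    unfolding assms(3) by (rule distr_stat_prod_restrict[OF fin assms(2)])
  finally show ?thesis .
qed

lemma sweep_law:
  assumes "i < m"
  shows "distr (stat_space r) (stat_prod (unswept m n i 0)) (\<lambda>x. restrict (sweep i 0 x) (unswept m n i 0))
        = stat_prod (unswept m n i 0)"
  using assms
proof (induction i)
  case 0
  \<comment> \<open>Before any cell is processed, the increments along both axes are the boundary
    weights.\<close>
  have eq: "(\<lambda>x. restrict (sweep 0 0 x) (unswept m n 0 0)) = (\<lambda>x. restrict x (unswept m n 0 0))"
  proof (intro ext)
    fix x s
    show "restrict (sweep 0 0 x) (unswept m n 0 0) s = restrict x (unswept m n 0 0) s"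
      by (cases s; cases "snd s") (auto simp: sweep_def unswept_def restrict_def)
  qed
  show ?case
    unfolding eq stat_space_def by (rule distr_stat_prod_restrict[OF finite_unswept]) simp
next
  case (Suc i)
  have "distr (stat_space r) (stat_prod (unswept m n i n)) (\<lambda>x. restrict (sweep i n x) (unswept m n i n))
      = stat_prod (unswept m n i n)"
    by (rule sweep_column[OF _ order_refl Suc.IH]) (use Suc.prems in simp_all)
  \<comment> \<open>A finished column hands over to the next one: the horizontal increment at its
    top is dropped, and the running increment of column \<open>i + 2\<close> starts as its boundary
    weight.\<close>
  then show ?case
  proof (rule sweep_restrict[OF finite_unswept, rotated])
    show "unswept m n (Suc i) 0 \<subseteq> unswept m n i n"
      by (auto simp: unswept_def)
    fix x s assume "s \<in> unswept m n (Suc i) 0"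
    then consider "fst s = 0" "1 \<le> snd s" "snd s \<le> n" | "s = (Suc (Suc i), 0)"
      | "fst s \<noteq> 0" "s \<noteq> (Suc i, 0)" "s \<noteq> (Suc (Suc i), 0)"
      by (cases s) (auto simp: unswept_def)
    then show "sweep i n x s = sweep (Suc i) 0 x s"
      by cases (simp_all add: sweep_def)
  qed
qed

text \<open>At the end of a column the sweep has replaced the vertical boundary weights by the
  increments of column \<open>m\<close> without changing their joint law. The increments keep the
  boundary indices \<open>(0, b)\<close>, so \<open>stat_rate\<close> assigns them rate
  \<open>r\<close>.\<close>

lemma stat_column_law:
  fixes m n :: nat
  assumes "1 \<le> m"
  shows "distr (stat_space r) (stat_prod ({0} \<times> {1..n}))
           (\<lambda>x. \<lambda>s\<in>{0} \<times> {1..n}. stat_passage x m (snd s) - stat_passage x m (snd s - 1))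
       = stat_prod ({0} \<times> {1..n})"
proof -
  obtain i where i: "m = Suc i" using assms by (cases m) auto
  have "distr (stat_space r) (stat_prod (unswept m n i n)) (\<lambda>x. restrict (sweep i n x) (unswept m n i n))
      = stat_prod (unswept m n i n)"
    by (rule sweep_column[OF _ order_refl sweep_law]) (use i in simp_all)
  then show ?thesis
  proof (rule sweep_restrict[OF finite_unswept, rotated])
    show "{0} \<times> {1..n} \<subseteq> unswept m n i n"
      by (auto simp: unswept_def)
    fix x s assume "s \<in> {0::nat} \<times> {1..n}"
    then have "fst s = 0" "snd s \<le> n" by auto
    then show "sweep i n x s = stat_passage x m (snd s) - stat_passage x m (snd s - 1)"
      by (simp add: sweep_def i)
  qed
qed

end


subsection \<open>Exponential tails and the upper bound\<close>

lemma AE_expo_nonneg: "AE x in expo a. 0 \<le> x"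
proof -
  have "AE x in lborel. 0 < ennreal (exponential_density a x) \<longrightarrow> 0 \<le> x"
    by (auto simp: exponential_density_def)
  then show ?thesis by (subst AE_density) auto
qed

text \<open>Exponential tilting: \<open>exp (\<theta> * x)\<close> times the \<open>Exp(a)\<close>
  density is \<open>a / (a - \<theta>)\<close> times the \<open>Exp(a - \<theta>)\<close> density.
  Negative \<open>\<theta>\<close> serves the lower tail.\<close>

lemma nn_integral_expo_exp:
  assumes "0 < a" "\<theta> < a"
  shows "(\<integral>\<^sup>+x. ennreal (exp (\<theta> * x)) \<partial>expo a) = ennreal (a / (a - \<theta>))"
proof -
  interpret prob_space "expo (a - \<theta>)"
    using assms by (intro prob_space_exponential_density) auto
  have eq: "exponential_density a x * exp (\<theta> * x) = a / (a - \<theta>) * exponential_density (a - \<theta>) x" for x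
  proof -
    have "exp (- x * (a - \<theta>)) = exp (- x * a) * exp (\<theta> * x)"
      by (simp add: exp_add[symmetric] algebra_simps)
    then show ?thesis using assms by (simp add: exponential_density_def)
  qed
  have "(\<integral>\<^sup>+x. ennreal (exp (\<theta> * x)) \<partial>expo a)
      = (\<integral>\<^sup>+x. ennreal (a / (a - \<theta>)) * ennreal (exponential_density (a - \<theta>) x) \<partial>lborel)"
    using assms by (subst nn_integral_expo)
      (auto simp: ennreal_mult[symmetric] exponential_density_nonneg eq intro!: nn_integral_cong)
  also have "\<dots> = ennreal (a / (a - \<theta>)) * emeasure (expo (a - \<theta>)) (space (expo (a - \<theta>)))"
    by (simp add: nn_integral_cmult emeasure_density)
  finally show ?thesis unfolding emeasure_space_1 by simp
qed

text \<open>Independence and marginals are packed into one equation of joint laws, so that the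
  property passes through reindexing by \<open>distr_distr\<close> and estimates can be moved
  between probability spaces.\<close>

definition iid_exp :: "'a measure \<Rightarrow> ('i \<Rightarrow> 'a \<Rightarrow> real) \<Rightarrow> 'i set \<Rightarrow> real \<Rightarrow> bool" where
  "iid_exp M Z K a \<longleftrightarrow> prob_space M \<and> (\<forall>i\<in>K. Z i \<in> borel_measurable M) \<and>
     distr M (PiM K (\<lambda>_. expo a)) (\<lambda>\<omega>. \<lambda>i\<in>K. Z i \<omega>) = PiM K (\<lambda>_. expo a)"

lemma iid_exp_measurable: "iid_exp M Z K a \<Longrightarrow> i \<in> K \<Longrightarrow> Z i \<in> borel_measurable M"
  by (auto simp: iid_exp_def)

lemma iid_exp_measurable_restrict:
  "iid_exp M Z K a \<Longrightarrow> (\<lambda>\<omega>. \<lambda>i\<in>K. Z i \<omega>) \<in> measurable M (PiM K (\<lambda>_. expo a))"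
  by (intro measurable_restrict) (simp add: iid_exp_def)

lemma nn_integral_exp_sum:
  assumes Z: "iid_exp M Z K a" and K: "finite K" and a: "0 < a" "\<theta> < a"
  shows "(\<integral>\<^sup>+\<omega>. ennreal (exp (\<theta> * (\<Sum>i\<in>K. Z i \<omega>))) \<partial>M) = ennreal ((a / (a - \<theta>)) ^ card K)"
proof -
  interpret product_sigma_finite "\<lambda>_. expo a"
    using a by (intro product_sigma_finite.intro sigma_finite_expo)
  have m: "(\<lambda>x. \<Prod>i\<in>K. ennreal (exp (\<theta> * x i))) \<in> borel_measurable (PiM K (\<lambda>_. expo a))"
    by (intro borel_measurable_prod_ennreal measurable_compose[OF measurable_component_singleton]) auto
  have "(\<integral>\<^sup>+\<omega>. ennreal (exp (\<theta> * (\<Sum>i\<in>K. Z i \<omega>))) \<partial>M)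
      = (\<integral>\<^sup>+\<omega>. (\<Prod>i\<in>K. ennreal (exp (\<theta> * (\<lambda>i\<in>K. Z i \<omega>) i))) \<partial>M)"
    using K by (intro nn_integral_cong) (simp add: sum_distrib_left exp_sum prod_ennreal)
  also have "\<dots> = (\<integral>\<^sup>+x. (\<Prod>i\<in>K. ennreal (exp (\<theta> * x i))) \<partial>distr M (PiM K (\<lambda>_. expo a)) (\<lambda>\<omega>. \<lambda>i\<in>K. Z i \<omega>))"
    by (subst nn_integral_distr[OF iid_exp_measurable_restrict[OF Z]]) (use m in simp_all)
  also have "\<dots> = (\<integral>\<^sup>+x. (\<Prod>i\<in>K. ennreal (exp (\<theta> * x i))) \<partial>PiM K (\<lambda>_. expo a))"
    using Z by (simp only: iid_exp_def)
  also have "\<dots> = (\<Prod>i\<in>K. (\<integral>\<^sup>+x. ennreal (exp (\<theta> * x)) \<partial>expo a))"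
    using K by (intro product_nn_integral_prod) auto
  also have "\<dots> = ennreal ((a / (a - \<theta>)) ^ card K)"
    using a by (simp add: nn_integral_expo_exp ennreal_power)
  finally show ?thesis .
qed

lemma exp_sum_chernoff:
  assumes Z: "iid_exp M Z K a" and K: "finite K" and a: "0 < a" "0 < \<theta>"
  shows "\<theta> < a \<Longrightarrow> measure M {\<omega>\<in>space M. t \<le> (\<Sum>i\<in>K. Z i \<omega>)} \<le> exp (- \<theta> * t) * (a / (a - \<theta>)) ^ card K"
    and "measure M {\<omega>\<in>space M. (\<Sum>i\<in>K. Z i \<omega>) \<le> t} \<le> exp (\<theta> * t) * (a / (a + \<theta>)) ^ card K"
proof -
  interpret prob_space M using Z by (simp add: iid_exp_def)
  have m: "(\<lambda>\<omega>. \<Sum>i\<in>K. Z i \<omega>) \<in> borel_measurable M"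
    by (intro borel_measurable_sum iid_exp_measurable[OF Z])
  have ind: "(\<integral>\<^sup>+\<omega>. f \<omega> * indicator (space M) \<omega> \<partial>M) = (\<integral>\<^sup>+\<omega>. f \<omega> \<partial>M)" for f
    by (intro nn_integral_cong) simp
  {
    assume th: "\<theta> < a"
    have "emeasure M {\<omega>\<in>space M. t \<le> (\<Sum>i\<in>K. Z i \<omega>)}
        \<le> ennreal (exp (- \<theta> * t)) * (\<integral>\<^sup>+\<omega>. ennreal (exp (\<theta> * (\<Sum>i\<in>K. Z i \<omega>))) * indicator (space M) \<omega> \<partial>M)"
      using a m by (intro Chernoff_ineq_nn_integral_ge) auto
    also have "\<dots> = ennreal (exp (- \<theta> * t) * (a / (a - \<theta>)) ^ card K)"
      unfolding ind nn_integral_exp_sum[OF Z K a(1) th] using a th by (simp add: ennreal_mult)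
    finally show "measure M {\<omega>\<in>space M. t \<le> (\<Sum>i\<in>K. Z i \<omega>)} \<le> exp (- \<theta> * t) * (a / (a - \<theta>)) ^ card K"
      using a th by (simp add: emeasure_eq_measure)
  }
  have th: "- \<theta> < a" using a by simp
  have "emeasure M {\<omega>\<in>space M. (\<Sum>i\<in>K. Z i \<omega>) \<le> t}
      \<le> ennreal (exp (\<theta> * t)) * (\<integral>\<^sup>+\<omega>. ennreal (exp (- \<theta> * (\<Sum>i\<in>K. Z i \<omega>))) * indicator (space M) \<omega> \<partial>M)"
    using a m by (intro Chernoff_ineq_nn_integral_le) auto
  also have "\<dots> = ennreal (exp (\<theta> * t) * (a / (a + \<theta>)) ^ card K)"
    unfolding ind nn_integral_exp_sum[OF Z K a(1) th] using a by (simp add: ennreal_mult)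
  finally show "measure M {\<omega>\<in>space M. (\<Sum>i\<in>K. Z i \<omega>) \<le> t} \<le> exp (\<theta> * t) * (a / (a + \<theta>)) ^ card K"
    using a by (simp add: emeasure_eq_measure)
qed

text \<open>Chernoff with tilt \<open>a * u\<close>: the exponent gains
  \<open>a * u * \<epsilon> * N\<close> and loses at most \<open>2 * card K * u^2\<close>. The rate
  \<open>c\<close> comes from \<open>a\<close>, \<open>\<epsilon>\<close>, \<open>D\<close> alone,
  and this uniformity is what the later union bounds rest on.\<close>

lemma exp_sum_deviation:
  fixes M :: "'a measure"
  assumes a: "0 < a" and e: "0 < \<epsilon>" and D: "0 \<le> D"
  shows "\<exists>c>0. \<forall>N (Z :: 'i \<Rightarrow> 'a \<Rightarrow> real) K. iid_exp M Z K a \<longrightarrow> finite K \<longrightarrow> real (card K) \<le> D * real N \<longrightarrow>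
      measure M {\<omega>\<in>space M. card K / a + \<epsilon> * N \<le> (\<Sum>i\<in>K. Z i \<omega>)} \<le> exp (- c * N) \<and>
      measure M {\<omega>\<in>space M. (\<Sum>i\<in>K. Z i \<omega>) \<le> card K / a - \<epsilon> * N} \<le> exp (- c * N)"
proof -
  \<comment> \<open>The first entry is the range of the logarithm bounds; the second keeps the
    quadratic loss below half of the linear gain when \<open>card K \<le> D * N\<close>.\<close>
  define u where "u = min (1/2) (a * \<epsilon> / (4 * (D + 1)))"
  define c where "c = a * u * \<epsilon> / 2"
  have u: "0 < u" "u \<le> 1/2" "u \<le> a * \<epsilon> / (4 * (D + 1))"
    unfolding u_def using a e D by (simp, intro min.cobounded1, intro min.cobounded2)
  have c: "0 < c" using a e u by (simp add: c_def)
  have Du: "2 * D * u \<le> a * \<epsilon> / 2"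
  proof -
    have "u * (4 * (D + 1)) \<le> a * \<epsilon>" using u(3) D by (simp add: pos_le_divide_eq)
    then have "4 * D * u \<le> a * \<epsilon>" using u(1) by (simp add: algebra_simps)
    then show ?thesis by simp
  qed
  have quad: "2 * real k * u\<^sup>2 - a * u * \<epsilon> * N \<le> - c * N" if "real k \<le> D * real N" for k N :: nat
  proof -
    have "2 * real k * u\<^sup>2 \<le> 2 * (D * N) * u\<^sup>2" using that by (intro mult_right_mono) auto
    also have "\<dots> = (2 * D * u) * (u * N)" by (simp add: power2_eq_square)
    also have "\<dots> \<le> (a * \<epsilon> / 2) * (u * N)" using Du u by (intro mult_right_mono) auto
    finally show ?thesis by (simp add: c_def algebra_simps)
  qed
  show ?thesis
  proof (intro exI[of _ c] conjI c allI impI)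
    fix N :: nat and Z :: "'i \<Rightarrow> 'a \<Rightarrow> real" and K
    assume Z: "iid_exp M Z K a" and K: "finite K" and card: "real (card K) \<le> D * real N"
    let ?k = "card K"
    have th: "0 < a * u" "a * u < a" using a u by auto
    have "measure M {\<omega>\<in>space M. ?k / a + \<epsilon> * N \<le> (\<Sum>i\<in>K. Z i \<omega>)}
        \<le> exp (- (a * u) * (?k / a + \<epsilon> * N)) * (a / (a - a * u)) ^ ?k"
      by (rule exp_sum_chernoff(1)[OF Z K a th])
    also have "a / (a - a * u) = exp (- ln (1 - u))"
      using a u by (simp add: exp_minus field_simps)
    also have "exp (- (a * u) * (?k / a + \<epsilon> * N)) * exp (- ln (1 - u)) ^ ?k
        = exp (?k * (- ln (1 - u)) - u * ?k - a * u * \<epsilon> * N)"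
      using a by (simp add: exp_of_nat_mult[symmetric] exp_add[symmetric] algebra_simps)
    also have "\<dots> \<le> exp (- c * N)"
    proof -
      have "?k * (- ln (1 - u)) \<le> ?k * (u + 2 * u\<^sup>2)"
        using ln_one_minus_pos_lower_bound[of u] u by (intro mult_left_mono) auto
      then show ?thesis using quad[OF card] by (simp add: algebra_simps)
    qed
    finally show "measure M {\<omega>\<in>space M. ?k / a + \<epsilon> * N \<le> (\<Sum>i\<in>K. Z i \<omega>)} \<le> exp (- c * N)" .
    have "measure M {\<omega>\<in>space M. (\<Sum>i\<in>K. Z i \<omega>) \<le> ?k / a - \<epsilon> * N}
        \<le> exp ((a * u) * (?k / a - \<epsilon> * N)) * (a / (a + a * u)) ^ ?k"
      by (rule exp_sum_chernoff(2)[OF Z K a th(1)])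
    also have "a / (a + a * u) = exp (- ln (1 + u))"
    proof -
      have "a + a * u = a * (1 + u)" by (simp add: algebra_simps)
      then show ?thesis using a u by (simp add: exp_minus inverse_eq_divide)
    qed
    also have "exp ((a * u) * (?k / a - \<epsilon> * N)) * exp (- ln (1 + u)) ^ ?k
        = exp (u * ?k - ?k * ln (1 + u) - a * u * \<epsilon> * N)"
      using a by (simp add: exp_of_nat_mult[symmetric] exp_add[symmetric] algebra_simps)
    also have "\<dots> \<le> exp (- c * N)"
    proof -
      have "?k * (u - u\<^sup>2) \<le> ?k * ln (1 + u)"
        using ln_one_plus_pos_lower_bound[of u] u by (intro mult_left_mono) auto
      then have "u * ?k - ?k * ln (1 + u) \<le> ?k * u\<^sup>2" by (simp add: algebra_simps)
      also have "\<dots> \<le> 2 * ?k * u\<^sup>2" by simp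
      finally show ?thesis using quad[OF card] by simp
    qed
    finally show "measure M {\<omega>\<in>space M. (\<Sum>i\<in>K. Z i \<omega>) \<le> ?k / a - \<epsilon> * N} \<le> exp (- c * N)" .
  qed
qed

section \<open>Transfer of laws, and domination by the stationary model\<close>

abbreviation rect :: "nat \<Rightarrow> nat \<Rightarrow> (nat \<times> nat) set" where
  "rect m n \<equiv> {1..m} \<times> {1..n}"

lemma measurable_last_passage:
  assumes "\<And>v. v \<in> rect m n \<Longrightarrow> (\<lambda>\<omega>. X \<omega> v) \<in> borel_measurable M"
  shows "(\<lambda>\<omega>. last_passage (X \<omega>) m n) \<in> borel_measurable M"
proof -
  have "i \<le> m \<Longrightarrow> j \<le> n \<Longrightarrow> (\<lambda>\<omega>. last_passage (X \<omega>) i j) \<in> borel_measurable M" for i j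
  proof (induction i arbitrary: j)
    case (Suc i)
    from Suc.prems(2) show ?case
    proof (induction j)
      case (Suc j)
      then show ?case
        using assms[of "(Suc i, Suc j)"] Suc.IH Suc.prems \<open>Suc i \<le> m\<close>
          \<open>\<And>j. i \<le> m \<Longrightarrow> j \<le> n \<Longrightarrow> (\<lambda>\<omega>. last_passage (X \<omega>) i j) \<in> borel_measurable M\<close>[of "Suc j"]
        by (auto intro!: borel_measurable_add borel_measurable_max)
    qed simp
  qed simp
  then show ?thesis by simp
qed

text \<open>The passage time is a function of the weights in \<open>rect m n\<close>, whose joint
  law is the same for both families. Estimates proved on \<open>stat_space\<close> thus carry over
  to any space.\<close>

lemma iid_exp_last_passage_law:
  assumes X: "iid_exp M X (rect m n) 1" and X': "iid_exp M' X' (rect m n) 1" and A: "A \<in> sets borel"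
  shows "measure M {\<omega>\<in>space M. last_passage (\<lambda>v. X v \<omega>) m n \<in> A}
       = measure M' {\<omega>\<in>space M'. last_passage (\<lambda>v. X' v \<omega>) m n \<in> A}"
proof -
  let ?P = "PiM (rect m n) (\<lambda>_. expo 1)"
  have "measure M {\<omega>\<in>space M. last_passage (\<lambda>v. X v \<omega>) m n \<in> A}
      = measure ?P {x\<in>space ?P. last_passage x m n \<in> A}" if X: "iid_exp M X (rect m n) 1"
    for M :: "'z measure" and X
  proof -
    let ?R = "\<lambda>\<omega>. \<lambda>v\<in>rect m n. X v \<omega>"
    have R: "?R \<in> measurable M ?P" by (rule iid_exp_measurable_restrict[OF X])
    have "(\<lambda>x. last_passage x m n) \<in> borel_measurable ?P"
    proof (rule measurable_last_passage)
      fix v assume "v \<in> rect m n"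
      from measurable_component_singleton[OF this, of "\<lambda>_. expo 1"]
      show "(\<lambda>x. x v) \<in> borel_measurable ?P" by simp
    qed
    then have S: "{x\<in>space ?P. last_passage x m n \<in> A} \<in> sets ?P"
      using A by (auto intro: measurable_sets_Collect)
    have eq: "last_passage (?R \<omega>) m n = last_passage (\<lambda>v. X v \<omega>) m n" for \<omega>
      by (intro antisym last_passage_weight_mono) auto
    have "measure ?P {x\<in>space ?P. last_passage x m n \<in> A}
        = measure (distr M ?P ?R) {x\<in>space ?P. last_passage x m n \<in> A}"
      using X by (simp only: iid_exp_def)
    also have "\<dots> = measure M (?R -` {x\<in>space ?P. last_passage x m n \<in> A} \<inter> space M)"
      by (rule measure_distr[OF R S])
    also have "?R -` {x\<in>space ?P. last_passage x m n \<in> A} \<inter> space M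
        = {\<omega>\<in>space M. last_passage (\<lambda>v. X v \<omega>) m n \<in> A}"
      using measurable_space[OF R] eq by auto
    finally show ?thesis ..
  qed
  from this[OF X] this[OF X'] show ?thesis by simp
qed

lemma iid_exp_stat_space:
  assumes r: "0 < r" "r < 1" and f: "inj_on f K" "\<And>i. i \<in> K \<Longrightarrow> stat_rate r (f i) = a"
  shows "iid_exp (stat_space r) (\<lambda>i x. x (f i)) K a"
proof -
  have eq: "PiM K (\<lambda>i. expo (stat_rate r (f i))) = PiM K (\<lambda>_. expo a)"
    using f(2) by (intro PiM_cong) auto
  have "distr (stat_space r) (PiM K (\<lambda>i. expo (stat_rate r (f i)))) (\<lambda>x. \<lambda>i\<in>K. x (f i))
      = PiM K (\<lambda>i. expo (stat_rate r (f i)))"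
    unfolding stat_space_def using f(1) prob_space_exponential_density[OF stat_rate_pos[OF r]]
    by (intro distr_PiM_reindex) auto
  then show ?thesis
    using prob_space_stat_space[OF r] by (simp only: iid_exp_def eq) simp
qed

lemma iid_exp_stat_row:
  assumes "0 < r" "r < 1"
  shows "iid_exp (stat_space r) (\<lambda>a x. x (a, 0)) {1..k} (1 - r)"
  using assms by (intro iid_exp_stat_space) (auto simp: inj_on_def stat_rate_def)

lemma iid_exp_stat_col:
  assumes "0 < r" "r < 1"
  shows "iid_exp (stat_space r) (\<lambda>b x. x (0, b)) {1..k} r"
  using assms by (intro iid_exp_stat_space) (auto simp: inj_on_def stat_rate_def)

lemma iid_exp_stat_bulk:
  assumes "0 < r" "r < 1"
  shows "iid_exp (stat_space r) (\<lambda>v x. shifted k l x v) (rect m n) 1"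
proof -
  have "iid_exp (stat_space r) (\<lambda>v x. x (fst v + k, snd v + l)) (rect m n) 1"
    using assms by (intro iid_exp_stat_space) (auto simp: inj_on_def stat_rate_def)
  then show ?thesis by (simp add: shifted_def split_beta')
qed

lemma iid_exp_stat_column:
  fixes m n :: nat
  assumes r: "0 < r" "r < 1" and m: "1 \<le> m"
  shows "iid_exp (stat_space r) (\<lambda>s x. stat_passage x m (snd s) - stat_passage x m (snd s - 1)) ({0::nat} \<times> {1..n}) r"
proof -
  have eq: "PiM ({0} \<times> {1..n}) (\<lambda>v. expo (stat_rate r v)) = PiM ({0} \<times> {1..n}) (\<lambda>_. expo r)"
    by (intro PiM_cong) (auto simp: stat_rate_def)
  show ?thesis
    using stat_column_law[OF r m, of n] prob_space_stat_space[OF r]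
    unfolding iid_exp_def eq by (simp del: restrict_apply)
qed

lemma AE_stat_space_nonneg:
  assumes "0 < r" "r < 1"
  shows "AE x in stat_space r. nonneg_on UNIV x"
proof -
  have "AE x in stat_space r. 0 \<le> x v" for v
    unfolding stat_space_def using prob_space_exponential_density[OF stat_rate_pos[OF assms]]
    by (intro AE_PiM_component AE_expo_nonneg) auto
  then show ?thesis unfolding nonneg_on_def by (simp add: AE_all_countable)
qed

text \<open>The increments are summed along the bottom axis to \<open>(m, 0)\<close> and then up
  column \<open>m\<close>. Each sum will be over an i.i.d. family, but the two families depend on
  each other, so the sums are estimated separately.\<close>

lemma stat_passage_telescope:
  "stat_passage x m n = (\<Sum>a=1..m. x (a, 0))
     + (\<Sum>s\<in>{0::nat} \<times> {1..n}. stat_passage x m (snd s) - stat_passage x m (snd s - 1))"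
proof -
  have "(\<Sum>s\<in>{0::nat} \<times> {1..n}. stat_passage x m (snd s) - stat_passage x m (snd s - 1))
      = (\<Sum>b=1..n. stat_passage x m b - stat_passage x m (b - 1))"
    by (subst sum.cartesian_product') simp
  also have "\<dots> = stat_passage x m n - stat_passage x m 0"
    by (induction n) auto
  finally show ?thesis by (simp add: stat_passage_row)
qed

text \<open>By domination, an excess of \<open>\<epsilon> * N\<close> forces an excess of
  \<open>\<epsilon> / 2 * N\<close> in the row sum or in the column sum of
  \<open>stat_passage_telescope\<close>.\<close>

lemma last_passage_upper_stat:
  assumes r: "0 < r" "r < 1" and e: "0 < \<epsilon>" and D: "0 \<le> D"
  shows "\<exists>c>0. \<forall>N m n. real m \<le> D * real N \<longrightarrow> real n \<le> D * real N \<longrightarrow>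
    measure (stat_space r) {x\<in>space (stat_space r). last_passage x m n \<in> {m / (1 - r) + n / r + \<epsilon> * N <..}}
      \<le> 2 * exp (- c * real N)"
proof -
  have r': "0 < 1 - r" and e2: "0 < \<epsilon> / 2" using r e by auto
  let ?P = "stat_space r"
  interpret prob_space ?P by (rule prob_space_stat_space[OF r])
  obtain c1 where c1: "0 < c1" "\<And>N Z K. iid_exp ?P Z K (1 - r) \<Longrightarrow> finite (K :: nat set) \<Longrightarrow> real (card K) \<le> D * real N \<Longrightarrow>
      measure ?P {\<omega>\<in>space ?P. card K / (1 - r) + \<epsilon> / 2 * N \<le> (\<Sum>i\<in>K. Z i \<omega>)} \<le> exp (- c1 * N)"
    using exp_sum_deviation[OF r' e2 D] by blast
  obtain c2 where c2: "0 < c2" "\<And>N Z K. iid_exp ?P Z K r \<Longrightarrow> finite (K :: (nat \<times> nat) set) \<Longrightarrow> real (card K) \<le> D * real N \<Longrightarrow>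
      measure ?P {\<omega>\<in>space ?P. card K / r + \<epsilon> / 2 * N \<le> (\<Sum>i\<in>K. Z i \<omega>)} \<le> exp (- c2 * N)"
    using exp_sum_deviation[OF r(1) e2 D] by blast
  define c where "c = min c1 c2"
  show ?thesis
  proof (intro exI[of _ c] conjI allI impI)
    show "0 < c" using c1 c2 by (simp add: c_def)
    fix N m n :: nat
    assume mn: "real m \<le> D * real N" "real n \<le> D * real N"
    show "measure ?P {x\<in>space ?P. last_passage x m n \<in> {m / (1 - r) + n / r + \<epsilon> * N <..}} \<le> 2 * exp (- c * real N)"
    proof (cases "m = 0")
      \<comment> \<open>The column law is stated for \<open>m \<ge> 1\<close>; for
        \<open>m = 0\<close> the passage time is 0 and the event is empty.\<close>
      case True
      have "\<not> m / (1 - r) + n / r + \<epsilon> * N < last_passage x m n" for x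
        using True r e by (simp add: not_less)
      then have "{x\<in>space ?P. last_passage x m n \<in> {m / (1 - r) + n / r + \<epsilon> * N <..}} = {}" by simp
      then show ?thesis by (simp only: measure_empty) simp
    next
      case False
      then have m: "1 \<le> m" by simp
      let ?Z = "\<lambda>s x. stat_passage x m (snd s) - stat_passage x m (snd s - 1)"
      let ?A = "{x\<in>space ?P. card {1..m} / (1 - r) + \<epsilon> / 2 * N \<le> (\<Sum>a=1..m. x (a, 0))}"
      let ?B = "{x\<in>space ?P. card ({0::nat} \<times> {1..n}) / r + \<epsilon> / 2 * N \<le> (\<Sum>s\<in>{0::nat} \<times> {1..n}. ?Z s x)}"
      have meas: "?A \<in> sets ?P" "?B \<in> sets ?P" by measurable
      have "AE x in ?P. x \<in> {x\<in>space ?P. last_passage x m n \<in> {m / (1 - r) + n / r + \<epsilon> * N <..}} \<longrightarrow> x \<in> ?A \<union> ?B"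
        using AE_stat_space_nonneg[OF r]
      proof eventually_elim
        case (elim x)
        then have "last_passage x m n \<le> (\<Sum>a=1..m. x (a, 0)) + (\<Sum>s\<in>{0::nat} \<times> {1..n}. ?Z s x)"
          using last_passage_le_stat_passage[of x m n] stat_passage_telescope[of x m n] by simp
        then show ?case by (auto simp: card_cartesian_product)
      qed
      then have "prob {x\<in>space ?P. last_passage x m n \<in> {m / (1 - r) + n / r + \<epsilon> * N <..}} \<le> prob (?A \<union> ?B)"
        using meas by (intro finite_measure_mono_AE) auto
      also have "\<dots> \<le> prob ?A + prob ?B"
        by (rule measure_Un_le[OF meas])
      also have "prob ?A \<le> exp (- c1 * N)"
        using mn by (intro c1(2) iid_exp_stat_row r) auto
      also have "prob ?B \<le> exp (- c2 * N)"
        using mn by (intro c2(2) iid_exp_stat_column r m) (auto simp: card_cartesian_product)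
      also have "exp (- c1 * N) + exp (- c2 * N) \<le> 2 * exp (- c * N)"
      proof -
        have "c * N \<le> c1 * N" "c * N \<le> c2 * N" by (auto simp: c_def intro!: mult_right_mono)
        then have "exp (- c1 * N) \<le> exp (- c * N)" "exp (- c2 * N) \<le> exp (- c * N)" by auto
        then show ?thesis by linarith
      qed
      finally show ?thesis by simp
    qed
  qed
qed

lemma last_passage_upper:
  assumes r: "0 < r" "r < 1" and e: "0 < \<epsilon>" and D: "0 \<le> D"
  shows "\<exists>c>0. \<forall>N m n X. iid_exp M X (rect m n) 1 \<longrightarrow> real m \<le> D * real N \<longrightarrow> real n \<le> D * real N \<longrightarrow>
    measure M {\<omega>\<in>space M. last_passage (\<lambda>v. X v \<omega>) m n \<in> {m / (1 - r) + n / r + \<epsilon> * N <..}} \<le> 2 * exp (- c * real N)"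
proof -
  obtain c where c: "0 < c" "\<And>N m n. real m \<le> D * real N \<Longrightarrow> real n \<le> D * real N \<Longrightarrow>
    measure (stat_space r) {x\<in>space (stat_space r). last_passage x m n \<in> {m / (1 - r) + n / r + \<epsilon> * N <..}}
      \<le> 2 * exp (- c * real N)"
    using last_passage_upper_stat[OF assms] by blast
  have "iid_exp (stat_space r) (\<lambda>v x. x v) (rect m n) 1" for m n
    using iid_exp_stat_bulk[OF r, of 0 0 m n] by (simp add: shifted_def)
  note law = iid_exp_last_passage_law[OF _ this]
  show ?thesis
  proof (intro exI[of _ c] conjI allI impI c(1))
    fix N m n :: nat and X
    assume *: "iid_exp M X (rect m n) 1" "real m \<le> D * real N" "real n \<le> D * real N"
    show "measure M {\<omega>\<in>space M. last_passage (\<lambda>v. X v \<omega>) m n \<in> {m / (1 - r) + n / r + \<epsilon> * N <..}} \<le> 2 * exp (- c * real N)"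
      using c(2)[OF *(2,3)] by (subst law[OF *(1)]) auto
  qed
qed


subsection \<open>The lower bound\<close>

lemma summable_linear_exp:
  fixes A B c :: real
  assumes "0 \<le> A" "0 \<le> B" "0 < c"
  shows "summable (\<lambda>N. (A + B * real N) * exp (- c * real N))"
proof (rule summable_comparison_test')
  have "summable (\<lambda>N. exp (- (c / 2)) ^ N)"
    using assms by (intro summable_geometric) auto
  then show "summable (\<lambda>N. (A + 2 * B / c) * exp (- (c / 2)) ^ N)"
    by (rule summable_mult)
  fix N :: nat
  have "c / 2 * N \<le> exp (c / 2 * N)"
    using exp_ge_add_one_self[of "c / 2 * N"] by linarith
  then have "real N \<le> 2 / c * exp (c / 2 * N)"
    using assms by (simp add: field_simps)
  then have "B * N \<le> 2 * B / c * exp (c / 2 * N)"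
    using assms mult_left_mono[of "real N" "2 / c * exp (c / 2 * N)" B] by (simp add: field_simps)
  moreover have "A \<le> A * exp (c / 2 * N)"
    using assms mult_left_mono[of 1 "exp (c / 2 * N)" A] by simp
  ultimately have "A + B * N \<le> (A + 2 * B / c) * exp (c / 2 * N)"
    by (simp add: algebra_simps)
  then have "(A + B * N) * exp (- c * N) \<le> (A + 2 * B / c) * exp (c / 2 * N) * exp (- c * N)"
    by (intro mult_right_mono) auto
  also have "\<dots> = (A + 2 * B / c) * exp (- (c / 2)) ^ N"
  proof -
    have "exp (c / 2 * N) * exp (- c * N) = exp (N * (- (c / 2)))"
      unfolding exp_add[symmetric] by (rule arg_cong[where f = exp]) (simp add: field_simps)
    also have "\<dots> = exp (- (c / 2)) ^ N" by (rule exp_of_nat_mult)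
    finally show ?thesis by (simp only: mult.assoc)
  qed
  finally show "norm ((A + B * N) * exp (- c * N)) \<le> (A + 2 * B / c) * exp (- (c / 2)) ^ N"
    using assms by (simp add: abs_mult)
qed

text \<open>\<open>r\<close> minimises \<open>x / (1 - r) + y / r\<close>: the equation between the
  squares says that the derivative vanishes, the one before it gives the minimum.\<close>

lemma characteristic_parameter:
  fixes x y :: real
  assumes "0 < x" "0 < y"
  defines "r \<equiv> sqrt y / (sqrt x + sqrt y)"
  shows "0 < r" "r < 1" "x / (1 - r) + y / r = (sqrt x + sqrt y)\<^sup>2"
    "x / (1 - r)\<^sup>2 = y / r\<^sup>2" "1 - r = sqrt x / (sqrt x + sqrt y)"
proof -
  define s t where "s = sqrt x" and "t = sqrt y"
  have st: "0 < s" "0 < t" "x = s\<^sup>2" "y = t\<^sup>2" using assms by (auto simp: s_def t_def)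
  have r: "r = t / (s + t)" by (simp add: r_def s_def t_def)
  have r1: "1 - r = s / (s + t)" using st by (simp add: r field_simps)
  show "0 < r" "r < 1" using st by (auto simp: r)
  show "1 - r = sqrt x / (sqrt x + sqrt y)" using r1 by (simp add: s_def t_def)
  have "x / (1 - r) = s * (s + t)" "y / r = t * (s + t)"
    using st unfolding r1 unfolding r by (simp_all add: power2_eq_square)
  then show "x / (1 - r) + y / r = (sqrt x + sqrt y)\<^sup>2"
    unfolding s_def[symmetric] t_def[symmetric] by (simp add: power2_eq_square algebra_simps)
  show "x / (1 - r)\<^sup>2 = y / r\<^sup>2"
    unfolding r1 unfolding r using st by (simp add: power_divide)
qed

text \<open>At the characteristic parameter \<open>x / (1 - r) + y / r\<close> is stationary, so moving the
  parameter a little gains only to second order, while shortening \<open>x\<close> by \<open>\<delta>\<close> gains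
  to first order.\<close>

lemma characteristic_gap:
  fixes x y \<delta> :: real
  assumes xy: "0 < x" "0 < y" and d: "0 < \<delta>"
  defines "r \<equiv> sqrt y / (sqrt x + sqrt y)"
  shows "\<exists>r1. r < r1 \<and> r1 < 1 \<and> (x - \<delta>) * (1 / (1 - r1) - 1 / (1 - r)) + y * (1 / r1 - 1 / r) < 0"
proof -
  note r = characteristic_parameter[OF xy, folded r_def]
  define f where "f = (\<lambda>\<eta>. (x - \<delta>) / (1 - \<eta>) + y / \<eta>)"
  have "DERIV f r :> (x - \<delta>) / (1 - r)\<^sup>2 - y / r\<^sup>2"
    unfolding f_def using r(1,2) by (auto intro!: derivative_eq_intros simp: power2_eq_square)
  moreover have "(x - \<delta>) / (1 - r)\<^sup>2 - y / r\<^sup>2 < 0"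
    using r(1,2,4) d by (simp add: diff_divide_distrib)
  ultimately obtain h where h: "0 < h" "\<And>k. 0 < k \<Longrightarrow> k < h \<Longrightarrow> f (r + k) < f r"
    using DERIV_neg_dec_right by blast
  define k where "k = min (h / 2) ((1 - r) / 2)"
  have "0 < k" "k \<le> h / 2" "k \<le> (1 - r) / 2"
    using h(1) r(1,2) unfolding k_def by (simp, intro min.cobounded1, intro min.cobounded2)
  moreover have "2 * k \<le> 1 - r" using \<open>k \<le> (1 - r) / 2\<close> by (simp add: pos_le_divide_eq)
  ultimately have "0 < k" "k < h" "r + k < 1" using h(1) r(2) by linarith+
  with h(2)[of k] show ?thesis
    by (intro exI[of _ "r + k"]) (auto simp: f_def algebra_simps diff_divide_distrib)
qed

text \<open>The deterministic core, for weights that satisfy all estimates with error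
  \<open>E\<close>. The stationary time (\<open>2 * E\<close>) and the boundary sum
  (\<open>E\<close>) make up the \<open>3 * E\<close> of the conclusion. The bulk estimate adds a
  fourth \<open>E\<close>, so \<open>G1\<close> and \<open>G2\<close> rule out exits beyond
  \<open>d\<close>; an exit up to \<open>d\<close> costs at most the mean boundary time up to
  there.\<close>

lemma last_passage_lower_from_exit:
  assumes x: "nonneg_on UNIV x" and mn: "1 \<le> m" "1 \<le> n" and r: "0 < r" "r < 1" and d: "0 \<le> d"
    and S: "m / (1 - r) + n / r - 2 * E \<le> stat_passage x m n"
    and B1: "\<And>k. k \<le> m \<Longrightarrow> (\<Sum>a=1..k. x (a, 0)) \<le> k / (1 - r) + E"
    and B2: "\<And>l. l \<le> n \<Longrightarrow> (\<Sum>b=1..l. x (0, b)) \<le> l / r + E"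
    and C1: "\<And>k. k < m \<Longrightarrow> last_passage (shifted k 0 x) (m - k) n \<le> real (m - k) / (1 - r1) + n / r1 + E"
    and C2: "\<And>l. l < n \<Longrightarrow> last_passage (shifted 0 l x) m (n - l) \<le> m / (1 - r2) + real (n - l) / r2 + E"
    and G1: "\<And>k. k < m \<Longrightarrow> d < real (Suc k) \<Longrightarrow>
      Suc k / (1 - r) + real (m - k) / (1 - r1) + n / r1 + 4 * E < m / (1 - r) + n / r"
    and G2: "\<And>l. l < n \<Longrightarrow> d < real (Suc l) \<Longrightarrow>
      Suc l / r + m / (1 - r2) + real (n - l) / r2 + 4 * E < m / (1 - r) + n / r"
  shows "m / (1 - r) + n / r - 3 * E - d * (1 / (1 - r) + 1 / r) \<le> last_passage x m n"
proof -
  have N: "nonneg_on Nsq x" using x by (auto simp: nonneg_on_def)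
  obtain i j where ij: "m = Suc i" "n = Suc j" using mn by (metis Suc_le_D One_nat_def)
  have d': "0 \<le> d / (1 - r)" "0 \<le> d / r" "d * (1 / (1 - r) + 1 / r) = d / (1 - r) + d / r"
    using d r by (auto simp: algebra_simps)
  from stat_passage_exit[OF N, of i j] show ?thesis
  proof (elim disjE exE conjE)
    fix k assume k: "k \<le> i" and le: "stat_passage x (Suc i) (Suc j)
        \<le> (\<Sum>a=1..Suc k. x (a, 0)) + last_passage (shifted k 0 x) (Suc i - k) (Suc j)"
    have km: "k < m" "Suc k \<le> m" using k ij by auto
    have le': "m / (1 - r) + n / r - 3 * E \<le> Suc k / (1 - r) + last_passage (shifted k 0 x) (m - k) n"
      using le S B1[OF km(2)] unfolding ij[symmetric] by linarith
    have "real (Suc k) \<le> d"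
    proof (rule ccontr)
      assume "\<not> real (Suc k) \<le> d"
      then have "Suc k / (1 - r) + real (m - k) / (1 - r1) + n / r1 + 4 * E < m / (1 - r) + n / r"
        using G1[OF km(1)] by simp
      then show False using le' C1[OF km(1)] by linarith
    qed
    then have "Suc k / (1 - r) \<le> d / (1 - r)" using r by (intro divide_right_mono) auto
    moreover have "last_passage (shifted k 0 x) (m - k) n \<le> last_passage x m n"
      using last_passage_shift_le[OF N, of k 0 "m - k" n] km by simp
    ultimately show ?thesis using le' d' by linarith
  next
    fix l assume l: "l \<le> j" and le: "stat_passage x (Suc i) (Suc j)
        \<le> (\<Sum>b=1..Suc l. x (0, b)) + last_passage (shifted 0 l x) (Suc i) (Suc j - l)"
    have ln: "l < n" "Suc l \<le> n" using l ij by auto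
    have le': "m / (1 - r) + n / r - 3 * E \<le> Suc l / r + last_passage (shifted 0 l x) m (n - l)"
      using le S B2[OF ln(2)] unfolding ij[symmetric] by linarith
    have "real (Suc l) \<le> d"
    proof (rule ccontr)
      assume "\<not> real (Suc l) \<le> d"
      then have "Suc l / r + m / (1 - r2) + real (n - l) / r2 + 4 * E < m / (1 - r) + n / r"
        using G2[OF ln(1)] by simp
      then show False using le' C2[OF ln(1)] by linarith
    qed
    then have "Suc l / r \<le> d / r" using r by (intro divide_right_mono) auto
    moreover have "last_passage (shifted 0 l x) m (n - l) \<le> last_passage x m n"
      using last_passage_shift_le[OF N, of 0 l m "n - l"] ln by simp
    ultimately show ?thesis using le' d' by linarith
  qed
qed

text \<open>Exits beyond \<open>\<delta> N\<close> are too expensive by \<open>characteristic_gap\<close>; the additive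
  constants come from rounding and are absorbed once \<open>N\<close> is large.\<close>

lemma gap_eventually:
  fixes x y \<delta> p p1 q q1 e :: real
  assumes s: "p < p1" and t: "q1 < q" and pq: "0 < p1"
    and gap: "(x - \<delta>) * (p1 - p) + y * (q1 - q) + 4 * e < 0"
  shows "\<forall>\<^sub>F N::nat in sequentially. \<forall>m n k :: nat. real m \<le> real N * x \<longrightarrow> real N * y - 1 \<le> real n \<longrightarrow> k < m
     \<longrightarrow> \<delta> * N < real (Suc k) \<longrightarrow> Suc k * p + real (m - k) * p1 + n * q1 + 4 * (e * N) < m * p + n * q"
proof -
  define \<gamma> where "\<gamma> = - ((x - \<delta>) * (p1 - p) + y * (q1 - q) + 4 * e)"
  have g: "0 < \<gamma>" using gap by (simp add: \<gamma>_def)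
  \<comment> \<open>\<open>p1\<close> pays for the one column by which \<open>m - k\<close> exceeds
    \<open>m - Suc k\<close>, and \<open>q - q1\<close> for the rounding of
    \<open>n\<close>.\<close>
  have "\<forall>\<^sub>F N::nat in sequentially. (p1 + (q - q1)) / \<gamma> < real N"
    using filterlim_real_sequentially unfolding filterlim_at_top_dense by blast
  then show ?thesis
  proof eventually_elim
    case (elim N)
    show ?case
    proof (intro allI impI)
      fix m n k :: nat
      assume m: "real m \<le> real N * x" and n: "real N * y - 1 \<le> real n" and k: "k < m" "\<delta> * N < real (Suc k)"
      have 1: "(real m - Suc k) * (p1 - p) \<le> (real N * x - \<delta> * N) * (p1 - p)"
        using m k s by (intro mult_right_mono) auto
      have 2: "(real N * y - 1) * (q - q1) \<le> real n * (q - q1)"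
        using n t by (intro mult_right_mono) auto
      have 3: "p1 + (q - q1) < N * \<gamma>" using elim g by (simp add: pos_divide_less_eq)
      have "Suc k * p + (real m - real k) * p1 + n * q1 + 4 * (e * N) - (m * p + n * q)
          = (real m - Suc k) * (p1 - p) - n * (q - q1) + p1 + 4 * (e * N)"
        by (simp add: algebra_simps)
      also have "\<dots> \<le> (real N * x - \<delta> * N) * (p1 - p) - (real N * y - 1) * (q - q1) + p1 + 4 * (e * N)"
        using 1 2 by linarith
      also have "\<dots> = - (N * \<gamma>) + p1 + (q - q1)"
        by (simp add: \<gamma>_def algebra_simps)
      also have "\<dots> < 0" using 3 by linarith
      finally show "Suc k * p + real (m - k) * p1 + n * q1 + 4 * (e * N) < m * p + n * q"
        using k by (simp add: of_nat_diff)
    qed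
  qed
qed

text \<open>The mirror image under exchange of the axes, for exits on the vertical axis.\<close>

lemma gap_eventually':
  fixes x y \<delta> p p2 q q2 e :: real
  assumes "q < q2" "p2 < p" "0 < q2"
    and "(y - \<delta>) * (q2 - q) + x * (p2 - p) + 4 * e < 0"
  shows "\<forall>\<^sub>F N::nat in sequentially. \<forall>m n l :: nat. real N * x - 1 \<le> real m \<longrightarrow> real n \<le> real N * y \<longrightarrow> l < n
     \<longrightarrow> \<delta> * N < real (Suc l) \<longrightarrow> Suc l * q + m * p2 + real (n - l) * q2 + 4 * (e * N) < m * p + n * q"
  using gap_eventually[OF assms] by eventually_elim (auto simp: algebra_simps)

text \<open>A union bound over the estimates that \<open>last_passage_lower_from_exit\<close> asks
  for, one for each possible exit. Horizontal exits are tested with a parameter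
  \<open>r1 > r\<close>, vertical ones with \<open>r2 < r\<close>.\<close>

lemma last_passage_lower_stat:
  fixes x y \<epsilon> :: real
  assumes xy: "0 < x" "0 < y" and e: "0 < \<epsilon>"
  defines "r \<equiv> sqrt y / (sqrt x + sqrt y)"
  shows "\<exists>p. summable p \<and> (\<forall>N. measure (stat_space r) {w\<in>space (stat_space r).
     last_passage w (nat \<lfloor>real N * x\<rfloor>) (nat \<lfloor>real N * y\<rfloor>) \<in> {..< real N * ((sqrt x + sqrt y)\<^sup>2 - \<epsilon>)}} \<le> p N)"
proof -
  note char = characteristic_parameter[OF xy, folded r_def]
  note r = char(1,2)
  let ?P = "stat_space r"
  interpret prob_space ?P by (rule prob_space_stat_space[OF r])
  define s where "s = 1 / (1 - r) + 1 / r"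
  have s: "0 < s" using r by (simp add: s_def add_pos_pos)
  \<comment> \<open>Error budget: a quarter of \<open>\<epsilon> * N\<close> each for the boundary
    up to \<open>\<delta> * N\<close>, for the fluctuations \<open>3 * (e' * N)\<close>, and for the
    rounding of the endpoint, which costs at most \<open>s\<close>.\<close>
  define \<delta> where "\<delta> = \<epsilon> / (4 * s)"
  have d: "0 < \<delta>" "\<delta> * s = \<epsilon> / 4" using s e by (auto simp: \<delta>_def)
  obtain r1 where r1: "r < r1" "r1 < 1" "(x - \<delta>) * (1 / (1 - r1) - 1 / (1 - r)) + y * (1 / r1 - 1 / r) < 0"
    using characteristic_gap[OF xy d(1)] unfolding r_def by blast
  \<comment> \<open>Exchanging the axes turns the characteristic parameter into
    \<open>1 - r\<close>; the parameter found there is reflected back to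
    \<open>r2 = 1 - r1'\<close>.\<close>
  have r': "sqrt x / (sqrt y + sqrt x) = 1 - r" using char(5) by (simp add: add.commute)
  obtain r1' where r1': "1 - r < r1'" "r1' < 1" "(y - \<delta>) * (1 / (1 - r1') - 1 / (1 - (1 - r))) + x * (1 / r1' - 1 / (1 - r)) < 0"
    using characteristic_gap[OF xy(2,1) d(1)] unfolding r' by blast
  define r2 where "r2 = 1 - r1'"
  have r2: "0 < r2" "r2 < r" "(y - \<delta>) * (1 / r2 - 1 / r) + x * (1 / (1 - r2) - 1 / (1 - r)) < 0"
    using r1' by (auto simp: r2_def)
  define \<phi>1 \<phi>2 where "\<phi>1 = (x - \<delta>) * (1 / (1 - r1) - 1 / (1 - r)) + y * (1 / r1 - 1 / r)"
    and "\<phi>2 = (y - \<delta>) * (1 / r2 - 1 / r) + x * (1 / (1 - r2) - 1 / (1 - r))"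
  \<comment> \<open>With the eighths, \<open>4 * e'\<close> uses up at most half of either
    gap.\<close>
  define e' where "e' = Min {\<epsilon> / 12, - \<phi>1 / 8, - \<phi>2 / 8}"
  have phi: "\<phi>1 < 0" "\<phi>2 < 0" using r1 r2 by (auto simp: \<phi>1_def \<phi>2_def)
  have e': "0 < e'" "e' \<le> \<epsilon> / 12" "e' \<le> - \<phi>1 / 8" "e' \<le> - \<phi>2 / 8"
    using phi e unfolding e'_def by (auto simp: Min_gr_iff intro!: Min_le)
  have e'': "\<phi>1 + 4 * e' < 0" "\<phi>2 + 4 * e' < 0" using phi e' by linarith+
  define D where "D = x + y"
  have D: "0 \<le> D" using xy by (simp add: D_def)
  have rr: "0 < 1 - r" "0 < r1" "r2 < 1" using r r1 r2 by auto
  obtain c1 where c1: "0 < c1" "\<And>N Z K. iid_exp ?P Z K (1 - r) \<Longrightarrow> finite (K :: nat set) \<Longrightarrow> real (card K) \<le> D * real N \<Longrightarrow>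
      measure ?P {\<omega>\<in>space ?P. card K / (1 - r) + e' * N \<le> (\<Sum>i\<in>K. Z i \<omega>)} \<le> exp (- c1 * N) \<and>
      measure ?P {\<omega>\<in>space ?P. (\<Sum>i\<in>K. Z i \<omega>) \<le> card K / (1 - r) - e' * N} \<le> exp (- c1 * N)"
    using exp_sum_deviation[OF rr(1) e'(1) D] by blast
  obtain c2 where c2: "0 < c2" "\<And>N Z K. iid_exp ?P Z K r \<Longrightarrow> finite (K :: nat set) \<Longrightarrow> real (card K) \<le> D * real N \<Longrightarrow>
      measure ?P {\<omega>\<in>space ?P. card K / r + e' * N \<le> (\<Sum>i\<in>K. Z i \<omega>)} \<le> exp (- c2 * N) \<and>
      measure ?P {\<omega>\<in>space ?P. (\<Sum>i\<in>K. Z i \<omega>) \<le> card K / r - e' * N} \<le> exp (- c2 * N)"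
    using exp_sum_deviation[OF r(1) e'(1) D] by blast
  obtain c3 where c3: "0 < c3" "\<And>N Z K. iid_exp ?P Z K r \<Longrightarrow> finite (K :: (nat \<times> nat) set) \<Longrightarrow> real (card K) \<le> D * real N \<Longrightarrow>
      measure ?P {\<omega>\<in>space ?P. card K / r + e' * N \<le> (\<Sum>i\<in>K. Z i \<omega>)} \<le> exp (- c3 * N) \<and>
      measure ?P {\<omega>\<in>space ?P. (\<Sum>i\<in>K. Z i \<omega>) \<le> card K / r - e' * N} \<le> exp (- c3 * N)"
    using exp_sum_deviation[OF r(1) e'(1) D] by blast
  obtain c4 where c4: "0 < c4" "\<And>N m n X. iid_exp ?P X (rect m n) 1 \<Longrightarrow> real m \<le> D * real N \<Longrightarrow> real n \<le> D * real N \<Longrightarrow>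
      measure ?P {\<omega>\<in>space ?P. last_passage (\<lambda>v. X v \<omega>) m n \<in> {m / (1 - r1) + n / r1 + e' * N <..}} \<le> 2 * exp (- c4 * real N)"
    using last_passage_upper[OF rr(2) r1(2) e'(1) D] by blast
  obtain c5 where c5: "0 < c5" "\<And>N m n X. iid_exp ?P X (rect m n) 1 \<Longrightarrow> real m \<le> D * real N \<Longrightarrow> real n \<le> D * real N \<Longrightarrow>
      measure ?P {\<omega>\<in>space ?P. last_passage (\<lambda>v. X v \<omega>) m n \<in> {m / (1 - r2) + n / r2 + e' * N <..}} \<le> 2 * exp (- c5 * real N)"
    using last_passage_upper[OF r2(1) rr(3) e'(1) D] by blast
  define c where "c = Min {c1, c2, c3, c4, c5}"
  have c: "0 < c" "c \<le> c1" "c \<le> c2" "c \<le> c3" "c \<le> c4" "c \<le> c5"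
    using c1(1) c2(1) c3(1) c4(1) c5(1) unfolding c_def by (auto simp: Min_gr_iff intro!: Min_le)
  have cexp: "exp (- c' * real N) \<le> exp (- c * real N)" if "c \<le> c'" for c' N
    using that by (simp add: mult_right_mono)
  let ?m = "\<lambda>N. nat \<lfloor>real N * x\<rfloor>" and ?n = "\<lambda>N. nat \<lfloor>real N * y\<rfloor>"
  let ?Bad = "\<lambda>N. {w\<in>space ?P. last_passage w (?m N) (?n N) \<in> {..< real N * ((sqrt x + sqrt y)\<^sup>2 - \<epsilon>)}}"
  have mn: "real (?m N) \<le> real N * x" "real N * x - 1 \<le> real (?m N)"
     "real (?n N) \<le> real N * y" "real N * y - 1 \<le> real (?n N)" for N
  proof -
    have "0 \<le> real N * x" "0 \<le> real N * y" using xy by auto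
    then show "real (?m N) \<le> real N * x" "real N * x - 1 \<le> real (?m N)"
      "real (?n N) \<le> real N * y" "real N * y - 1 \<le> real (?n N)" by linarith+
  qed
  have mnD: "real (?m N) \<le> D * real N" "real (?n N) \<le> D * real N" for N
  proof -
    have "0 \<le> real N * x" "0 \<le> real N * y" "D * real N = real N * x + real N * y"
      using xy by (auto simp: D_def algebra_simps)
    then show "real (?m N) \<le> D * real N" "real (?n N) \<le> D * real N"
      using mn[of N] by linarith+
  qed
  have "\<forall>\<^sub>F N::nat in sequentially. prob (?Bad N) \<le> (4 + 6 * D * real N) * exp (- c * real N)"
  proof -
    have "\<forall>\<^sub>F N::nat in sequentially. Max {2 / x, 2 / y, 4 * s / \<epsilon>} < real N"
      using filterlim_real_sequentially unfolding filterlim_at_top_dense by blast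
    moreover have "\<forall>\<^sub>F N::nat in sequentially. \<forall>m n k :: nat. real m \<le> real N * x \<longrightarrow> real N * y - 1 \<le> real n \<longrightarrow> k < m
       \<longrightarrow> \<delta> * N < real (Suc k) \<longrightarrow> Suc k * (1 / (1 - r)) + real (m - k) * (1 / (1 - r1)) + n * (1 / r1) + 4 * (e' * N)
           < m * (1 / (1 - r)) + n * (1 / r)"
      by (rule gap_eventually[where x = x and y = y])
         (use r r1 e'' in \<open>auto simp: \<phi>1_def intro!: divide_strict_left_mono\<close>)
    moreover have "\<forall>\<^sub>F N::nat in sequentially. \<forall>m n l :: nat. real N * x - 1 \<le> real m \<longrightarrow> real n \<le> real N * y \<longrightarrow> l < n
       \<longrightarrow> \<delta> * N < real (Suc l) \<longrightarrow> Suc l * (1 / r) + m * (1 / (1 - r2)) + real (n - l) * (1 / r2) + 4 * (e' * N)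
           < m * (1 / (1 - r)) + n * (1 / r)"
      by (rule gap_eventually'[where x = x and y = y])
         (use r r2 e'' in \<open>auto simp: \<phi>2_def intro!: divide_strict_left_mono\<close>)
    ultimately show ?thesis
    proof eventually_elim
      case (elim N)
      define m n where "m = ?m N" and "n = ?n N"
      note mn' = mn[of N, folded m_def n_def] mnD[of N, folded m_def n_def]
      have big: "2 < N * x" "2 < N * y" "4 * s < \<epsilon> * N"
        using elim(1) xy e by (auto simp: field_simps)
      have m1: "1 \<le> m" "1 \<le> n" using mn' big by linarith+
      let ?Z = "\<lambda>s w. stat_passage w m (snd s) - stat_passage w m (snd s - 1)"
      define A1 where "A1 = {w\<in>space ?P. (\<Sum>a\<in>{1..m}. w (a, 0)) \<le> card {1..m} / (1 - r) - e' * N}"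
      define A2 where "A2 = {w\<in>space ?P. (\<Sum>s\<in>{0::nat} \<times> {1..n}. ?Z s w) \<le> card ({0::nat} \<times> {1..n}) / r - e' * N}"
      define B1 where "B1 k = {w\<in>space ?P. card {1..k} / (1 - r) + e' * N \<le> (\<Sum>a\<in>{1..k}. w (a, 0))}" for k
      define B2 where "B2 l = {w\<in>space ?P. card {1..l} / r + e' * N \<le> (\<Sum>b\<in>{1..l}. w (0, b))}" for l
      define C1 where "C1 k = {w\<in>space ?P. last_passage (\<lambda>v. shifted k 0 w v) (m - k) n \<in> {real (m - k) / (1 - r1) + n / r1 + e' * N <..}}" for k
      define C2 where "C2 l = {w\<in>space ?P. last_passage (\<lambda>v. shifted 0 l w v) m (n - l) \<in> {m / (1 - r2) + real (n - l) / r2 + e' * N <..}}" for l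
      have sh[measurable]: "(\<lambda>w. last_passage (\<lambda>v. shifted k l w v) i j) \<in> borel_measurable ?P" for k l i j
        by (rule measurable_last_passage) (auto simp: shifted_def)
      have meas: "A1 \<in> sets ?P" "A2 \<in> sets ?P" "B1 k \<in> sets ?P" "B2 k \<in> sets ?P" "C1 k \<in> sets ?P" "C2 k \<in> sets ?P" for k
        unfolding A1_def A2_def B1_def B2_def C1_def C2_def by measurable
      have PA1: "prob A1 \<le> exp (- c * N)"
      proof -
        have "prob A1 \<le> exp (- c1 * N)"
          using c1(2)[OF iid_exp_stat_row[OF r], of m N] mn'  unfolding A1_def by simp
        then show ?thesis using cexp[OF c(2), of N] by linarith
      qed
      have PA2: "prob A2 \<le> exp (- c * N)"
      proof -
        have "prob A2 \<le> exp (- c3 * N)"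
          using c3(2)[OF iid_exp_stat_column[OF r m1(1)], of n N] mn'  unfolding A2_def by (simp add: card_cartesian_product)
        then show ?thesis using cexp[OF c(4), of N] by linarith
      qed
      have PB1: "prob (B1 k) \<le> exp (- c * N)" if "k \<le> m" for k
      proof -
        have "prob (B1 k) \<le> exp (- c1 * N)"
          using c1(2)[OF iid_exp_stat_row[OF r], of k N] mn' that unfolding B1_def by simp
        then show ?thesis using cexp[OF c(2), of N] by linarith
      qed
      have PB2: "prob (B2 l) \<le> exp (- c * N)" if "l \<le> n" for l
      proof -
        have "prob (B2 l) \<le> exp (- c2 * N)"
          using c2(2)[OF iid_exp_stat_col[OF r], of l N] mn' that unfolding B2_def by simp
        then show ?thesis using cexp[OF c(3), of N] by linarith
      qed
      have PC1: "prob (C1 k) \<le> 2 * exp (- c * N)" for k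
      proof -
        have "prob (C1 k) \<le> 2 * exp (- c4 * N)"
          using c4(2)[OF iid_exp_stat_bulk[OF r, of k 0 "m - k" n], of N] mn'  unfolding C1_def by simp
        then show ?thesis using cexp[OF c(5), of N] by linarith
      qed
      have PC2: "prob (C2 l) \<le> 2 * exp (- c * N)" for l
      proof -
        have "prob (C2 l) \<le> 2 * exp (- c5 * N)"
          using c5(2)[OF iid_exp_stat_bulk[OF r, of 0 l m "n - l"], of N] mn'  unfolding C2_def by simp
        then show ?thesis using cexp[OF c(6), of N] by linarith
      qed
      \<comment> \<open>The bad event: a part of the stationary time is too small
        (\<open>A1\<close>, \<open>A2\<close>), or some boundary sum (\<open>B1\<close>,
        \<open>B2\<close>) or some bulk time (\<open>C1\<close>, \<open>C2\<close>) is too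
        large.\<close>
      define T where "T = A1 \<union> (A2 \<union> ((\<Union>k\<in>{..m}. B1 k) \<union> ((\<Union>l\<in>{..n}. B2 l) \<union> ((\<Union>k\<in>{..<m}. C1 k) \<union> (\<Union>l\<in>{..<n}. C2 l)))))"
      have UB: "prob (\<Union>k\<in>I. F k) \<le> card I * u" if "finite I" "\<And>k. k \<in> I \<Longrightarrow> F k \<in> sets ?P" "\<And>k. k \<in> I \<Longrightarrow> prob (F k) \<le> u"
        for I :: "nat set" and F and u :: real
        using measure_UNION_le[OF that(1,2), of "\<lambda>k. k"] sum_bounded_above[of I "\<lambda>k. prob (F k)" u] that
          measure_UNION_le[OF that(1,2)] by fastforce
      have Tm: "T \<in> sets ?P" unfolding T_def using meas by auto
      have "prob T \<le> prob A1 + (prob A2 + (prob (\<Union>k\<in>{..m}. B1 k) + (prob (\<Union>l\<in>{..n}. B2 l)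
          + (prob (\<Union>k\<in>{..<m}. C1 k) + prob (\<Union>l\<in>{..<n}. C2 l)))))"
        unfolding T_def using meas by (intro order_trans[OF measure_Un_le] add_left_mono) auto
      also have "\<dots> \<le> exp (- c * N) + (exp (- c * N) + ((m + 1) * exp (- c * N) + ((n + 1) * exp (- c * N)
          + (m * (2 * exp (- c * N)) + n * (2 * exp (- c * N))))))"
        using UB[of "{..m}" B1 "exp (- c * N)"] UB[of "{..n}" B2 "exp (- c * N)"]
          UB[of "{..<m}" C1 "2 * exp (- c * N)"] UB[of "{..<n}" C2 "2 * exp (- c * N)"] meas PA1 PA2 PB1 PB2 PC1 PC2
        by (intro add_mono) auto
      also have "\<dots> = (4 + 3 * real m + 3 * real n) * exp (- c * N)"
        by (simp add: algebra_simps)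
      also have "\<dots> \<le> (4 + 6 * D * N) * exp (- c * N)"
        using mn' by (intro mult_right_mono) auto
      finally have PT: "prob T \<le> (4 + 6 * D * N) * exp (- c * N)" .
      have "AE w in ?P. w \<in> ?Bad N \<longrightarrow> w \<in> T"
        using AE_stat_space_nonneg[OF r]
      proof eventually_elim
        case (elim w)
        show ?case
        proof (rule impI, rule ccontr)
          assume w: "w \<in> ?Bad N" and "w \<notin> T"
          then have sp: "w \<in> space ?P" by simp
          have nA: "m / (1 - r) - e' * N < (\<Sum>a=1..m. w (a, 0))"
              "n / r - e' * N < (\<Sum>s\<in>{0::nat} \<times> {1..n}. ?Z s w)"
            using \<open>w \<notin> T\<close> sp by (auto simp: T_def A1_def A2_def card_cartesian_product)
          have nB: "(\<Sum>a=1..k. w (a, 0)) \<le> k / (1 - r) + e' * N" if "k \<le> m" for k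
            using \<open>w \<notin> T\<close> sp that by (auto simp: T_def B1_def less_imp_le not_le)
          have nB2: "(\<Sum>b=1..k. w (0, b)) \<le> k / r + e' * N" if "k \<le> n" for k
            using \<open>w \<notin> T\<close> sp that by (auto simp: T_def B2_def less_imp_le not_le)
          have nC1: "last_passage (shifted k 0 w) (m - k) n \<le> real (m - k) / (1 - r1) + n / r1 + e' * N" if "k < m" for k
            using \<open>w \<notin> T\<close> sp that by (auto simp: T_def C1_def not_less)
          have nC2: "last_passage (shifted 0 l w) m (n - l) \<le> m / (1 - r2) + real (n - l) / r2 + e' * N" if "l < n" for l
            using \<open>w \<notin> T\<close> sp that by (auto simp: T_def C2_def not_less)
          have "m / (1 - r) + n / r - 3 * (e' * N) - \<delta> * N * (1 / (1 - r) + 1 / r) \<le> last_passage w m n"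
          proof (rule last_passage_lower_from_exit[OF elim m1 r _ _ nB nB2 nC1 nC2])
            show "0 \<le> \<delta> * N" using d by simp
            show "m / (1 - r) + n / r - 2 * (e' * N) \<le> stat_passage w m n"
              using nA stat_passage_telescope[of w m n] by linarith
          qed (use \<open>\<forall>m n k. real m \<le> real N * x \<longrightarrow> real N * y - 1 \<le> real n \<longrightarrow> k < m
       \<longrightarrow> \<delta> * N < real (Suc k) \<longrightarrow> Suc k * (1 / (1 - r)) + real (m - k) * (1 / (1 - r1)) + n * (1 / r1) + 4 * (e' * N)
           < m * (1 / (1 - r)) + n * (1 / r)\<close> \<open>\<forall>m n l. real N * x - 1 \<le> real m \<longrightarrow> real n \<le> real N * y \<longrightarrow> l < n
       \<longrightarrow> \<delta> * N < real (Suc l) \<longrightarrow> Suc l * (1 / r) + m * (1 / (1 - r2)) + real (n - l) * (1 / r2) + 4 * (e' * N)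
           < m * (1 / (1 - r)) + n * (1 / r)\<close> mn' in auto)
          moreover have "\<delta> * N * (1 / (1 - r) + 1 / r) = \<epsilon> / 4 * N"
            unfolding s_def[symmetric] d(2)[symmetric] by simp
          moreover have "3 * (e' * N) \<le> \<epsilon> / 4 * N"
            using mult_right_mono[OF e'(2), of "real N"] by simp
          moreover have "N * ((sqrt x + sqrt y)\<^sup>2) - s \<le> m / (1 - r) + n / r"
          proof -
            have "(N * x - 1) / (1 - r) \<le> m / (1 - r)" "(N * y - 1) / r \<le> n / r"
              using mn' r by (auto intro!: divide_right_mono)
            then show ?thesis unfolding char(3)[symmetric] s_def
              by (simp add: algebra_simps diff_divide_distrib)
          qed
          moreover have "last_passage w m n < N * (sqrt x + sqrt y)\<^sup>2 - \<epsilon> * N"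
            using w by (simp add: m_def n_def algebra_simps)
          ultimately show False using big(3) s by linarith
        qed
      qed
      then have "prob (?Bad N) \<le> prob T"
        using Tm by (intro finite_measure_mono_AE)
      then show ?case using PT by simp
    qed
  qed
  then obtain N0 where N0: "\<And>N. N0 \<le> N \<Longrightarrow> prob (?Bad N) \<le> (4 + 6 * D * real N) * exp (- c * real N)"
    unfolding eventually_sequentially by blast
  \<comment> \<open>Adding 1 for the finitely many small \<open>N\<close> makes \<open>p\<close> a
    bound for every \<open>N\<close> and keeps it summable.\<close>
  define p where "p N = (if N \<in> {..<N0} then 1 else 0) + (4 + 6 * D * real N) * exp (- c * real N)" for N
  have "summable p" unfolding p_def
    using D c(1) by (intro summable_add summable_If_finite_set summable_linear_exp) auto
  moreover have "prob (?Bad N) \<le> p N" for N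
  proof (cases "N < N0")
    case True
    have "0 \<le> (4 + 6 * D * real N) * exp (- c * real N)" using D by simp
    moreover have "p N = 1 + (4 + 6 * D * real N) * exp (- c * real N)"
      using True by (simp add: p_def)
    ultimately show ?thesis using prob_le_1[of "?Bad N"] by linarith
  next
    case False
    then show ?thesis using N0[of N] by (simp add: p_def)
  qed
  ultimately show ?thesis by blast
qed

lemma last_passage_lower:
  fixes x y \<epsilon> :: real
  assumes xy: "0 < x" "0 < y" and e: "0 < \<epsilon>"
  shows "\<exists>p. summable p \<and> (\<forall>N X. iid_exp M X (rect (nat \<lfloor>real N * x\<rfloor>) (nat \<lfloor>real N * y\<rfloor>)) 1 \<longrightarrow>
     measure M {\<omega>\<in>space M. last_passage (\<lambda>v. X v \<omega>) (nat \<lfloor>real N * x\<rfloor>) (nat \<lfloor>real N * y\<rfloor>)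
       \<in> {..< real N * ((sqrt x + sqrt y)\<^sup>2 - \<epsilon>)}} \<le> p N)"
proof -
  define r where "r = sqrt y / (sqrt x + sqrt y)"
  note r = characteristic_parameter(1,2)[OF xy, folded r_def]
  have "iid_exp (stat_space r) (\<lambda>v x. x v) (rect m n) 1" for m n
    using iid_exp_stat_bulk[OF r, of 0 0 m n] by (simp add: shifted_def)
  note law = iid_exp_last_passage_law[OF _ this]
  obtain p where p: "summable p" "\<And>N. measure (stat_space r) {w\<in>space (stat_space r).
     last_passage w (nat \<lfloor>real N * x\<rfloor>) (nat \<lfloor>real N * y\<rfloor>) \<in> {..< real N * ((sqrt x + sqrt y)\<^sup>2 - \<epsilon>)}} \<le> p N"
    using last_passage_lower_stat[OF assms] unfolding r_def[symmetric] by blast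
  show ?thesis
  proof (intro exI[of _ p] conjI p(1) allI impI)
    fix N X
    assume X: "iid_exp M X (rect (nat \<lfloor>real N * x\<rfloor>) (nat \<lfloor>real N * y\<rfloor>)) 1"
    show "measure M {\<omega>\<in>space M. last_passage (\<lambda>v. X v \<omega>) (nat \<lfloor>real N * x\<rfloor>) (nat \<lfloor>real N * y\<rfloor>)
       \<in> {..< real N * ((sqrt x + sqrt y)\<^sup>2 - \<epsilon>)}} \<le> p N"
      using p(2)[of N] by (subst law[OF X]) auto
  qed
qed


subsection \<open>The limit shape function\<close>

context
  fixes c1 c2 c b :: real
  assumes c12: "c2 \<le> c1" "0 < c2"
  defines "c \<equiv> c1 / c2" and "b \<equiv> 2 * c - 1 - 2 * sqrt (c * (c - 1))"
begin

lemma c_ge_1: "1 \<le> c"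
  using c12 by (simp add: c_def)

text \<open>\<open>b\<close> is the root of this quadratic in \<open>(0, 1]\<close>; the product of
  the roots is 1. Divided by \<open>b\<close>, the equation says
  \<open>1 / (1 - r) + 1 / r = 4 * c\<close> for \<open>r = 1 / (1 + b)\<close>.\<close>

lemma b_equation: "(1 + b)\<^sup>2 = 4 * c * b"
proof -
  have "0 \<le> c * (c - 1)" using c_ge_1 by simp
  then have "(sqrt (c * (c - 1)))\<^sup>2 = c * (c - 1)" by simp
  moreover have "sqrt (c * (c - 1)) = (2 * c - 1 - b) / 2" by (simp add: b_def)
  ultimately have "((2 * c - 1 - b) / 2)\<^sup>2 = c * (c - 1)" by simp
  then show ?thesis by (simp add: power2_eq_square field_simps)
qed

lemma b_bounds: "0 < b" "b \<le> 1"
proof -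
  have "sqrt (c * (c - 1)) < (2 * c - 1) / 2"
    using c_ge_1 by (intro real_less_lsqrt) (auto simp: power2_eq_square field_simps)
  then show "0 < b" by (simp add: b_def)
  have "c - 1 \<le> sqrt (c * (c - 1))"
    using c_ge_1 by (intro real_le_rsqrt) (auto simp: power2_eq_square intro: mult_right_mono)
  then show "b \<le> 1" by (simp add: b_def)
qed

lemma b_eq_1: "b = 1 \<Longrightarrow> c1 = c2"
  using b_equation c12 by (simp add: c_def field_simps)

text \<open>The first branch of \<open>lpp_Phi\<close> can apply here only if \<open>b = 1\<close>,
  that is \<open>c1 = c2\<close>, and then the two formulas coincide.\<close>

lemma lpp_Phi_below:
  assumes "0 < y" "y \<le> x"
  shows "lpp_Phi c1 c2 x y = (sqrt x + sqrt y)\<^sup>2 / c2"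
proof (cases "x \<le> b\<^sup>2 * y")
  case True
  then have "1 * y \<le> b\<^sup>2 * y" using assms by linarith
  then have "1 \<le> b\<^sup>2" using assms(1) by (rule mult_right_le_imp_le)
  then have "\<not> b < 1" using b_bounds(1) mult_strict_mono[of b 1 b 1] by (auto simp: power2_eq_square)
  then have "b = 1" using b_bounds(2) by simp
  then show ?thesis using b_eq_1 assms True by (auto simp: lpp_Phi_def Let_def c_def[symmetric] b_def[symmetric])
next
  case False
  then show ?thesis using assms by (simp add: lpp_Phi_def Let_def c_def[symmetric] b_def[symmetric])
qed

lemma lpp_Phi_steep:
  assumes "x \<le> b\<^sup>2 * y"
  shows "lpp_Phi c1 c2 x y = (sqrt x + sqrt y)\<^sup>2 / c1"
  using assms by (simp add: lpp_Phi_def Let_def c_def[symmetric] b_def[symmetric])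

text \<open>In terms of \<open>q = sqrt x / sqrt y\<close> the right-hand side is
  \<open>(1 + q)^2 / q\<close>, which decreases on \<open>(0, 1]\<close> and equals
  \<open>4 * c\<close> at \<open>q = b\<close>.\<close>

lemma steep_parameter:
  assumes xy: "0 < x" "0 < y" and le: "x \<le> b\<^sup>2 * y"
  defines "r \<equiv> sqrt y / (sqrt x + sqrt y)"
  shows "4 * c \<le> 1 / (1 - r) + 1 / r"
proof -
  define q where "q = sqrt x / sqrt y"
  have q: "0 < q" "q \<le> b"
  proof -
    show "0 < q" using xy by (simp add: q_def)
    have "sqrt x \<le> sqrt (b\<^sup>2 * y)" using le by simp
    also have "\<dots> = b * sqrt y" using b_bounds by (simp add: real_sqrt_mult)
    finally show "q \<le> b" using xy by (simp add: q_def pos_divide_le_eq)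
  qed
  have "1 / (1 - r) + 1 / r = (1 + q)\<^sup>2 / q"
  proof -
    have "1 / (1 - r) = (sqrt x + sqrt y) / sqrt x" "1 / r = (sqrt x + sqrt y) / sqrt y"
      using characteristic_parameter(5)[OF xy] by (auto simp: r_def)
    moreover have "(s + t) / s + (s + t) / t = (1 + s / t)\<^sup>2 / (s / t)" if "0 < s" "0 < t" for s t :: real
      using that by (simp add: power2_eq_square field_simps)
    ultimately show ?thesis using xy by (simp only: q_def) simp
  qed
  moreover have "(1 + b)\<^sup>2 / b \<le> (1 + q)\<^sup>2 / q"
  proof -
    have "q * b \<le> 1" using q b_bounds mult_mono[of q 1 b 1] by simp
    then have "0 \<le> (b - q) * (1 - q * b)" using q by (intro mult_nonneg_nonneg) auto
    then have "(1 + b)\<^sup>2 * q \<le> (1 + q)\<^sup>2 * b" by (simp add: power2_eq_square algebra_simps)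
    then show ?thesis using q b_bounds by (simp add: frac_le_eq pos_divide_le_eq pos_le_divide_eq field_simps)
  qed
  moreover have "(1 + b)\<^sup>2 / b = 4 * c" using b_equation b_bounds by simp
  ultimately show ?thesis by simp
qed

text \<open>\<open>(a, a)\<close> is where the optimal path leaves the diagonal: the rest has the
  critical direction, \<open>x - a = b^2 * (y - a)\<close>. The linear branch gets two forms, one at
  the fixed parameter \<open>r\<close> for the upper bound, and one as diagonal plus homogeneous
  piece for the lower bound.\<close>

lemma lpp_Phi_middle:
  assumes xy: "0 < x" "b\<^sup>2 * y < x" "x < y"
  defines "r \<equiv> 1 / (1 + b)" and "a \<equiv> (x - b\<^sup>2 * y) / (1 - b\<^sup>2)"
  shows "0 < r" "r < 1" "1 / (1 - r) + 1 / r = 4 * c" "lpp_Phi c1 c2 x y = (x / (1 - r) + y / r) / c1"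
    "0 < a" "a < x" "lpp_Phi c1 c2 x y = 4 * a / c2 + (sqrt (x - a) + sqrt (y - a))\<^sup>2 / c1"
proof -
  note b0 = b_bounds(1)
  have b1: "b < 1"
    using b_bounds(2) xy by (cases "b = 1") auto
  have b2: "0 < 1 - b\<^sup>2" using b0 b1 by (simp add: power_less_one_iff)
  have b2': "1 - b\<^sup>2 = (1 - b) * (1 + b)" by (simp add: power2_eq_square algebra_simps)
  show r: "0 < r" "r < 1" using b0 by (auto simp: r_def)
  have r1: "1 / r = 1 + b" using b0 by (simp add: r_def)
  have r2: "1 / (1 - r) = (1 + b) / b"
  proof -
    have "1 - r = b / (1 + b)" using b0 by (simp add: r_def field_simps)
    then show ?thesis by simp
  qed
  have fourc: "4 * c = (1 + b)\<^sup>2 / b" using b_equation b0 by simp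
  show "1 / (1 - r) + 1 / r = 4 * c"
    unfolding r1 r2 fourc using b0 by (simp add: power2_eq_square field_simps)
  have P: "lpp_Phi c1 c2 x y = (x * ((1 + b) / b) + y * (1 + b)) / c1"
  proof -
    have 1: "(4 * c - (1 + b)\<^sup>2) / (1 - b\<^sup>2) = (1 + b) / b"
    proof -
      have "4 * c - (1 + b)\<^sup>2 = (1 + b) / b * (1 - b\<^sup>2)"
        unfolding fourc using b0 by (simp add: power2_eq_square field_simps)
      then show ?thesis using b2 by simp
    qed
    have 2: "((1 + b)\<^sup>2 - 4 * c * b\<^sup>2) / (1 - b\<^sup>2) = 1 + b"
    proof -
      have "4 * c * b\<^sup>2 = (1 + b)\<^sup>2 * b" using b_equation by (simp add: power2_eq_square)
      then have "(1 + b)\<^sup>2 - 4 * c * b\<^sup>2 = (1 + b) * (1 - b\<^sup>2)"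
        by (simp add: power2_eq_square algebra_simps)
      then show ?thesis using b2 by simp
    qed
    have "lpp_Phi c1 c2 x y = x * (4 * c - (1 + b)\<^sup>2) / (c1 * (1 - b\<^sup>2)) + y * ((1 + b)\<^sup>2 - 4 * c * b\<^sup>2) / (c1 * (1 - b\<^sup>2))"
      using xy by (simp add: lpp_Phi_def Let_def c_def[symmetric] b_def[symmetric])
    also have "\<dots> = (x * ((4 * c - (1 + b)\<^sup>2) / (1 - b\<^sup>2)) + y * (((1 + b)\<^sup>2 - 4 * c * b\<^sup>2) / (1 - b\<^sup>2))) / c1"
      by (simp add: add_divide_distrib mult.commute)
    finally show ?thesis unfolding 1 2 .
  qed
  show "lpp_Phi c1 c2 x y = (x / (1 - r) + y / r) / c1"
  proof -
    have "x / (1 - r) = x * (1 / (1 - r))" "y / r = y * (1 / r)" by simp_all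
    then show ?thesis unfolding P r1 r2 by simp
  qed
  show "0 < a" using xy b2 by (simp add: a_def)
  have xa: "x - a = b\<^sup>2 * (y - a)"
  proof -
    have "a * (1 - b\<^sup>2) = x - b\<^sup>2 * y" using b2 by (simp add: a_def)
    then show ?thesis by (simp add: algebra_simps)
  qed
  have ya: "y - a = (y - x) / (1 - b\<^sup>2)"
  proof -
    have "y - x = (y - a) * (1 - b\<^sup>2)" using xa by (simp add: algebra_simps)
    then show ?thesis using b2 by simp
  qed
  have ya0: "0 < y - a" unfolding ya using xy b2 by simp
  then have "0 < x - a" unfolding xa using b0 by simp
  then show "a < x" by simp
  have "sqrt (x - a) = b * sqrt (y - a)" unfolding xa using b0 by (simp add: real_sqrt_mult)
  then have "(sqrt (x - a) + sqrt (y - a))\<^sup>2 = (1 + b)\<^sup>2 * (sqrt (y - a))\<^sup>2"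
    by (simp add: power2_eq_square algebra_simps)
  also have "(sqrt (y - a))\<^sup>2 = y - a" using ya0 by simp
  finally have sq: "(sqrt (x - a) + sqrt (y - a))\<^sup>2 = (1 + b)\<^sup>2 * (y - a)" .
  have "4 * a / c2 = 4 * c * a / c1" using c12 by (simp add: c_def)
  also have "\<dots> = (1 + b)\<^sup>2 / b * a / c1" unfolding fourc ..
  finally have "4 * a / c2 + (sqrt (x - a) + sqrt (y - a))\<^sup>2 / c1 = (1 + b)\<^sup>2 * (a / b + (y - a)) / c1"
    unfolding sq by (simp add: add_divide_distrib distrib_left)
  also have "(1 + b)\<^sup>2 * (a / b + (y - a)) = x * ((1 + b) / b) + y * (1 + b)"
  proof -
    have "a * (1 - b\<^sup>2) = x - b\<^sup>2 * y" using b2 by (simp add: a_def)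
    then have "(1 + b) * (a * (1 - b) + b * y) = x + b * y"
      by (simp add: power2_eq_square algebra_simps)
    then have "(1 + b) * ((1 + b) * (a * (1 - b) + b * y)) = (1 + b) * (x + b * y)" by simp
    then show ?thesis using b0 by (simp add: power2_eq_square field_simps)
  qed
  finally show "lpp_Phi c1 c2 x y = 4 * a / c2 + (sqrt (x - a) + sqrt (y - a))\<^sup>2 / c1"
    unfolding P ..
qed

end


subsection \<open>Almost sure bounds\<close>

lemma shifted_0_0 [simp]: "shifted 0 0 w = w"
  by (auto simp: shifted_def)

lemma iid_exp_reindex:
  assumes Z: "iid_exp M Z K a" and a: "0 < a" and f: "inj_on f I" "f \<in> I \<rightarrow> K"
  shows "iid_exp M (\<lambda>i. Z (f i)) I a"
proof -
  have R: "(\<lambda>x. \<lambda>i\<in>I. x (f i)) \<in> measurable (PiM K (\<lambda>_. expo a)) (PiM I (\<lambda>_. expo a))"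
    using f(2) by (intro measurable_restrict measurable_component_singleton) auto
  have "distr M (PiM I (\<lambda>_. expo a)) ((\<lambda>x. \<lambda>i\<in>I. x (f i)) \<circ> (\<lambda>\<omega>. \<lambda>i\<in>K. Z i \<omega>))
      = distr (distr M (PiM K (\<lambda>_. expo a)) (\<lambda>\<omega>. \<lambda>i\<in>K. Z i \<omega>)) (PiM I (\<lambda>_. expo a)) (\<lambda>x. \<lambda>i\<in>I. x (f i))"
    by (rule distr_distr[OF R iid_exp_measurable_restrict[OF Z], symmetric])
  also have "distr M (PiM K (\<lambda>_. expo a)) (\<lambda>\<omega>. \<lambda>i\<in>K. Z i \<omega>) = PiM K (\<lambda>_. expo a)"
    using Z by (simp only: iid_exp_def)
  also have "distr (PiM K (\<lambda>_. expo a)) (PiM I (\<lambda>_. expo a)) (\<lambda>x. \<lambda>i\<in>I. x (f i)) = PiM I (\<lambda>_. expo a)"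
    using prob_space_exponential_density[OF a] f by (intro distr_PiM_reindex) auto
  also have "(\<lambda>x. \<lambda>i\<in>I. x (f i)) \<circ> (\<lambda>\<omega>. \<lambda>i\<in>K. Z i \<omega>) = (\<lambda>\<omega>. \<lambda>i\<in>I. Z (f i) \<omega>)"
    using f(2) by (auto simp: fun_eq_iff restrict_def)
  finally show ?thesis
    using Z f(2) by (simp only: iid_exp_def) auto
qed

lemma (in prob_space) iid_exp_of_indep_vars:
  assumes ind: "indep_vars (\<lambda>_. borel) Z K" and K: "K \<noteq> {}"
    and law: "\<And>v. v \<in> K \<Longrightarrow> distributed M lborel (Z v) (exponential_density a)"
  shows "iid_exp M Z K a"
proof -
  have m: "Z v \<in> borel_measurable M" if "v \<in> K" for v
    using distributed_measurable[OF law[OF that]] by simp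
  have d: "distr M borel (Z v) = expo a" if "v \<in> K" for v
    using distributed_distr_eq_density[OF law[OF that]] by (simp cong: distr_cong)
  have "distr M (PiM K (\<lambda>_. expo a)) (\<lambda>\<omega>. \<lambda>v\<in>K. Z v \<omega>) = distr M (PiM K (\<lambda>_. borel)) (\<lambda>\<omega>. \<lambda>v\<in>K. Z v \<omega>)"
    by (intro distr_cong refl sets_PiM_cong) auto
  also have "\<dots> = PiM K (\<lambda>v. distr M borel (Z v))"
    using ind K m by (subst (asm) indep_vars_iff_distr_eq_PiM') auto
  also have "\<dots> = PiM K (\<lambda>_. expo a)"
    using d by (intro PiM_cong) auto
  finally show ?thesis using m prob_space_axioms by (simp only: iid_exp_def) auto
qed

lemma AE_eventually_not:
  assumes "prob_space M" and A: "\<And>N. A N \<in> sets M" and p: "summable p" "\<And>N. measure M (A N) \<le> p N"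
  shows "AE \<omega> in M. eventually (\<lambda>N::nat. \<omega> \<notin> A N) sequentially"
proof -
  interpret prob_space M by fact
  have "summable (\<lambda>N. measure M (A N))"
    by (rule summable_comparison_test'[OF p(1), of 0]) (use p(2) in auto)
  then have "AE \<omega> in M. eventually (\<lambda>N. \<omega> \<in> space M - A N) sequentially"
    using A by (intro borel_cantelli_AE1) (auto simp: emeasure_eq_measure)
  then show ?thesis by eventually_elim (auto elim: eventually_mono)
qed

text \<open>A coupling: \<open>Y\<close> is a pointwise function of the i.i.d. weights
  \<open>X\<close>, so comparing rates becomes comparing passage times for each
  \<open>\<omega>\<close> with nonnegative weights.\<close>

locale two_phase = prob_space M for M :: "'a measure" +
  fixes X :: "nat \<times> nat \<Rightarrow> 'a \<Rightarrow> real" and Y and c1 c2 :: real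
  assumes c12: "c2 \<le> c1" "0 < c2"
    and X: "indep_vars (\<lambda>_. borel) X Nsq"
    and law: "\<And>v. v \<in> Nsq \<Longrightarrow> distributed M lborel (X v) (exponential_density 1)"
    and Y: "\<And>v \<omega>. Y v \<omega> = X v \<omega> / lpp_rate c1 c2 v"
begin

lemma c1_pos: "0 < c1"
  using c12 by simp

lemma shifted_apply2: "(\<lambda>v. shifted k l X v \<omega>) = shifted k l (\<lambda>v. X v \<omega>)"
  by (auto simp: shifted_def)

lemma iid_exp_shifted: "iid_exp M (shifted k l X) (rect m n) 1"
proof -
  \<comment> \<open>The extra row and column keep the index set nonempty, as
    \<open>iid_exp_of_indep_vars\<close> requires.\<close>
  let ?K = "rect (Suc (k + m)) (Suc (l + n))"
  have K: "?K \<subseteq> Nsq" "?K \<noteq> {}" by (auto simp: Nsq_def)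
  then have "iid_exp M X ?K 1"
    by (intro iid_exp_of_indep_vars indep_vars_subset[OF X] law) auto
  then have "iid_exp M (\<lambda>v. X (fst v + k, snd v + l)) (rect m n) 1"
    by (rule iid_exp_reindex) (auto simp: inj_on_def)
  then show ?thesis by (simp add: shifted_def split_beta')
qed

lemma iid_exp_X: "iid_exp M X (rect m n) 1"
  using iid_exp_shifted[of 0 0 m n] by simp

lemma measurable_X: "v \<in> Nsq \<Longrightarrow> X v \<in> borel_measurable M"
  using distributed_measurable[OF law] by simp

lemma measurable_last_passage_shifted [measurable]:
  "(\<lambda>\<omega>. last_passage (shifted k l (\<lambda>v. X v \<omega>)) m n) \<in> borel_measurable M"
  by (rule measurable_last_passage) (auto intro!: measurable_X)

lemma measurable_last_passage_X [measurable]: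
  "(\<lambda>\<omega>. last_passage (\<lambda>v. X v \<omega>) m n) \<in> borel_measurable M"
  using measurable_last_passage_shifted[of 0 0] by simp

lemma AE_nonneg: "AE \<omega> in M. nonneg_on Nsq (\<lambda>v. X v \<omega>)"
proof -
  have "AE \<omega> in M. 0 \<le> X v \<omega>" if v: "v \<in> Nsq" for v
  proof -
    have "AE x in distr M lborel (X v). 0 \<le> x"
      unfolding distributed_distr_eq_density[OF law[OF v]] by (rule AE_expo_nonneg)
    then show ?thesis
      by (rule AE_distrD[OF distributed_measurable[OF law[OF v]]])
  qed
  moreover have "countable Nsq" by (rule countable_subset[of _ UNIV]) auto
  ultimately show ?thesis unfolding nonneg_on_def by (subst AE_ball_countable) auto
qed

lemma rate_pos: "0 < lpp_rate c1 c2 v"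
  using c12 c1_pos by (auto simp: lpp_rate_def split: prod.splits)

lemma nonneg_Y: "nonneg_on Nsq (\<lambda>v. X v \<omega>) \<Longrightarrow> nonneg_on Nsq (\<lambda>v. Y v \<omega>)"
  using rate_pos by (auto simp: nonneg_on_def Y less_imp_le)

lemma Y_ge: "nonneg_on Nsq (\<lambda>v. X v \<omega>) \<Longrightarrow> v \<in> Nsq \<Longrightarrow> X v \<omega> / c1 \<le> Y v \<omega>"
  unfolding Y using c12 c1_pos by (intro divide_left_mono) (auto simp: nonneg_on_def lpp_rate_def split: prod.splits)

lemma Y_le: "nonneg_on Nsq (\<lambda>v. X v \<omega>) \<Longrightarrow> v \<in> Nsq \<Longrightarrow> Y v \<omega> \<le> X v \<omega> / c2"
  unfolding Y using c12 c1_pos by (intro divide_left_mono) (auto simp: nonneg_on_def lpp_rate_def split: prod.splits)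

lemma last_passage_Y_ge:
  assumes "nonneg_on Nsq (\<lambda>v. X v \<omega>)"
  shows "last_passage (shifted k l (\<lambda>v. X v \<omega>)) m n / c1 \<le> last_passage (shifted k l (\<lambda>v. Y v \<omega>)) m n"
  unfolding last_passage_divide[OF c1_pos, symmetric]
  by (intro last_passage_weight_mono) (auto intro!: Y_ge assms)

lemma last_passage_Y_le:
  assumes "nonneg_on Nsq (\<lambda>v. X v \<omega>)"
  shows "last_passage (\<lambda>v. Y v \<omega>) m n \<le> last_passage (\<lambda>v. X v \<omega>) m n / c2"
  unfolding last_passage_divide[OF c12(2), symmetric]
  by (intro last_passage_weight_mono) (auto intro!: Y_le assms)

text \<open>The leftmost column of the box is \<open>k + 1\<close> and its top row
  \<open>n + l\<close>, so the hypothesis puts every cell on or below the diagonal, where the rate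
  is \<open>c2\<close> (on the diagonal as \<open>min c1 c2\<close>).\<close>

lemma last_passage_Y_below:
  assumes "n + l \<le> Suc k"
  shows "last_passage (shifted k l (\<lambda>v. X v \<omega>)) m n / c2 \<le> last_passage (shifted k l (\<lambda>v. Y v \<omega>)) m n"
  unfolding last_passage_divide[OF c12(2), symmetric]
proof (rule last_passage_weight_mono)
  fix a b assume "1 \<le> a" "a \<le> m" "1 \<le> b" "b \<le> n"
  then have "b + l \<le> a + k" using assms by linarith
  then have "lpp_rate c1 c2 (a + k, b + l) = c2"
    using c12 by (auto simp: lpp_rate_def)
  then show "shifted k l (\<lambda>v. X v \<omega>) (a, b) / c2 \<le> shifted k l (\<lambda>v. Y v \<omega>) (a, b)"
    by (simp add: Y)
qed

abbreviation scaled :: "nat \<Rightarrow> real \<Rightarrow> nat" where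
  "scaled N x \<equiv> nat \<lfloor>real N * x\<rfloor>"

lemma scaled_le: "0 \<le> x \<Longrightarrow> real (scaled N x) \<le> real N * x"
  using mult_nonneg_nonneg[of "real N" x] by linarith

lemma scaled_sum:
  assumes "0 \<le> x" "0 \<le> y"
  shows "real (scaled N x) \<le> (x + y) * real N" "real (scaled N y) \<le> (x + y) * real N"
proof -
  have "0 \<le> real N * x" "0 \<le> real N * y" "(x + y) * real N = real N * x + real N * y"
    using assms by (auto simp: algebra_simps)
  then show "real (scaled N x) \<le> (x + y) * real N" "real (scaled N y) \<le> (x + y) * real N"
    by linarith+
qed

text \<open>All rates are at least \<open>c2\<close>, so the homogeneous bound at the characteristic
  parameter applies after division by \<open>c2\<close>; it is matched from below when
  \<open>y \<le> x\<close>.\<close>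

lemma AE_upper_below:
  assumes xy: "0 < x" "0 < y" and e: "0 < \<epsilon>"
  shows "AE \<omega> in M. eventually (\<lambda>N. last_passage (\<lambda>v. Y v \<omega>) (scaled N x) (scaled N y)
           \<le> real N * ((sqrt x + sqrt y)\<^sup>2 / c2 + \<epsilon>)) sequentially"
proof -
  define r where "r = sqrt y / (sqrt x + sqrt y)"
  note char = characteristic_parameter[OF xy, folded r_def]
  have D: "0 \<le> x + y" and e': "0 < \<epsilon> * c2" using xy e c12 by auto
  obtain c where c: "0 < c" "\<And>N m n X. iid_exp M X (rect m n) 1 \<Longrightarrow> real m \<le> (x + y) * real N \<Longrightarrow> real n \<le> (x + y) * real N \<Longrightarrow>
      measure M {\<omega>\<in>space M. last_passage (\<lambda>v. X v \<omega>) m n \<in> {m / (1 - r) + n / r + \<epsilon> * c2 * N <..}} \<le> 2 * exp (- c * real N)"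
    using last_passage_upper[OF char(1,2) e' D, of M] by blast
  let ?A = "\<lambda>N. {\<omega>\<in>space M. last_passage (\<lambda>v. X v \<omega>) (scaled N x) (scaled N y)
      \<in> {scaled N x / (1 - r) + scaled N y / r + \<epsilon> * c2 * N <..}}"
  have sc: "real (scaled N x) \<le> (x + y) * real N" "real (scaled N y) \<le> (x + y) * real N" for N
    using scaled_sum[of x y N] xy by auto
  have "AE \<omega> in M. eventually (\<lambda>N. \<omega> \<notin> ?A N) sequentially"
  proof (rule AE_eventually_not)
    show "summable (\<lambda>N. (2 + 0 * real N) * exp (- c * real N))"
      using c(1) by (intro summable_linear_exp) auto
    show "measure M (?A N) \<le> (2 + 0 * real N) * exp (- c * real N)" for N
      using c(2)[OF iid_exp_X sc, of N] by simp
  qed (use prob_space_axioms in measurable)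
  then show ?thesis using AE_nonneg AE_space
  proof eventually_elim
    case (elim \<omega>)
    from elim(1) show ?case
    proof eventually_elim
      case (elim N)
      have "scaled N x / (1 - r) \<le> N * x / (1 - r)" "scaled N y / r \<le> N * y / r"
        using xy char(1,2) by (intro divide_right_mono scaled_le; simp)+
      moreover have "N * x / (1 - r) + N * y / r = N * (sqrt x + sqrt y)\<^sup>2"
        unfolding char(3)[symmetric] by (simp add: algebra_simps)
      moreover have "last_passage (\<lambda>v. X v \<omega>) (scaled N x) (scaled N y)
          \<le> scaled N x / (1 - r) + scaled N y / r + \<epsilon> * c2 * N"
        using elim \<open>\<omega> \<in> space M\<close> by (simp add: not_less)
      ultimately have "last_passage (\<lambda>v. X v \<omega>) (scaled N x) (scaled N y) \<le> N * (sqrt x + sqrt y)\<^sup>2 + \<epsilon> * c2 * N"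
        by linarith
      then have "last_passage (\<lambda>v. X v \<omega>) (scaled N x) (scaled N y) / c2
          \<le> (N * (sqrt x + sqrt y)\<^sup>2 + \<epsilon> * c2 * N) / c2"
        using c12 by (intro divide_right_mono) auto
      also have "\<dots> = N * ((sqrt x + sqrt y)\<^sup>2 / c2 + \<epsilon>)"
        using c12 by (simp add: field_simps)
      finally show ?case
        using last_passage_Y_le[OF \<open>nonneg_on Nsq (\<lambda>v. X v \<omega>)\<close>, of "scaled N x" "scaled N y"] by linarith
    qed
  qed
qed

end


section \<open>Almost sure bounds in the separate regimes of directions\<close>

lemma sqrt_sum_square_scale:
  assumes "0 \<le> t" "0 \<le> u" "0 \<le> v"
  shows "(sqrt (t * u) + sqrt (t * v))\<^sup>2 = t * (sqrt u + sqrt v)\<^sup>2"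
proof -
  have "(sqrt (t * u) + sqrt (t * v))\<^sup>2 = (sqrt t * (sqrt u + sqrt v))\<^sup>2"
    by (simp add: real_sqrt_mult distrib_left)
  also have "\<dots> = t * (sqrt u + sqrt v)\<^sup>2"
    using assms by (simp add: power_mult_distrib)
  finally show ?thesis .
qed

context two_phase
begin

lemma scaled_mono: "x \<le> y \<Longrightarrow> scaled N x \<le> scaled N y"
  by (intro nat_mono floor_mono mult_left_mono) auto

lemma eventually_scaled_pos: "0 < x \<Longrightarrow> eventually (\<lambda>N. 1 \<le> scaled N x) sequentially"
proof -
  assume x: "0 < x"
  have "eventually (\<lambda>N. 1 / x < real N) sequentially"
    using filterlim_real_sequentially unfolding filterlim_at_top_dense by blast
  then show ?thesis
  proof eventually_elim
    case (elim N)
    then have "1 < real N * x" using x by (simp add: pos_divide_less_eq)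
    then show ?case by linarith
  qed
qed

lemma prob_UN_le:
  fixes m :: nat and u :: real
  assumes "\<And>k. k < m \<Longrightarrow> F k \<in> events" "\<And>k. k < m \<Longrightarrow> prob (F k) \<le> u"
  shows "prob (\<Union>k<m. F k) \<le> m * u"
proof -
  have "prob (\<Union>k<m. F k) \<le> (\<Sum>k<m. prob (F k))"
    using assms(1) by (intro measure_UNION_le) auto
  also have "\<dots> \<le> m * u"
    using sum_bounded_above[of "{..<m}" "\<lambda>k. prob (F k)" u] assms(2) by simp
  finally show ?thesis .
qed

text \<open>Since \<open>4 c1 / c2 \<le> 1 / (1 - r) + 1 / r\<close>, the bound obtained from
  \<open>two_phase_upper\<close> is largest when the path leaves the diagonal at once.\<close>

lemma AE_upper_above:
  assumes xy: "0 < x" "x < y" and r: "0 < r" "r < 1" and A: "4 * (c1 / c2) \<le> 1 / (1 - r) + 1 / r" and e: "0 < \<epsilon>"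
  shows "AE \<omega> in M. eventually (\<lambda>N. last_passage (\<lambda>v. Y v \<omega>) (scaled N x) (scaled N y)
           \<le> real N * ((x / (1 - r) + y / r) / c1 + \<epsilon>)) sequentially"
proof -
  define c where "c = c1 / c2"
  have c: "0 < c" using c12 c1_pos by (simp add: c_def)
  \<comment> \<open>In units of \<open>N / c1\<close>, the diagonal piece has error
    \<open>c * e'\<close>, the bulk piece \<open>e'\<close>, and a further \<open>e'\<close> absorbs
    the constant \<open>4 * c\<close> that stems from \<open>Suc k\<close> in place of
    \<open>k\<close>.\<close>
  define e' where "e' = \<epsilon> * c1 / (c + 2)"
  have e': "0 < e'" using e c c1_pos by (simp add: e'_def)
  have D: "0 \<le> x + y" using xy by simp
  \<comment> \<open>\<open>1/2\<close> is the characteristic parameter of the diagonal; it gives the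
    time \<open>4 * k\<close> to \<open>(k, k)\<close>.\<close>
  have h: "0 < (1/2::real)" "(1/2::real) < 1" by auto
  obtain d1 where d1: "0 < d1" "\<And>N m n X. iid_exp M X (rect m n) 1 \<Longrightarrow> real m \<le> (x + y) * real N \<Longrightarrow> real n \<le> (x + y) * real N \<Longrightarrow>
      measure M {\<omega>\<in>space M. last_passage (\<lambda>v. X v \<omega>) m n \<in> {m / (1 - 1/2) + n / (1/2) + e' * N <..}} \<le> 2 * exp (- d1 * real N)"
    using last_passage_upper[OF h e' D, of M] by blast
  obtain d2 where d2: "0 < d2" "\<And>N m n X. iid_exp M X (rect m n) 1 \<Longrightarrow> real m \<le> (x + y) * real N \<Longrightarrow> real n \<le> (x + y) * real N \<Longrightarrow>
      measure M {\<omega>\<in>space M. last_passage (\<lambda>v. X v \<omega>) m n \<in> {m / (1 - r) + n / r + e' * N <..}} \<le> 2 * exp (- d2 * real N)"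
    using last_passage_upper[OF r e' D, of M] by blast
  define F1 where "F1 N k = {\<omega>\<in>space M. last_passage (\<lambda>v. X v \<omega>) (Suc k) (Suc k) \<in> {Suc k / (1 - 1/2) + Suc k / (1/2) + e' * N <..}}" for N k :: nat
  define F2 where "F2 N k = {\<omega>\<in>space M. last_passage (\<lambda>v. shifted k (Suc k) X v \<omega>) (scaled N x - k) (scaled N y - Suc k)
      \<in> {real (scaled N x - k) / (1 - r) + real (scaled N y - Suc k) / r + e' * N <..}}" for N k :: nat
  have meas: "F1 N k \<in> events" "F2 N k \<in> events" for N k
    unfolding F1_def F2_def shifted_apply2 by measurable
  have le: "scaled N x \<le> scaled N y" for N using xy by (intro scaled_mono) auto
  have sc: "real (scaled N x) \<le> (x + y) * real N" "real (scaled N y) \<le> (x + y) * real N" for N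
    using scaled_sum[of x y N] xy by auto
  let ?A = "\<lambda>N. (\<Union>k<scaled N x. F1 N k) \<union> (\<Union>k<scaled N x. F2 N k)"
  define d where "d = min d1 d2"
  have "AE \<omega> in M. eventually (\<lambda>N. \<omega> \<notin> ?A N) sequentially"
  proof (rule AE_eventually_not)
    show "prob_space M" by (rule prob_space_axioms)
    show "?A N \<in> events" for N using meas by auto
    show "summable (\<lambda>N. (0 + 4 * (x + y) * real N) * exp (- d * real N))"
      using d1(1) d2(1) xy by (intro summable_linear_exp) (auto simp: d_def)
    fix N
    have ex: "exp (- d1 * real N) \<le> exp (- d * real N)" "exp (- d2 * real N) \<le> exp (- d * real N)"
      by (auto simp: d_def intro!: mult_right_mono)
    have P1: "prob (F1 N k) \<le> 2 * exp (- d * real N)" if "k < scaled N x" for k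
    proof -
      have "real (Suc k) \<le> (x + y) * real N" using that sc(1)[of N] by linarith
      from d1(2)[OF iid_exp_X this this] ex(1) show ?thesis unfolding F1_def by linarith
    qed
    have P2: "prob (F2 N k) \<le> 2 * exp (- d * real N)" if "k < scaled N x" for k
    proof -
      have "real (scaled N x - k) \<le> (x + y) * real N" "real (scaled N y - Suc k) \<le> (x + y) * real N"
        using sc[of N] by linarith+
      from d2(2)[OF iid_exp_shifted[of k "Suc k"] this] ex(2) show ?thesis unfolding F2_def by linarith
    qed
    have "prob (?A N) \<le> prob (\<Union>k<scaled N x. F1 N k) + prob (\<Union>k<scaled N x. F2 N k)"
      using meas by (intro measure_Un_le) auto
    also have "\<dots> \<le> real (scaled N x) * (2 * exp (- d * real N)) + real (scaled N x) * (2 * exp (- d * real N))"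
      using meas P1 P2 by (intro add_mono prob_UN_le) auto
    also have "\<dots> = 4 * real (scaled N x) * exp (- d * real N)" by simp
    also have "\<dots> \<le> (0 + 4 * (x + y) * real N) * exp (- d * real N)"
    proof (rule mult_right_mono)
      show "4 * real (scaled N x) \<le> 0 + 4 * (x + y) * real N"
        using mult_left_mono[OF sc(1)[of N], of 4] by (simp only: mult.assoc add_0)
    qed simp
    finally show "prob (?A N) \<le> (0 + 4 * (x + y) * real N) * exp (- d * real N)" .
  qed
  then show ?thesis using AE_nonneg AE_space
  proof eventually_elim
    case (elim \<omega>)
    note nn = elim(2) and sp = elim(3)
    have big: "eventually (\<lambda>N. 4 * c / e' < real N) sequentially"
      using filterlim_real_sequentially unfolding filterlim_at_top_dense by blast
    from elim(1) eventually_scaled_pos[OF xy(1)] big show ?case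
    proof eventually_elim
      case (elim N)
      define m n where "m = scaled N x" and "n = scaled N y"
      have mn: "1 \<le> m" "m \<le> n" using elim le by (auto simp: m_def n_def)
      obtain k where k: "k < m" "last_passage (\<lambda>v. Y v \<omega>) m n \<le> last_passage (\<lambda>v. X v \<omega>) (Suc k) (Suc k) / c2
            + last_passage (shifted k (Suc k) (\<lambda>v. X v \<omega>)) (m - k) (n - Suc k) / c1"
        using two_phase_upper[OF nn c12 Y mn] by blast
      have k1: "last_passage (\<lambda>v. X v \<omega>) (Suc k) (Suc k) \<le> 4 * real (Suc k) + e' * N"
        using elim(1) k(1) sp by (auto simp: F1_def m_def not_less)
      have k2: "last_passage (shifted k (Suc k) (\<lambda>v. X v \<omega>)) (m - k) (n - Suc k)
          \<le> real (m - k) / (1 - r) + real (n - Suc k) / r + e' * N"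
        using elim(1) k(1) sp by (auto simp: F2_def m_def n_def shifted_apply2 not_less)
      define p q where "p = 1 / (1 - r)" and "q = 1 / r"
      have pq: "0 < p" "0 < q" "4 * c \<le> p + q" using r A by (auto simp: p_def q_def c_def)
      have kn: "Suc k \<le> n" using k(1) mn by simp
      have "last_passage (\<lambda>v. Y v \<omega>) m n \<le> (4 * real (Suc k) + e' * N) / c2
            + (real (m - k) / (1 - r) + real (n - Suc k) / r + e' * N) / c1"
        using k(2) divide_right_mono[OF k1, of c2] divide_right_mono[OF k2, of c1] c12 c1_pos by linarith
      also have "(4 * real (Suc k) + e' * N) / c2 = c * (4 * real (Suc k) + e' * N) / c1"
        using c12 c1_pos by (simp add: c_def)
      also have "real (m - k) / (1 - r) + real (n - Suc k) / r = (real m - k) * p + (real n - Suc k) * q"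
        using k(1) kn by (simp add: p_def q_def of_nat_diff)
      also have "c * (4 * real (Suc k) + e' * N) / c1 + ((real m - k) * p + (real n - Suc k) * q + e' * N) / c1
          = (c * (4 * real (Suc k) + e' * N) + ((real m - k) * p + (real n - Suc k) * q + e' * N)) / c1"
        by (simp add: add_divide_distrib)
      also have "\<dots> \<le> (N * x * p + N * y * q + (c + 2) * e' * N) / c1"
      proof (intro divide_right_mono)
        have "real k * (4 * c) \<le> real k * (p + q)" using pq by (intro mult_left_mono) auto
        moreover have "real m * p \<le> N * x * p" "real n * q \<le> N * y * q"
          using scaled_le[of x N] scaled_le[of y N] xy pq by (auto simp: m_def n_def intro!: mult_right_mono)
        moreover have "4 * c \<le> e' * N" using elim(3) e' by (simp add: pos_divide_less_eq mult.commute)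
        ultimately show "c * (4 * real (Suc k) + e' * N) + ((real m - k) * p + (real n - Suc k) * q + e' * N)
            \<le> N * x * p + N * y * q + (c + 2) * e' * N"
        proof -
          assume *: "real k * (4 * c) \<le> real k * (p + q)" "real m * p \<le> N * x * p" "real n * q \<le> N * y * q" "4 * c \<le> e' * N"
          have "c * (4 * real (Suc k) + e' * N) + ((real m - k) * p + (real n - Suc k) * q + e' * N)
              = real k * (4 * c) - real k * (p + q) + 4 * c - q + real m * p + real n * q + (c + 1) * e' * N"
            by (simp add: algebra_simps)
          moreover have "N * x * p + N * y * q + (c + 2) * e' * N = N * x * p + N * y * q + ((c + 1) * e' * N + e' * N)"
            by (simp add: algebra_simps)
          moreover have "A1 - A2 + C - q + B1 + D1 + T \<le> B2 + D2 + (T + E)"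
            if "A1 \<le> A2" "B1 \<le> B2" "D1 \<le> D2" "C \<le> E" for A1 A2 B1 B2 C D1 D2 E T :: real
            using that pq(2) by linarith
          ultimately show ?thesis using * by (simp only:)
        qed
      qed (use c1_pos in simp)
      also have "(c + 2) * e' = \<epsilon> * c1" using c by (simp add: e'_def)
      also have "(N * x * p + N * y * q + \<epsilon> * c1 * N) / c1 = N * ((x / (1 - r) + y / r) / c1 + \<epsilon>)"
        using c1_pos by (simp add: p_def q_def add_divide_distrib distrib_left)
      finally show ?case unfolding m_def n_def .
    qed
  qed
qed

lemma AE_lower_box:
  assumes xy: "0 < x" "0 < y" and e: "0 < \<epsilon>"
  shows "AE \<omega> in M. eventually (\<lambda>N. real N * ((sqrt x + sqrt y)\<^sup>2 / c1 - \<epsilon>)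
           \<le> last_passage (\<lambda>v. Y v \<omega>) (scaled N x) (scaled N y)) sequentially"
proof -
  have e': "0 < \<epsilon> * c1" using e c1_pos by simp
  obtain p where p: "summable p" "\<And>N X. iid_exp M X (rect (scaled N x) (scaled N y)) 1 \<Longrightarrow>
     measure M {\<omega>\<in>space M. last_passage (\<lambda>v. X v \<omega>) (scaled N x) (scaled N y)
       \<in> {..< real N * ((sqrt x + sqrt y)\<^sup>2 - \<epsilon> * c1)}} \<le> p N"
    using last_passage_lower[OF xy e', of M] by blast
  let ?A = "\<lambda>N. {\<omega>\<in>space M. last_passage (\<lambda>v. X v \<omega>) (scaled N x) (scaled N y)
       \<in> {..< real N * ((sqrt x + sqrt y)\<^sup>2 - \<epsilon> * c1)}}"
  have "AE \<omega> in M. eventually (\<lambda>N. \<omega> \<notin> ?A N) sequentially"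
    by (rule AE_eventually_not[OF prob_space_axioms _ p(1)]) (measurable, rule p(2)[OF iid_exp_X])
  then show ?thesis using AE_nonneg AE_space
  proof eventually_elim
    case (elim \<omega>)
    note nn = elim(2) and sp = elim(3)
    from elim(1) show ?case
    proof eventually_elim
      case (elim N)
      then have "real N * ((sqrt x + sqrt y)\<^sup>2 - \<epsilon> * c1) \<le> last_passage (\<lambda>v. X v \<omega>) (scaled N x) (scaled N y)"
        using sp by (simp add: not_less)
      then have "real N * ((sqrt x + sqrt y)\<^sup>2 - \<epsilon> * c1) / c1 \<le> last_passage (\<lambda>v. X v \<omega>) (scaled N x) (scaled N y) / c1"
        using c1_pos by (intro divide_right_mono) auto
      also have "\<dots> \<le> last_passage (\<lambda>v. Y v \<omega>) (scaled N x) (scaled N y)"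
        using last_passage_Y_ge[OF nn, of 0 0] by simp
      also have "real N * ((sqrt x + sqrt y)\<^sup>2 - \<epsilon> * c1) / c1 = real N * ((sqrt x + sqrt y)\<^sup>2 / c1 - \<epsilon>)"
        using c1_pos by (simp add: field_simps)
      finally show ?case .
    qed
  qed
qed

text \<open>\<open>K\<close> boxes stacked in direction \<open>(u, v)\<close>, shifted right by one box height, stay
  strictly below the diagonal; a last box leads on in direction \<open>(x', y')\<close>.\<close>

lemma AE_lower_chain:
  fixes K :: nat
  assumes uv: "0 < v" "v \<le> u" and xy': "0 < x'" "0 < y'" and K: "1 \<le> K"
    and fit: "u + v / K + x' \<le> x" "v + y' \<le> y" and e: "0 < \<epsilon>"
  shows "AE \<omega> in M. eventually (\<lambda>N. real N * ((sqrt u + sqrt v)\<^sup>2 / c2 + (sqrt x' + sqrt y')\<^sup>2 / c1 - \<epsilon>)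
           \<le> last_passage (\<lambda>v. Y v \<omega>) (scaled N x) (scaled N y)) sequentially"
proof -
  \<comment> \<open>\<open>K\<close> boxes with error \<open>e' / c2\<close> each and a last box
    with error \<open>e' / c1\<close> add up to \<open>\<epsilon>\<close>.\<close>
  define e' where "e' = \<epsilon> / (K / c2 + 1 / c1)"
  have den: "0 < K / c2 + 1 / c1" using c12 c1_pos by (simp add: add_nonneg_pos)
  have e': "0 < e'" "K * e' / c2 + e' / c1 = \<epsilon>"
  proof -
    show "0 < e'" using den e by (simp add: e'_def)
    have "K * e' / c2 + e' / c1 = e' * (K / c2 + 1 / c1)" by (simp add: distrib_left)
    also have "\<dots> = \<epsilon>" using den unfolding e'_def by simp
    finally show "K * e' / c2 + e' / c1 = \<epsilon>" .
  qed
  have uvK: "0 < u / K" "0 < v / K" using uv K by auto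
  obtain p where p: "summable p" "\<And>N X. iid_exp M X (rect (scaled N (u / K)) (scaled N (v / K))) 1 \<Longrightarrow>
     measure M {\<omega>\<in>space M. last_passage (\<lambda>v. X v \<omega>) (scaled N (u / K)) (scaled N (v / K))
       \<in> {..< real N * ((sqrt (u / K) + sqrt (v / K))\<^sup>2 - e')}} \<le> p N"
    using last_passage_lower[OF uvK e'(1), of M] by blast
  obtain p' where p': "summable p'" "\<And>N X. iid_exp M X (rect (scaled N x') (scaled N y')) 1 \<Longrightarrow>
     measure M {\<omega>\<in>space M. last_passage (\<lambda>v. X v \<omega>) (scaled N x') (scaled N y')
       \<in> {..< real N * ((sqrt x' + sqrt y')\<^sup>2 - e')}} \<le> p' N"
    using last_passage_lower[OF xy' e'(1), of M] by blast
  let ?a = "\<lambda>N. scaled N (u / K)" and ?b = "\<lambda>N. scaled N (v / K)"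
  \<comment> \<open>Box \<open>k\<close> has columns beyond \<open>?b N + k * ?a N\<close> and rows
    up to \<open>(k + 1) * ?b N\<close>. Since \<open>?b N \<le> ?a N\<close>, the offset
    \<open>?b N\<close> keeps every such box below the diagonal.\<close>
  define F where "F N k = {\<omega>\<in>space M. last_passage (\<lambda>v. shifted (?b N + k * ?a N) (k * ?b N) X v \<omega>) (?a N) (?b N)
       \<in> {..< real N * ((sqrt (u / K) + sqrt (v / K))\<^sup>2 - e')}}" for N k :: nat
  define F' where "F' N = {\<omega>\<in>space M. last_passage (\<lambda>v. shifted (?b N + K * ?a N) (K * ?b N) X v \<omega>) (scaled N x') (scaled N y')
       \<in> {..< real N * ((sqrt x' + sqrt y')\<^sup>2 - e')}}" for N :: nat
  have meas: "F N k \<in> events" "F' N \<in> events" for N k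
    unfolding F_def F'_def shifted_apply2 by measurable
  let ?A = "\<lambda>N. (\<Union>k<K. F N k) \<union> F' N"
  have "AE \<omega> in M. eventually (\<lambda>N. \<omega> \<notin> ?A N) sequentially"
  proof (rule AE_eventually_not)
    show "prob_space M" by (rule prob_space_axioms)
    show "?A N \<in> events" for N using meas by auto
    show "summable (\<lambda>N. K * p N + p' N)"
      by (intro summable_add summable_mult p p')
    fix N
    have "prob (F N k) \<le> p N" for k
      unfolding F_def by (rule p(2)[OF iid_exp_shifted])
    moreover have "prob (F' N) \<le> p' N"
      unfolding F'_def by (rule p'(2)[OF iid_exp_shifted])
    ultimately have "prob (\<Union>k<K. F N k) + prob (F' N) \<le> K * p N + p' N"
      using meas by (intro add_mono prob_UN_le) auto
    moreover have "prob (?A N) \<le> prob (\<Union>k<K. F N k) + prob (F' N)"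
      using meas by (intro measure_Un_le) auto
    ultimately show "prob (?A N) \<le> K * p N + p' N" by linarith
  qed
  then show ?thesis using AE_nonneg AE_space
  proof eventually_elim
    case (elim \<omega>)
    note nn = elim(2) and sp = elim(3)
    from elim(1) show ?case
    proof eventually_elim
      case (elim N)
      define a b where "a = ?a N" and "b = ?b N"
      define X' Y' where "X' = (\<lambda>v. X v \<omega>)" and "Y' = (\<lambda>v. Y v \<omega>)"
      have nY: "nonneg_on Nsq Y'" unfolding Y'_def by (rule nonneg_Y[OF nn])
      have ba: "b \<le> a" unfolding a_def b_def using uv K by (intro scaled_mono divide_right_mono) auto
      define g where "g = (sqrt (u / K) + sqrt (v / K))\<^sup>2 - e'"
      define g' where "g' = (sqrt x' + sqrt y')\<^sup>2 - e'"
      have box: "N * g / c2 \<le> last_passage (shifted (b + k * a) (0 + k * b) Y') a b" if "k < K" for k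
      proof -
        have "\<omega> \<notin> F N k" using elim that by auto
        then have "N * g \<le> last_passage (shifted (b + k * a) (k * b) X') a b"
          using sp by (simp add: F_def a_def b_def g_def X'_def shifted_apply2 not_less)
        then have "N * g / c2 \<le> last_passage (shifted (b + k * a) (k * b) X') a b / c2"
          using c12 by (intro divide_right_mono) auto
        also have "\<dots> \<le> last_passage (shifted (b + k * a) (k * b) Y') a b"
          unfolding X'_def Y'_def using ba mult_le_mono2[OF ba, of k]
          by (intro last_passage_Y_below) linarith
        finally show ?thesis by simp
      qed
      have "N * g' / c1 \<le> last_passage (shifted (b + K * a) (0 + K * b) Y') (scaled N x') (scaled N y')"
      proof -
        have "\<omega> \<notin> F' N" using elim by auto
        then have "N * g' \<le> last_passage (shifted (b + K * a) (K * b) X') (scaled N x') (scaled N y')"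
          using sp by (simp add: F'_def a_def b_def g'_def X'_def shifted_apply2 not_less)
        then have "N * g' / c1 \<le> last_passage (shifted (b + K * a) (K * b) X') (scaled N x') (scaled N y') / c1"
          using c1_pos by (intro divide_right_mono) auto
        also have "\<dots> \<le> last_passage (shifted (b + K * a) (K * b) Y') (scaled N x') (scaled N y')"
          unfolding X'_def Y'_def by (rule last_passage_Y_ge[OF nn])
        finally show ?thesis by simp
      qed
      moreover have "K * (N * g / c2) \<le> last_passage Y' (b + K * a) (0 + K * b)"
      proof -
        have "K * (N * g / c2) = (\<Sum>k<K. N * g / c2)" by simp
        also have "\<dots> \<le> (\<Sum>k<K. last_passage (shifted (b + k * a) (0 + k * b) Y') a b)"
          using box by (intro sum_mono) auto
        also have "\<dots> \<le> last_passage Y' (b + K * a) (0 + K * b)"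
          by (rule last_passage_chain[OF nY])
        finally show ?thesis .
      qed
      moreover have "last_passage Y' (b + K * a) (0 + K * b)
          + last_passage (shifted (b + K * a) (0 + K * b) Y') (scaled N x') (scaled N y')
          \<le> last_passage Y' (b + K * a + scaled N x') (0 + K * b + scaled N y')"
        by (rule last_passage_superadditive[OF nY])
      moreover have "last_passage Y' (b + K * a + scaled N x') (0 + K * b + scaled N y')
          \<le> last_passage Y' (scaled N x) (scaled N y)"
      proof (rule last_passage_mono[OF nY])
        have a: "real a \<le> N * (u / K)" and b: "real b \<le> N * (v / K)"
          unfolding a_def b_def by (rule scaled_le, rule less_imp_le, rule uvK)+
        have K': "K * (N * (u / K)) = N * u" "K * (N * (v / K)) = N * v" using K by auto
        have "K * real a \<le> N * u" "K * real b \<le> N * v"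
          using mult_left_mono[OF a, of K] mult_left_mono[OF b, of K] unfolding K' by auto
        then have "real (b + K * a + scaled N x') \<le> N * (v / K) + N * u + N * x'"
          "real (0 + K * b + scaled N y') \<le> N * v + N * y'"
          using b scaled_le[OF less_imp_le[OF xy'(1)], of N] scaled_le[OF less_imp_le[OF xy'(2)], of N]
          unfolding of_nat_add of_nat_mult by linarith+
        moreover have "N * (v / K) + N * u + N * x' \<le> N * x" "N * v + N * y' \<le> N * y"
          using mult_left_mono[OF fit(1), of "real N"] mult_left_mono[OF fit(2), of "real N"]
          by (simp_all add: distrib_left)
        ultimately show "b + K * a + scaled N x' \<le> scaled N x" "0 + K * b + scaled N y' \<le> scaled N y"
          by (intro le_nat_floor; linarith)+
      qed
      ultimately have "K * (N * g / c2) + N * g' / c1 \<le> last_passage Y' (scaled N x) (scaled N y)"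
        by linarith
      moreover have "K * (N * g / c2) + N * g' / c1
          = N * ((sqrt u + sqrt v)\<^sup>2 / c2 + (sqrt x' + sqrt y')\<^sup>2 / c1 - \<epsilon>)"
      proof -
        \<comment> \<open>Homogeneity of degree 1: \<open>K\<close> boxes of relative size
          \<open>1 / K\<close> add up to the value of the whole.\<close>
        have "K * (sqrt (u / K) + sqrt (v / K))\<^sup>2 = (sqrt u + sqrt v)\<^sup>2"
          using sqrt_sum_square_scale[of "real K" "u / K" "v / K"] uv K by simp
        then have "K * g = (sqrt u + sqrt v)\<^sup>2 - K * e'"
          by (simp add: g_def right_diff_distrib)
        then have "K * (N * g / c2) = N * (((sqrt u + sqrt v)\<^sup>2 - K * e') / c2)"
          by (metis mult.left_commute times_divide_eq_right)
        then show ?thesis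
          unfolding e'(2)[symmetric] g'_def by (simp add: diff_divide_distrib algebra_simps)
      qed
      ultimately show ?case unfolding Y'_def by simp
    qed
  qed
qed

text \<open>The chain runs in direction \<open>(x, y)\<close>, shrunk by \<open>1 - t\<close>. The
  spare part makes room for the offset and for the last box, whose nonnegative contribution is
  dropped.\<close>

lemma AE_lower_below:
  assumes xy: "0 < y" "y \<le> x" and e: "0 < \<epsilon>"
  shows "AE \<omega> in M. eventually (\<lambda>N. real N * ((sqrt x + sqrt y)\<^sup>2 / c2 - \<epsilon>)
           \<le> last_passage (\<lambda>v. Y v \<omega>) (scaled N x) (scaled N y)) sequentially"
proof -
  define S where "S = (sqrt x + sqrt y)\<^sup>2 / c2"
  have "0 < sqrt x + sqrt y" using xy by (intro add_pos_pos) auto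
  then have S: "0 < S" using c12 by (simp add: S_def)
  \<comment> \<open>Shrinking costs \<open>t * S \<le> \<epsilon> / 2\<close>; the chain is applied
    with the other half of \<open>\<epsilon>\<close>.\<close>
  define t where "t = min (1/2) (\<epsilon> / (2 * S))"
  have t: "0 < t" "t < 1" "t * S \<le> \<epsilon> / 2"
  proof -
    show "0 < t" "t < 1" using S e by (auto simp: t_def)
    have "t \<le> \<epsilon> / (2 * S)" unfolding t_def by (rule min.cobounded2)
    then show "t * S \<le> \<epsilon> / 2" using S by (simp add: field_simps)
  qed
  \<comment> \<open>A large \<open>K\<close> fits the offset \<open>(1 - t) * y / K\<close> into
    half of the spare width \<open>t * x\<close>.\<close>
  obtain K :: nat where K: "2 * y / (t * x) < real K" using reals_Archimedean2 by blast
  have "0 < 2 * y / (t * x)" using xy t by simp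
  then have K1: "1 \<le> K" using K by linarith
  have "(1 - t) * y / K \<le> t * x / 2"
  proof -
    have "2 * y \<le> K * (t * x)" using K xy t by (simp add: pos_divide_less_eq less_imp_le)
    moreover have "(1 - t) * y \<le> 1 * y" using xy t by (intro mult_right_mono) auto
    ultimately have "(1 - t) * y \<le> t * x / 2 * K" by (simp add: algebra_simps)
    then show ?thesis using K1 by (simp add: pos_divide_le_eq)
  qed
  then have fit: "(1 - t) * x + (1 - t) * y / K + t * x / 2 \<le> x" by (simp add: algebra_simps)
  have fit': "(1 - t) * y + t * y \<le> y" by (simp add: algebra_simps)
  have "AE \<omega> in M. eventually (\<lambda>N. real N * ((sqrt ((1 - t) * x) + sqrt ((1 - t) * y))\<^sup>2 / c2
      + (sqrt (t * x / 2) + sqrt (t * y))\<^sup>2 / c1 - \<epsilon> / 2)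
           \<le> last_passage (\<lambda>v. Y v \<omega>) (scaled N x) (scaled N y)) sequentially"
    by (rule AE_lower_chain[OF _ _ _ _ K1 fit fit']) (use xy t e in simp_all)
  then show ?thesis
  proof eventually_elim
    case (elim \<omega>)
    then show ?case
    proof eventually_elim
      case (elim N)
      have "(sqrt ((1 - t) * x) + sqrt ((1 - t) * y))\<^sup>2 / c2 = S - t * S"
      proof -
        have "(sqrt ((1 - t) * x) + sqrt ((1 - t) * y))\<^sup>2 = (1 - t) * (sqrt x + sqrt y)\<^sup>2"
          using xy t by (intro sqrt_sum_square_scale) auto
        then show ?thesis by (simp only: S_def left_diff_distrib diff_divide_distrib times_divide_eq_right mult_1)
      qed
      moreover have "0 \<le> (sqrt (t * x / 2) + sqrt (t * y))\<^sup>2 / c1" using c1_pos by simp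
      ultimately have "S - \<epsilon> \<le> (sqrt ((1 - t) * x) + sqrt ((1 - t) * y))\<^sup>2 / c2
          + (sqrt (t * x / 2) + sqrt (t * y))\<^sup>2 / c1 - \<epsilon> / 2"
        using t(3) by linarith
      then have "real N * (S - \<epsilon>) \<le> real N * ((sqrt ((1 - t) * x) + sqrt ((1 - t) * y))\<^sup>2 / c2
          + (sqrt (t * x / 2) + sqrt (t * y))\<^sup>2 / c1 - \<epsilon> / 2)"
        by (intro mult_left_mono) auto
      then show ?case using elim unfolding S_def by linarith
    qed
  qed
qed

text \<open>Square boxes along the diagonal reach almost to \<open>(a, a)\<close> and collect nearly
  \<open>(sqrt a + sqrt a)^2 = 4 * a\<close> over \<open>c2\<close>; one box of size
  \<open>(x - a, y - a)\<close>, compared with rate \<open>c1\<close>, leads on.\<close>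

lemma AE_lower_middle:
  assumes xy: "0 < a" "a < x" "x < y" and e: "0 < \<epsilon>"
  shows "AE \<omega> in M. eventually (\<lambda>N. real N * (4 * a / c2 + (sqrt (x - a) + sqrt (y - a))\<^sup>2 / c1 - \<epsilon>)
           \<le> last_passage (\<lambda>v. Y v \<omega>) (scaled N x) (scaled N y)) sequentially"
proof -
  define S where "S = 4 * a / c2"
  have S: "0 < S" using xy c12 by (simp add: S_def)
  define t where "t = min (1/2) (\<epsilon> / (2 * S))"
  have t: "0 < t" "t < 1" "t * S \<le> \<epsilon> / 2"
  proof -
    show "0 < t" "t < 1" using S e by (auto simp: t_def)
    have "t \<le> \<epsilon> / (2 * S)" unfolding t_def by (rule min.cobounded2)
    then show "t * S \<le> \<epsilon> / 2" using S by (simp add: field_simps)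
  qed
  obtain K :: nat where K: "1 / t < real K" using reals_Archimedean2 by blast
  have "0 < 1 / t" using t by simp
  then have K1: "1 \<le> K" using K by linarith
  have "(1 - t) * a / K \<le> t * a"
  proof -
    have "1 \<le> t * K" using K t by (simp add: pos_divide_less_eq mult.commute less_imp_le)
    then have "a * 1 \<le> a * (t * K)" using xy by (intro mult_left_mono) auto
    moreover have "(1 - t) * a \<le> 1 * a" using xy t by (intro mult_right_mono) auto
    ultimately have "(1 - t) * a \<le> t * a * K" by (simp add: algebra_simps)
    then show ?thesis using K1 by (simp add: pos_divide_le_eq)
  qed
  then have fit: "(1 - t) * a + (1 - t) * a / K + (x - a) \<le> x" by (simp add: algebra_simps)
  have "AE \<omega> in M. eventually (\<lambda>N. real N * ((sqrt ((1 - t) * a) + sqrt ((1 - t) * a))\<^sup>2 / c2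
      + (sqrt (x - a) + sqrt (y - a))\<^sup>2 / c1 - \<epsilon> / 2)
           \<le> last_passage (\<lambda>v. Y v \<omega>) (scaled N x) (scaled N y)) sequentially"
    by (rule AE_lower_chain[OF _ _ _ _ K1 fit]) (use xy t e in \<open>auto simp: algebra_simps\<close>)
  then show ?thesis
  proof eventually_elim
    case (elim \<omega>)
    then show ?case
    proof eventually_elim
      case (elim N)
      have "(sqrt a + sqrt a)\<^sup>2 = 4 * a" using xy by (simp add: power2_eq_square algebra_simps)
      then have "(sqrt ((1 - t) * a) + sqrt ((1 - t) * a))\<^sup>2 / c2 = S - t * S"
        using sqrt_sum_square_scale[of "1 - t" a a] xy t by (simp add: S_def left_diff_distrib diff_divide_distrib)
      then have "S + (sqrt (x - a) + sqrt (y - a))\<^sup>2 / c1 - \<epsilon> \<le> (sqrt ((1 - t) * a) + sqrt ((1 - t) * a))\<^sup>2 / c2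
          + (sqrt (x - a) + sqrt (y - a))\<^sup>2 / c1 - \<epsilon> / 2"
        using t(3) by linarith
      then have "real N * (S + (sqrt (x - a) + sqrt (y - a))\<^sup>2 / c1 - \<epsilon>) \<le> real N * ((sqrt ((1 - t) * a) + sqrt ((1 - t) * a))\<^sup>2 / c2
          + (sqrt (x - a) + sqrt (y - a))\<^sup>2 / c1 - \<epsilon> / 2)"
        by (intro mult_left_mono) auto
      then show ?case using elim unfolding S_def by linarith
    qed
  qed
qed

lemma AE_bounds:
  assumes xy: "0 < x" "0 < y" and e: "0 < \<epsilon>"
  shows "AE \<omega> in M. eventually (\<lambda>N. real N * (lpp_Phi c1 c2 x y - \<epsilon>) \<le> last_passage (\<lambda>v. Y v \<omega>) (scaled N x) (scaled N y)
       \<and> last_passage (\<lambda>v. Y v \<omega>) (scaled N x) (scaled N y) \<le> real N * (lpp_Phi c1 c2 x y + \<epsilon>)) sequentially"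
proof -
  define b where "b = 2 * (c1 / c2) - 1 - 2 * sqrt (c1 / c2 * (c1 / c2 - 1))"
  have "(AE \<omega> in M. eventually (\<lambda>N. real N * (lpp_Phi c1 c2 x y - \<epsilon>) \<le> last_passage (\<lambda>v. Y v \<omega>) (scaled N x) (scaled N y)) sequentially)
     \<and> (AE \<omega> in M. eventually (\<lambda>N. last_passage (\<lambda>v. Y v \<omega>) (scaled N x) (scaled N y) \<le> real N * (lpp_Phi c1 c2 x y + \<epsilon>)) sequentially)"
  proof -
    consider (below) "y \<le> x" | (steep) "x < y" "x \<le> b\<^sup>2 * y" | (middle) "b\<^sup>2 * y < x" "x < y" by linarith
    then show ?thesis
    proof cases
      case below
      then show ?thesis
        using AE_lower_below[OF xy(2) below e] AE_upper_below[OF xy e] lpp_Phi_below[OF c12 xy(2) below] by simp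
    next
      case steep
      define r where "r = sqrt y / (sqrt x + sqrt y)"
      note char = characteristic_parameter[OF xy, folded r_def]
      show ?thesis
        using AE_lower_box[OF xy e] AE_upper_above[OF xy(1) steep(1) char(1,2) _ e]
          steep_parameter[OF c12 xy steep(2)[unfolded b_def], folded r_def]
          lpp_Phi_steep[OF c12 steep(2)[unfolded b_def]] char(3) by simp
    next
      case middle
      note mid = lpp_Phi_middle[OF c12 xy(1) middle(1)[unfolded b_def] middle(2)]
      show ?thesis
        using AE_lower_middle[OF mid(5,6) middle(2) e, folded mid(7)]
          AE_upper_above[OF xy(1) middle(2) mid(1,2) eq_refl[OF mid(3)[symmetric]] e, folded mid(4)] by blast
    qed
  qed
  then have "AE \<omega> in M. eventually (\<lambda>N. real N * (lpp_Phi c1 c2 x y - \<epsilon>) \<le> last_passage (\<lambda>v. Y v \<omega>) (scaled N x) (scaled N y)) sequentially"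
    "AE \<omega> in M. eventually (\<lambda>N. last_passage (\<lambda>v. Y v \<omega>) (scaled N x) (scaled N y) \<le> real N * (lpp_Phi c1 c2 x y + \<epsilon>)) sequentially"
    by blast+
  then show ?thesis by eventually_elim (rule eventually_conj)
qed

lemma AE_limit:
  assumes xy: "0 < x" "0 < y"
  shows "AE \<omega> in M. (\<lambda>N. lpp_G Y (scaled N x) (scaled N y) \<omega> / real N) \<longlonglongrightarrow> lpp_Phi c1 c2 x y"
proof -
  let ?\<Phi> = "lpp_Phi c1 c2 x y"
  \<comment> \<open>Only the accuracies \<open>1 / Suc q\<close> are used, so countably many null
    sets are discarded.\<close>
  have "AE \<omega> in M. \<forall>q::nat. eventually (\<lambda>N. real N * (?\<Phi> - 1 / Suc q) \<le> last_passage (\<lambda>v. Y v \<omega>) (scaled N x) (scaled N y)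
       \<and> last_passage (\<lambda>v. Y v \<omega>) (scaled N x) (scaled N y) \<le> real N * (?\<Phi> + 1 / Suc q)) sequentially"
    unfolding AE_all_countable by (intro allI AE_bounds xy) simp
  then show ?thesis using AE_nonneg
  proof eventually_elim
    case (elim \<omega>)
    note nY = nonneg_Y[OF elim(2)]
    show ?case
    proof (rule tendstoI)
      fix \<epsilon> :: real assume "0 < \<epsilon>"
      then obtain q where q: "1 / Suc q < \<epsilon>" using nat_approx_posE by blast
      from elim(1) have "eventually (\<lambda>N. real N * (?\<Phi> - 1 / Suc q) \<le> last_passage (\<lambda>v. Y v \<omega>) (scaled N x) (scaled N y)
       \<and> last_passage (\<lambda>v. Y v \<omega>) (scaled N x) (scaled N y) \<le> real N * (?\<Phi> + 1 / Suc q)) sequentially" by blast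
      then show "eventually (\<lambda>N. dist (lpp_G Y (scaled N x) (scaled N y) \<omega> / real N) ?\<Phi> < \<epsilon>) sequentially"
        using eventually_scaled_pos[OF xy(1)] eventually_scaled_pos[OF xy(2)] eventually_gt_at_top[of 0]
      proof eventually_elim
        case (elim N)
        let ?L = "last_passage (\<lambda>v. Y v \<omega>) (scaled N x) (scaled N y)"
        have "?\<Phi> - 1 / Suc q \<le> ?L / N" "?L / N \<le> ?\<Phi> + 1 / Suc q"
          using elim by (simp_all add: pos_le_divide_eq pos_divide_le_eq mult.commute)
        then have "\<bar>?L / N - ?\<Phi>\<bar> < \<epsilon>" using q by linarith
        then show ?case
          unfolding lpp_G_eq_last_passage[where Y = Y and \<omega> = \<omega>, OF nY elim(2,3)] dist_real_def .
      qed
    qed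
  qed
qed

end

lemma (in prob_space) exponential_distributed_scale:
  assumes "0 < l" and D: "distributed M lborel Z (exponential_density l)"
  shows "distributed M lborel (\<lambda>\<omega>. l * Z \<omega>) (exponential_density 1)"
proof -
  have Z: "Z \<in> borel_measurable M" and P: "\<And>a. 0 \<le> a \<Longrightarrow> prob {\<omega>\<in>space M. Z \<omega> \<le> a} = 1 - exp (- a * l)"
    using exponential_distributed_iff[OF assms(1)] D by auto
  have "prob {\<omega>\<in>space M. l * Z \<omega> \<le> a} = 1 - exp (- a * 1)" if "0 \<le> a" for a
  proof -
    have "{\<omega>\<in>space M. l * Z \<omega> \<le> a} = {\<omega>\<in>space M. Z \<omega> \<le> a / l}"
      using assms(1) by (auto simp: pos_le_divide_eq mult.commute)
    then show ?thesis using P[of "a / l"] that assms(1) by simp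
  qed
  then show ?thesis using Z by (subst exponential_distributed_iff) auto
qed

theorem mainTheorem1:
  fixes M :: "'a measure" and Y :: "nat \<times> nat \<Rightarrow> 'a \<Rightarrow> real"
    and c1 c2 :: real
  assumes "prob_space M"
    and "c1 \<ge> c2" and "c2 > 0"
    and "prob_space.indep_vars M (\<lambda>_. borel) Y Nsq"
    and "\<And>v. v \<in> Nsq \<Longrightarrow> distributed M lborel (Y v) (exponential_density (lpp_rate c1 c2 v))"
  shows "\<forall>x y. x > 0 \<longrightarrow> y > 0 \<longrightarrow>
    (AE \<omega> in M. (\<lambda>n. lpp_G Y (nat \<lfloor>real n * x\<rfloor>) (nat \<lfloor>real n * y\<rfloor>) \<omega> / real n)
        \<longlonglongrightarrow> lpp_Phi c1 c2 x y)"
proof -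
  interpret prob_space M by fact
  have pos: "0 < lpp_rate c1 c2 v" for v
    using assms(2,3) by (auto simp: lpp_rate_def split: prod.splits)
  define X where "X v \<omega> = lpp_rate c1 c2 v * Y v \<omega>" for v \<omega>
  interpret two_phase M X Y c1 c2
  proof
    show "indep_vars (\<lambda>_. borel) X Nsq"
      unfolding X_def by (rule indep_vars_compose2[OF assms(4)]) simp
    show "distributed M lborel (X v) (exponential_density 1)" if "v \<in> Nsq" for v
      unfolding X_def by (rule exponential_distributed_scale[OF pos assms(5)[OF that]])
    show "Y v \<omega> = X v \<omega> / lpp_rate c1 c2 v" for v \<omega>
      using pos[of v] by (simp add: X_def)
  qed (use assms in auto)
  show ?thesis using AE_limit by simp
qed

end
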